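(* Let $P$ and $Q$ be Hilbert spaces of dimensions $p,q$ over the quaternion field $\mathbb{H}$ with $q\geq p\geq 2$, and let $C=\mathcal{L}(P,Q)$ be a type $I_{2p,2q}^{\mathbb{H}}$ real Cartan factor. Let $I$ be a weak$^*$-closed subtriple of $C$ which is weak$^*$-Hahn--Banach smooth in $C$ and has rank $\geq 2$. Then $I$ is an inner ideal of $C$.
   Context: $\mathcal{L}(P,Q)$ is the real Banach space of bounded $\mathbb{H}$-linear operators from $P$ to $Q$ with the operator norm and the triple product $\{a,b,c\}=\frac12(ab^*c+cb^*a)$; it is a real JBW$^*$-triple, i.e. a real JB$^*$-triple (a norm-closed real subtriple of a complex JB$^*$-triple) which is a dual Banach space, with a unique isometric predual $C_*$ and separately weak$^*$-continuous triple product. A subtriple is a (real) linear subspace closed under the triple product. A weak$^*$-closed subspace $Z$ of a dual Banach space $X$ with predual $X_*$ is weak$^*$-Hahn--Banach smooth if every weak$^*$-continuous functional on $Z$ admits a unique norm-preserving extension to a functional in $X_*$ (a weak$^*$-continuous functional on $X$). Elements $x,y$ are orthogonal if $\{x,y,z\}=0$ for all $z$ (equivalently $\{x,x,y\}=0$). A subset $S$ of a real JB$^*$-triple is orthogonal if $0\notin S$ and any two distinct elements of $S$ are orthogonal; the rank of a real JB$^*$-triple is the minimal cardinal $m$ such that $\mathrm{card}(S)\le m$ for every orthogonal subset $S$. An inner ideal of $C$ is a closed subtriple $I$ with $\{I,C,I\}\subseteq I$. *)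

theory Defs
  imports "HOL-Analysis.Analysis"
begin

unbundle cardinal_syntax

section \<open>The quaternion division ring\<close>

datatype quat = Quat (qRe: real) (qI: real) (qJ: real) (qK: real)

lemma quat_eq_iff: "x = y \<longleftrightarrow> qRe x = qRe y \<and> qI x = qI y \<and> qJ x = qJ y \<and> qK x = qK y"
  by (cases x; cases y) simp

instantiation quat :: real_vector
begin

definition "0 = Quat 0 0 0 0"
definition "x + y = Quat (qRe x + qRe y) (qI x + qI y) (qJ x + qJ y) (qK x + qK y)"
definition "x - y = Quat (qRe x - qRe y) (qI x - qI y) (qJ x - qJ y) (qK x - qK y)"
definition "- x = Quat (- qRe x) (- qI x) (- qJ x) (- qK x)"
definition "r *\<^sub>R x = Quat (r * qRe x) (r * qI x) (r * qJ x) (r * qK x)"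

instance
  by standard
    (auto simp: zero_quat_def plus_quat_def minus_quat_def uminus_quat_def scaleR_quat_def
      quat_eq_iff algebra_simps)

end

definition qcnj :: "quat \<Rightarrow> quat" where
  "qcnj x = Quat (qRe x) (- qI x) (- qJ x) (- qK x)"

definition qnorm2 :: "quat \<Rightarrow> real" where
  "qnorm2 x = (qRe x)\<^sup>2 + (qI x)\<^sup>2 + (qJ x)\<^sup>2 + (qK x)\<^sup>2"

lemma qnorm2_eq_0_iff: "qnorm2 x = 0 \<longleftrightarrow> x = 0"
  by (auto simp: qnorm2_def zero_quat_def quat_eq_iff add_nonneg_eq_0_iff)

instantiation quat :: "{real_algebra_1, division_ring}"
begin

definition "1 = Quat 1 0 0 0"
definition "x * y = Quat
   (qRe x * qRe y - qI x * qI y - qJ x * qJ y - qK x * qK y)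
   (qRe x * qI y + qI x * qRe y + qJ x * qK y - qK x * qJ y)
   (qRe x * qJ y - qI x * qK y + qJ x * qRe y + qK x * qI y)
   (qRe x * qK y + qI x * qJ y - qJ x * qI y + qK x * qRe y)"
definition "inverse (x::quat) = inverse (qnorm2 x) *\<^sub>R qcnj x"
definition "x div (y::quat) = x * inverse y"

instance
proof
  fix x y z :: quat and r :: real
  show "x * y * z = x * (y * z)"
    by (simp add: times_quat_def quat_eq_iff algebra_simps)
  show "1 * x = x" "x * 1 = x"
    by (simp_all add: times_quat_def one_quat_def quat_eq_iff)
  show "(x + y) * z = x * z + y * z" "x * (y + z) = x * y + x * z"
    by (simp_all add: times_quat_def plus_quat_def quat_eq_iff algebra_simps)
  show "r *\<^sub>R x * y = r *\<^sub>R (x * y)" "x * r *\<^sub>R y = r *\<^sub>R (x * y)"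
    by (simp_all add: times_quat_def scaleR_quat_def quat_eq_iff algebra_simps)
  show "(0::quat) \<noteq> 1"
    by (simp add: zero_quat_def one_quat_def)
  show "x div y = x * inverse y"
    by (rule divide_quat_def)
  show "inverse (0::quat) = 0"
    by (simp add: inverse_quat_def qnorm2_eq_0_iff)
  assume "x \<noteq> 0"
  then have "qnorm2 x \<noteq> 0"
    by (simp add: qnorm2_eq_0_iff)
  moreover have "qcnj x * x = qnorm2 x *\<^sub>R 1" "x * qcnj x = qnorm2 x *\<^sub>R 1"
    by (simp_all add: times_quat_def qcnj_def qnorm2_def scaleR_quat_def one_quat_def
        quat_eq_iff power2_eq_square)
  moreover have "(a *\<^sub>R u) * v = a *\<^sub>R (u * v)" "u * (a *\<^sub>R v) = a *\<^sub>R (u * v)" for a and u v :: quat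
    by (simp_all add: times_quat_def scaleR_quat_def quat_eq_iff algebra_simps)
  ultimately show "inverse x * x = 1" "x * inverse x = 1"
    by (simp_all add: inverse_quat_def)
qed

end


section \<open>Hilbert spaces over the quaternions\<close>

text \<open>Scalars act on the right, so that linear operators (written on the left) commute with
  them. The inner product is linear in its second argument; its real part is the inner product
  of the underlying real Hilbert space, so that the norm of \<^term>\<open>x\<close> is the square root
  of \<open>hinner x x\<close>, and completeness refers to this norm.\<close>

class quat_hilbert = real_inner + complete_space +
  fixes scaleH :: "'a \<Rightarrow> quat \<Rightarrow> 'a"  (infixl \<open>*\<^sub>H\<close> 75)
    and hinner :: "'a \<Rightarrow> 'a \<Rightarrow> quat"
  assumes scaleH_add_left: "(x + y) *\<^sub>H c = x *\<^sub>H c + y *\<^sub>H c"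
    and scaleH_add_right: "x *\<^sub>H (c + d) = x *\<^sub>H c + x *\<^sub>H d"
    and scaleH_scaleH: "x *\<^sub>H (c * d) = (x *\<^sub>H c) *\<^sub>H d"
    and scaleH_of_real: "x *\<^sub>H (of_real r) = r *\<^sub>R x"
    and hinner_add_right: "hinner x (y + z) = hinner x y + hinner x z"
    and hinner_scaleH_right: "hinner x (y *\<^sub>H c) = hinner x y * c"
    and hinner_commute: "hinner y x = qcnj (hinner x y)"
    and inner_eq_qRe_hinner: "inner x y = qRe (hinner x y)"

subclass (in quat_hilbert) banach ..

text \<open>The dimension is the cardinality of an orthonormal basis, that is, of a maximal
  orthonormal set; it may be infinite.\<close>

definition orthonormal_basis :: "'a::quat_hilbert set \<Rightarrow> bool" where
  "orthonormal_basis B \<longleftrightarrow>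
     (\<forall>x\<in>B. hinner x x = 1) \<and>
     (\<forall>x\<in>B. \<forall>y\<in>B. x \<noteq> y \<longrightarrow> hinner x y = 0) \<and>
     (\<forall>z. (\<forall>x\<in>B. hinner x z = 0) \<longrightarrow> z = 0)"

definition hdim :: "'a::quat_hilbert itself \<Rightarrow> 'a rel" where
  "hdim _ = |SOME B. orthonormal_basis B|"


section \<open>The real Cartan factor of bounded quaternion-linear operators\<close>

typedef (overloaded) ('a, 'b) hop =
  "{T :: 'a::quat_hilbert \<Rightarrow>\<^sub>L 'b::quat_hilbert. \<forall>x c. T (x *\<^sub>H c) = T x *\<^sub>H c}"
  morphisms blinfun_of_hop Hop
proof
  have "(0::'b) *\<^sub>H c = 0" for c
    using scaleH_add_left[of "0::'b" 0 c] by simp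
  then show "0 \<in> {T :: 'a \<Rightarrow>\<^sub>L 'b. \<forall>x c. T (x *\<^sub>H c) = T x *\<^sub>H c}"
    by simp
qed

setup_lifting type_definition_hop

lift_definition hop_apply :: "('a::quat_hilbert, 'b::quat_hilbert) hop \<Rightarrow> 'a \<Rightarrow> 'b"
  is blinfun_apply .

lemma scaleH_scaleR: "(r *\<^sub>R x) *\<^sub>H c = r *\<^sub>R (x *\<^sub>H c)" for x :: "'a::quat_hilbert"
proof -
  have "(of_real r :: quat) * c = c * of_real r"
    by (simp add: of_real_def)
  then show ?thesis
    by (metis scaleH_of_real scaleH_scaleH)
qed

lemma scaleH_minus: "(- x) *\<^sub>H c = - (x *\<^sub>H c)" for x :: "'a::quat_hilbert"
  using scaleH_scaleR[of "-1" x c] by simp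

lemma scaleH_diff: "(x - y) *\<^sub>H c = x *\<^sub>H c - y *\<^sub>H c" for x :: "'a::quat_hilbert"
  using scaleH_add_left[of x "- y" c] by (simp add: scaleH_minus)

instantiation hop :: (quat_hilbert, quat_hilbert) real_vector
begin

lift_definition zero_hop :: "('a, 'b) hop" is 0
  using scaleH_scaleR[of 0] by simp

lift_definition plus_hop :: "('a, 'b) hop \<Rightarrow> ('a, 'b) hop \<Rightarrow> ('a, 'b) hop" is "(+)"
  by (simp add: blinfun.add_left scaleH_add_left)

lift_definition minus_hop :: "('a, 'b) hop \<Rightarrow> ('a, 'b) hop \<Rightarrow> ('a, 'b) hop" is "(-)"
  by (simp add: blinfun.diff_left scaleH_diff)

lift_definition uminus_hop :: "('a, 'b) hop \<Rightarrow> ('a, 'b) hop" is uminus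
  by (simp add: blinfun.minus_left scaleH_minus)

lift_definition scaleR_hop :: "real \<Rightarrow> ('a, 'b) hop \<Rightarrow> ('a, 'b) hop" is "(*\<^sub>R)"
  by (simp add: blinfun.scaleR_left scaleH_scaleR)

instance
proof
  fix S T U :: "('a, 'b) hop" and r s :: real
  show "S + T + U = S + (T + U)" "S + T = T + S" "0 + S = S" "- S + S = 0" "S - T = S + - T"
    by (transfer; simp add: add_ac)+
  show "r *\<^sub>R (S + T) = r *\<^sub>R S + r *\<^sub>R T" "(r + s) *\<^sub>R S = r *\<^sub>R S + s *\<^sub>R S"
    "r *\<^sub>R s *\<^sub>R S = (r * s) *\<^sub>R S" "1 *\<^sub>R S = S"
    by (transfer; simp add: algebra_simps)+
qed

end

instantiation hop :: (quat_hilbert, quat_hilbert) real_normed_vector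
begin

lift_definition norm_hop :: "('a, 'b) hop \<Rightarrow> real" is norm .

definition "sgn (S::('a, 'b) hop) = S /\<^sub>R norm S"
definition "dist (S::('a, 'b) hop) T = norm (S - T)"
definition "uniformity =
  (INF e\<in>{0<..}. principal {(S::('a, 'b) hop, T). dist S T < e})"
definition "open (U :: ('a, 'b) hop set) \<longleftrightarrow>
  (\<forall>S\<in>U. \<forall>\<^sub>F (S', T) in uniformity. S' = S \<longrightarrow> T \<in> U)"

instance
proof
  fix S T :: "('a, 'b) hop" and r :: real
  show "norm S = 0 \<longleftrightarrow> S = 0" "norm (S + T) \<le> norm S + norm T"
    "norm (r *\<^sub>R S) = \<bar>r\<bar> * norm S"
    by (transfer; simp add: norm_triangle_ineq)+
qed (fact sgn_hop_def dist_hop_def uniformity_hop_def open_hop_def)+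

end

lemma bounded_linear_scaleH: "bounded_linear (\<lambda>x :: 'a::quat_hilbert. x *\<^sub>H c)"
proof (rule bounded_linear_intro[where K = "sqrt (qnorm2 c)"])
  fix x y :: 'a and r :: real
  show "(x + y) *\<^sub>H c = x *\<^sub>H c + y *\<^sub>H c"
    by (rule scaleH_add_left)
  show "(r *\<^sub>R x) *\<^sub>H c = r *\<^sub>R (x *\<^sub>H c)"
    by (rule scaleH_scaleR)
  have real: "qI (hinner x x) = 0" "qJ (hinner x x) = 0" "qK (hinner x x) = 0"
    using hinner_commute[of x x] by (simp_all add: qcnj_def quat_eq_iff)
  have "hinner (x *\<^sub>H c) x = qcnj (hinner x x * c)"
    by (metis hinner_commute hinner_scaleH_right)
  then have "hinner (x *\<^sub>H c) (x *\<^sub>H c) = qcnj (hinner x x * c) * c"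
    by (simp add: hinner_scaleH_right)
  then have "inner (x *\<^sub>H c) (x *\<^sub>H c) = inner x x * qnorm2 c"
    by (simp add: inner_eq_qRe_hinner times_quat_def qcnj_def qnorm2_def real
        power2_eq_square algebra_simps)
  then show "norm (x *\<^sub>H c) \<le> norm x * sqrt (qnorm2 c)"
    by (simp add: norm_eq_sqrt_inner real_sqrt_mult)
qed

instance hop :: (quat_hilbert, quat_hilbert) banach
proof
  fix X :: "nat \<Rightarrow> ('a, 'b) hop"
  assume "Cauchy X"
  have dist_eq: "dist S T = dist (blinfun_of_hop S) (blinfun_of_hop T)" for S T :: "('a, 'b) hop"
    by (simp add: dist_norm norm_hop.rep_eq minus_hop.rep_eq)
  have "Cauchy (\<lambda>n. blinfun_of_hop (X n))"
    using \<open>Cauchy X\<close> by (simp add: Cauchy_def dist_eq)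
  then have "convergent (\<lambda>n. blinfun_of_hop (X n))"
    by (rule Cauchy_convergent)
  then obtain L where L: "(\<lambda>n. blinfun_of_hop (X n)) \<longlonglongrightarrow> L"
    unfolding convergent_def by (rule exE)
  have "L (x *\<^sub>H c) = L x *\<^sub>H c" for x c
  proof (rule LIMSEQ_unique)
    show "(\<lambda>n. blinfun_of_hop (X n) (x *\<^sub>H c)) \<longlonglongrightarrow> L (x *\<^sub>H c)"
      by (rule blinfun.tendsto[OF L tendsto_const])
    have "(\<lambda>n. blinfun_of_hop (X n) x *\<^sub>H c) \<longlonglongrightarrow> L x *\<^sub>H c"
      by (rule bounded_linear.tendsto[OF bounded_linear_scaleH blinfun.tendsto[OF L tendsto_const]])
    moreover have "blinfun_of_hop (X n) (x *\<^sub>H c) = blinfun_of_hop (X n) x *\<^sub>H c" for n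
      using blinfun_of_hop[of "X n"] by simp
    ultimately show "(\<lambda>n. blinfun_of_hop (X n) (x *\<^sub>H c)) \<longlonglongrightarrow> L x *\<^sub>H c"
      by simp
  qed
  then have "blinfun_of_hop (Hop L) = L"
    by (simp add: Hop_inverse)
  then have "X \<longlonglongrightarrow> Hop L"
    using L by (simp add: tendsto_iff dist_eq)
  then show "convergent X"
    by (rule convergentI)
qed

lift_definition hop_compose ::
  "('b::quat_hilbert, 'c::quat_hilbert) hop \<Rightarrow> ('a::quat_hilbert, 'b) hop \<Rightarrow> ('a, 'c) hop"
  is "(o\<^sub>L)"
  by simp

definition hop_adjoint ::
  "('a::quat_hilbert, 'b::quat_hilbert) hop \<Rightarrow> ('b, 'a) hop" where
  "hop_adjoint T =
     (THE S. \<forall>x y. hinner (hop_apply T x) y = hinner x (hop_apply S y))"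

definition triple_product ::
  "('a::quat_hilbert, 'b::quat_hilbert) hop \<Rightarrow> ('a, 'b) hop \<Rightarrow> ('a, 'b) hop \<Rightarrow> ('a, 'b) hop"
  where
  "triple_product a b c = (1/2) *\<^sub>R
     (hop_compose a (hop_compose (hop_adjoint b) c) +
      hop_compose c (hop_compose (hop_adjoint b) a))"

definition subtriple :: "('a::quat_hilbert, 'b::quat_hilbert) hop set \<Rightarrow> bool" where
  "subtriple I \<longleftrightarrow> subspace I \<and> (\<forall>a\<in>I. \<forall>b\<in>I. \<forall>c\<in>I. triple_product a b c \<in> I)"

definition inner_ideal :: "('a::quat_hilbert, 'b::quat_hilbert) hop set \<Rightarrow> bool" where
  "inner_ideal I \<longleftrightarrow>
     subtriple I \<and> closed I \<and> (\<forall>a\<in>I. \<forall>b. \<forall>c\<in>I. triple_product a b c \<in> I)"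


section \<open>Rank\<close>

text \<open>Orthogonality and rank are taken inside the subtriple \<open>I\<close>, regarded as a real
  JB*-triple in its own right.\<close>

definition triple_orthogonal ::
  "('a::quat_hilbert, 'b::quat_hilbert) hop set \<Rightarrow> ('a, 'b) hop \<Rightarrow> ('a, 'b) hop \<Rightarrow> bool" where
  "triple_orthogonal I x y \<longleftrightarrow> (\<forall>z\<in>I. triple_product x y z = 0)"

definition orthogonal_subset ::
  "('a::quat_hilbert, 'b::quat_hilbert) hop set \<Rightarrow> ('a, 'b) hop set \<Rightarrow> bool" where
  "orthogonal_subset I S \<longleftrightarrow> S \<subseteq> I \<and> 0 \<notin> S \<and>
     (\<forall>x\<in>S. \<forall>y\<in>S. x \<noteq> y \<longrightarrow> triple_orthogonal I x y)"

text \<open>The least cardinal bounding all orthogonal subsets. It can be sought among the cardinals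
  on the type of operators itself, since the cardinality of this type is a bound; it is
  determined up to \<open>=o\<close>.\<close>

definition is_triple_rank ::
  "('a::quat_hilbert, 'b::quat_hilbert) hop set \<Rightarrow> ('a, 'b) hop rel \<Rightarrow> bool" where
  "is_triple_rank I m \<longleftrightarrow>
     Card_order m \<and> (\<forall>S. orthogonal_subset I S \<longrightarrow> |S| \<le>o m) \<and>
     (\<forall>m' :: ('a, 'b) hop rel.
        Card_order m' \<and> (\<forall>S. orthogonal_subset I S \<longrightarrow> |S| \<le>o m') \<longrightarrow> m \<le>o m')"

definition triple_rank ::
  "('a::quat_hilbert, 'b::quat_hilbert) hop set \<Rightarrow> ('a, 'b) hop rel" where
  "triple_rank I = (SOME m. is_triple_rank I m)"


section \<open>Preduals and weak* Hahn--Banach smoothness\<close>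

definition linear_functional_on :: "'x::real_vector set \<Rightarrow> ('x \<Rightarrow> real) \<Rightarrow> bool" where
  "linear_functional_on Z g \<longleftrightarrow>
     (\<forall>x\<in>Z. \<forall>y\<in>Z. g (x + y) = g x + g y) \<and> (\<forall>r. \<forall>x\<in>Z. g (r *\<^sub>R x) = r * g x)"

definition bounded_functional_on :: "'x::real_normed_vector set \<Rightarrow> ('x \<Rightarrow> real) \<Rightarrow> bool" where
  "bounded_functional_on Z g \<longleftrightarrow>
     linear_functional_on Z g \<and> (\<exists>K. \<forall>x\<in>Z. \<bar>g x\<bar> \<le> K * norm x)"

definition functional_norm_on :: "'x::real_normed_vector set \<Rightarrow> ('x \<Rightarrow> real) \<Rightarrow> real" where
  "functional_norm_on Z g = (SUP x\<in>{x\<in>Z. norm x \<le> 1}. \<bar>g x\<bar>)"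

text \<open>An isometric predual of \<open>X\<close> is a Banach space whose dual is \<open>X\<close>. Through its canonical
  embedding into the bidual it is identified with a norm-closed subspace \<open>F\<close> of the dual
  of \<open>X\<close> for which evaluation is an isometric isomorphism of \<open>X\<close> onto the dual of \<open>F\<close>.
  For a real JBW*-triple such an \<open>F\<close> exists and is unique, so one may speak of its predual by
  quantifying over \<open>F\<close>.\<close>

definition isometric_predual :: "('x::real_normed_vector \<Rightarrow>\<^sub>L real) set \<Rightarrow> bool" where
  "isometric_predual F \<longleftrightarrow>
     subspace F \<and> closed F \<and>
     (\<forall>x. functional_norm_on F (\<lambda>f. blinfun_apply f x) = norm x) \<and>
     (\<forall>g. bounded_functional_on F g \<longrightarrow> (\<exists>x. \<forall>f\<in>F. g f = blinfun_apply f x))"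

definition weak_star_topology :: "('x::real_normed_vector \<Rightarrow>\<^sub>L real) set \<Rightarrow> 'x topology" where
  "weak_star_topology F =
     topology_generated_by {blinfun_apply f -` U | f U. f \<in> F \<and> open U}"

definition weak_star_HB_smooth ::
  "('x::real_normed_vector \<Rightarrow>\<^sub>L real) set \<Rightarrow> 'x set \<Rightarrow> bool" where
  "weak_star_HB_smooth F Z \<longleftrightarrow>
     subspace Z \<and> closedin (weak_star_topology F) Z \<and>
     (\<forall>g. linear_functional_on Z g \<and>
          continuous_map (subtopology (weak_star_topology F) Z) euclideanreal g \<longrightarrow>
          (\<exists>!f. f \<in> F \<and> (\<forall>z\<in>Z. blinfun_apply f z = g z) \<and>
                norm f = functional_norm_on Z g))"

end

(*
  The norm of L(P,Q) is Frechet differentiable at a rank one partial isometry, so every isometric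
  predual F contains the matrix coefficients x |-> Re <b, x a>; by Hahn-Banach it is their closed
  span. If f in F attains its norm on the subtriple at a, it also attains it at the odd powers
  a (a* a)^n and hence at their strong limit, which is a tripotent.

  Let e be a tripotent of I. By smoothness, normal states of the corner of e that agree on I are
  equal, and by polarization differences of such states are dense in the self-adjoint part of the
  predual of the corner. Hence I contains the whole self-adjoint part of the corner, in particular
  all rank one operators below e. Two orthogonal rank one operators e1, e2 in I then give, through
  e1 + e2 and e1 - e2, all operators of the 2 x 2 block they span. This propagates to all rank one
  operators from the initial space to the final space of I, and these generate {I, C, I}.
*)

theory Submission
  imports Defs
begin

text \<open>Scalars are real, so a functional that attains its norm at a tripotent e sees only the
  self-adjoint part of the corner of e, and smoothness is silent about the skew part. Rank one
  cannot repair this: the real line through a single rank one partial isometry is smooth but no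
  inner ideal. With two orthogonal rank one operators, the free choice of a relative sign isolates
  the off-diagonal entries. Density of differences of states does not by itself put the self-adjoint
  corner into I, because a difference k = f - g might be large in norm and small on I. The remedy is
  to extend the restriction of k to I minimally. The extension k' attains its norm at a tripotent of
  I, hence has a Jordan decomposition f' - g'. Now f + g' and f' + g are positive and agree on I, so
  they are equal and k = k'. Thus the norm of k is attained on I, and a functional annihilating I
  that is close to such k on the corner is small there. Spectral theory is replaced by algebra:
  tripotents are limits of iterated cubes, and the spectral projections of the Jordan decomposition
  are explicit expressions in e and u.\<close>

section \<open>Hilbert space and Hahn--Banach preliminaries\<close>

lemma power2_norm_diff_scaleR:
  "(norm (x - (y + s *\<^sub>R z)))\<^sup>2 = (norm (x - y))\<^sup>2 - 2 * s * inner (x - y) z + s\<^sup>2 * (norm z)\<^sup>2"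
  for x :: "'a::real_inner"
proof -
  have "x - (y + s *\<^sub>R z) = (x - y) - s *\<^sub>R z"
    by simp
  moreover have "(norm (u - s *\<^sub>R z))\<^sup>2 = (norm u)\<^sup>2 - 2 * s * inner u z + s\<^sup>2 * (norm z)\<^sup>2" for u
    unfolding power2_norm_eq_inner
    by (simp add: power2_eq_square inner_diff_left inner_diff_right inner_commute[of z u] algebra_simps)
  ultimately show ?thesis
    by metis
qed

lemma closed_subspace_projection:
  fixes V :: "'a::{real_inner,complete_space} set"
  assumes V: "subspace V" "closed V"
  obtains y where "y \<in> V" "\<And>z. z \<in> V \<Longrightarrow> inner (x - y) z = 0"
proof -
  define d where "d = (INF v\<in>V. (norm (x - v))\<^sup>2)"
  have V0: "V \<noteq> {}"
    using subspace_0[OF V(1)] by auto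
  have bdd: "bdd_below ((\<lambda>v. (norm (x - v))\<^sup>2) ` V)"
    by (rule bdd_belowI[of _ 0]) auto
  have d_le: "d \<le> (norm (x - v))\<^sup>2" if "v \<in> V" for v
    unfolding d_def by (rule cINF_lower[OF bdd that])
  have "\<exists>v\<in>V. (norm (x - v))\<^sup>2 < d + inverse (real (Suc n))" for n
  proof (rule ccontr)
    assume "\<not> ?thesis"
    then have "d + inverse (real (Suc n)) \<le> d"
      unfolding d_def by (intro cINF_greatest V0) (auto simp: not_less d_def)
    then show False
      by (simp add: field_simps)
  qed
  then obtain v where v: "\<And>n. v n \<in> V" "\<And>n. (norm (x - v n))\<^sup>2 < d + inverse (real (Suc n))"
    by metis
  \<comment> \<open>Parallelogram law: the midpoint of two points of V lies in V, so its squared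
    distance to x is at least d.\<close>
  have par: "(norm (v m - v n))\<^sup>2 \<le> 2 * inverse (real (Suc m)) + 2 * inverse (real (Suc n))" for m n
  proof -
    have "d \<le> (norm (x - (1/2) *\<^sub>R (v m + v n)))\<^sup>2"
      by (intro d_le subspace_scale subspace_add V v)
    moreover have "(norm (v m - v n))\<^sup>2 = 2 * (norm (x - v m))\<^sup>2 + 2 * (norm (x - v n))\<^sup>2
        - 4 * (norm (x - (1/2) *\<^sub>R (v m + v n)))\<^sup>2"
      by (simp add: power2_norm_eq_inner inner_diff inner_add inner_commute algebra_simps)
    ultimately show ?thesis
      using v(2)[of m] v(2)[of n] by linarith
  qed
  have "Cauchy v"
  proof (rule metric_CauchyI)
    fix e :: real assume e: "e > 0"
    obtain N where N: "inverse (real (Suc N)) < e\<^sup>2 / 4"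
      using reals_Archimedean[of "e\<^sup>2 / 4"] e by auto
    have "dist (v m) (v n) < e" if "m \<ge> N" "n \<ge> N" for m n
    proof -
      have "inverse (real (Suc m)) \<le> inverse (real (Suc N))" "inverse (real (Suc n)) \<le> inverse (real (Suc N))"
        using that by (auto intro!: le_imp_inverse_le)
      then have "(norm (v m - v n))\<^sup>2 < e\<^sup>2"
        using par[of m n] N by linarith
      then show ?thesis
        using e by (simp add: dist_norm power_less_imp_less_base)
    qed
    then show "\<exists>M. \<forall>m\<ge>M. \<forall>n\<ge>M. dist (v m) (v n) < e"
      by blast
  qed
  then obtain y where y: "v \<longlonglongrightarrow> y"
    using Cauchy_convergent convergent_def by blast
  have yV: "y \<in> V"
    using V(2) v(1) y closed_sequentially by blast
  have "(\<lambda>n. (norm (x - v n))\<^sup>2) \<longlonglongrightarrow> (norm (x - y))\<^sup>2"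
    by (intro tendsto_intros y)
  moreover have "(\<lambda>n. d + inverse (real (Suc n))) \<longlonglongrightarrow> d + 0"
    by (intro tendsto_intros LIMSEQ_inverse_real_of_nat)
  ultimately have "(norm (x - y))\<^sup>2 \<le> d + 0"
    by (rule LIMSEQ_le) (use v(2) less_imp_le in blast)
  then have min: "(norm (x - y))\<^sup>2 \<le> (norm (x - w))\<^sup>2" if "w \<in> V" for w
    using d_le[OF that] by linarith
  have "inner (x - y) z = 0" if z: "z \<in> V" for z
  proof (cases "z = 0")
    case False
    \<comment> \<open>The minimizer of the quadratic in
      \<open>power2_norm_diff_scaleR\<close>.\<close>
    define s where "s = inner (x - y) z / (norm z)\<^sup>2"
    have "(norm (x - y))\<^sup>2 \<le> (norm (x - (y + s *\<^sub>R z)))\<^sup>2"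
      by (intro min subspace_add subspace_scale V yV z)
    also have "\<dots> = (norm (x - y))\<^sup>2 - 2 * s * inner (x - y) z + s\<^sup>2 * (norm z)\<^sup>2"
      by (rule power2_norm_diff_scaleR)
    also have "\<dots> = (norm (x - y))\<^sup>2 - (inner (x - y) z)\<^sup>2 / (norm z)\<^sup>2"
      using False by (simp add: s_def power2_eq_square field_simps)
    finally have "(inner (x - y) z)\<^sup>2 / (norm z)\<^sup>2 \<le> 0"
      by simp
    then show ?thesis
      using False by (simp add: divide_le_0_iff)
  qed simp
  then show thesis
    by (rule that[OF yV])
qed

lemma riesz_representation:
  fixes f :: "'a::{real_inner,complete_space} \<Rightarrow> real"
  assumes f: "bounded_linear f"
  obtains y where "\<And>x. f x = inner y x"
proof (cases "\<forall>x. f x = 0")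
  case True
  then show thesis using that[of 0] by simp
next
  case False
  then obtain x0 where x0: "f x0 \<noteq> 0" by blast
  interpret f: bounded_linear f by fact
  define V where "V = {x. f x = 0}"
  have "subspace V"
    by (auto simp: V_def subspace_def f.add f.scaleR)
  moreover have "closed V"
    unfolding V_def by (intro closed_Collect_eq continuous_intros f.continuous_on)
  ultimately obtain y0 where y0: "y0 \<in> V" "\<And>z. z \<in> V \<Longrightarrow> inner (x0 - y0) z = 0"
    by (rule closed_subspace_projection) blast
  define w where "w = x0 - y0"
  have fw: "f w = f x0"
    using y0(1) by (simp add: w_def f.diff V_def)
  then have w: "w \<noteq> 0"
    using x0 f.zero by auto
  have "f x = inner ((f w / (norm w)\<^sup>2) *\<^sub>R w) x" for x
  proof -
    have "f (f w *\<^sub>R x - f x *\<^sub>R w) = 0"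
      by (simp add: f.diff f.scaleR)
    then have "inner w (f w *\<^sub>R x - f x *\<^sub>R w) = 0"
      using y0(2) by (simp add: V_def w_def)
    then have "f w * inner w x = f x * (norm w)\<^sup>2"
      by (simp add: inner_diff_right power2_norm_eq_inner)
    then show ?thesis
      using w by (simp add: field_simps)
  qed
  then show thesis
    using that by blast
qed

text \<open>Functionals are handled as graphs, so that extension is inclusion of subspaces and
  Zorn's lemma applies directly. The bound by the norm forces such a subspace to be single valued,
  since the difference of two values at x is a value at 0.\<close>

lemma hahn_banach_graph:
  fixes G :: "('a::real_normed_vector \<times> real) set"
  assumes G: "subspace G" and le: "\<And>x t. (x, t) \<in> G \<Longrightarrow> t \<le> norm x"
  shows "\<exists>g :: 'a \<Rightarrow>\<^sub>L real. norm g \<le> 1 \<and> (\<forall>x t. (x, t) \<in> G \<longrightarrow> blinfun_apply g x = t)"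
proof -
  define A where "A = {H. subspace H \<and> G \<subseteq> H \<and> (\<forall>x t. (x, t) \<in> H \<longrightarrow> t \<le> norm x)}"
  have "\<Union>\<C> \<in> A" if "\<C> \<noteq> {}" "subset.chain A \<C>" for \<C>
  proof -
    have sub: "subspace H" if "H \<in> \<C>" for H
      using \<open>subset.chain A \<C>\<close> that by (auto simp: subset_chain_def A_def)
    have "u + v \<in> \<Union>\<C>" if uv: "u \<in> \<Union>\<C>" "v \<in> \<Union>\<C>" for u v
    proof -
      obtain H K where HK: "H \<in> \<C>" "K \<in> \<C>" "u \<in> H" "v \<in> K"
        using uv by blast
      then have "H \<subseteq> K \<or> K \<subseteq> H"
        using \<open>subset.chain A \<C>\<close> by (auto simp: subset_chain_def)
      then show ?thesis
        using HK sub subspace_add by blast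
    qed
    moreover have "0 \<in> \<Union>\<C>"
    proof -
      obtain H where "H \<in> \<C>"
        using \<open>\<C> \<noteq> {}\<close> by blast
      then show ?thesis
        using subspace_0[OF sub] by blast
    qed
    moreover have "c *\<^sub>R u \<in> \<Union>\<C>" if u: "u \<in> \<Union>\<C>" for c u
    proof -
      obtain H where "H \<in> \<C>" "u \<in> H"
        using u by blast
      then show ?thesis
        using subspace_scale[OF sub] by blast
    qed
    ultimately have "subspace (\<Union>\<C>)"
      by (simp add: subspace_def)
    then show ?thesis
      using that by (auto simp: A_def subset_chain_def)
  qed
  moreover have "A \<noteq> {}"
    using G le by (auto simp: A_def)
  ultimately obtain M where M: "M \<in> A" and max: "\<And>H. H \<in> A \<Longrightarrow> M \<subseteq> H \<Longrightarrow> H = M"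
    using subset_Zorn_nonempty[of A] by blast
  have subM: "subspace M" and GM: "G \<subseteq> M" and leM: "\<And>x t. (x, t) \<in> M \<Longrightarrow> t \<le> norm x"
    using M by (auto simp: A_def)
  have uniq: "s = t" if "(x, s) \<in> M" "(x, t) \<in> M" for x s t
  proof -
    have "s - t \<le> 0" "t - s \<le> 0"
      using leM[of 0 "s - t"] leM[of 0 "t - s"] subspace_diff[OF subM that] subspace_diff[OF subM that(2,1)]
      by auto
    then show ?thesis by simp
  qed
  have dom: "\<exists>t. (x0, t) \<in> M" for x0
  proof -
    have key: "t - norm (x - x0) \<le> norm (y + x0) - s" if "(x, t) \<in> M" "(y, s) \<in> M" for x t y s
    proof -
      have "t + s \<le> norm (x + y)"
        using leM[of "x + y" "t + s"] subspace_add[OF subM that] by simp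
      also have "\<dots> \<le> norm (x - x0) + norm (y + x0)"
        using norm_triangle_ineq[of "x - x0" "y + x0"] by simp
      finally show ?thesis by simp
    qed
    have 0: "(0, 0) \<in> M"
      using subspace_0[OF subM] by (simp add: zero_prod_def)
    \<comment> \<open>The smallest admissible value at x0; \<open>key\<close> says that every lower
      constraint lies below every upper one.\<close>
    define c where "c = (SUP (x, t)\<in>M. t - norm (x - x0))"
    have bdd: "bdd_above ((\<lambda>(x, t). t - norm (x - x0)) ` M)"
      using key[OF _ 0] by (auto intro!: bdd_aboveI)
    have c1: "t - norm (x - x0) \<le> c" if "(x, t) \<in> M" for x t
      using cSUP_upper[OF that bdd] by (simp add: c_def)
    have c2: "c \<le> norm (y + x0) - s" if "(y, s) \<in> M" for y s
      unfolding c_def using 0 key[OF _ that] by (intro cSUP_least) auto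
    define M' where "M' = span (insert (x0, c) M)"
    have "t \<le> norm x" if xt: "(x, t) \<in> M'" for x t
    proof -
      \<comment> \<open>k is the coefficient of the new vector. Dividing by its absolute value
        reduces the cases k > 0 and k < 0 to \<open>c2\<close> and \<open>c1\<close>.\<close>
      obtain k where k: "(x - k *\<^sub>R x0, t - k * c) \<in> M"
        using xt subM by (auto simp: M'_def span_insert span_eq_iff[THEN iffD2])
      then have sc: "(r *\<^sub>R (x - k *\<^sub>R x0), r * (t - k * c)) \<in> M" for r
        using subspace_scale[OF subM k, of r] by simp
      consider "k = 0" | "k > 0" | "k < 0" by linarith
      then show ?thesis
      proof cases
        case 1
        then show ?thesis using leM k by simp
      next
        case 2
        have "(inverse k *\<^sub>R (x - k *\<^sub>R x0)) + x0 = inverse k *\<^sub>R x"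
          using 2 by (simp add: algebra_simps)
        then have "c \<le> inverse k * norm x - inverse k * (t - k * c)"
          using c2[OF sc[of "inverse k"]] 2 by simp
        then show ?thesis
          using 2 by (simp add: field_simps)
      next
        case 3
        have "(inverse (- k) *\<^sub>R (x - k *\<^sub>R x0)) - x0 = inverse (- k) *\<^sub>R x"
          using 3 by (simp add: algebra_simps)
        then have "inverse (- k) * (t - k * c) - norm (inverse (- k) *\<^sub>R x) \<le> c"
          using c1[OF sc[of "inverse (- k)"]] by simp
        also have "norm (inverse (- k) *\<^sub>R x) = inverse (- k) * norm x"
          using 3 by simp
        finally show ?thesis
          using 3 by (simp add: field_simps)
      qed
    qed
    moreover have "M \<subseteq> M'"
      by (auto simp: M'_def span_base)
    ultimately have "M' = M"
      using GM by (intro max) (auto simp: A_def M'_def)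
    then show ?thesis
      unfolding M'_def by (metis insertI1 span_base)
  qed
  then obtain g where g: "\<And>x. (x, g x) \<in> M"
    by metis
  have gle: "\<bar>g x\<bar> \<le> norm x" for x
  proof -
    have "g (- x) = - g x"
      using uniq[OF g[of "- x"]] subspace_neg[OF subM g[of x]] by simp
    then show ?thesis
      using leM[OF g[of x]] leM[OF g[of "- x"]] by simp
  qed
  have bl: "bounded_linear g"
  proof (rule bounded_linear_intro[where K = 1])
    show "g (x + y) = g x + g y" for x y
      using uniq[OF g[of "x + y"]] subspace_add[OF subM g[of x] g[of y]] by simp
    show "g (r *\<^sub>R x) = r *\<^sub>R g x" for r x
      using uniq[OF g[of "r *\<^sub>R x"]] subspace_scale[OF subM g[of x], of r] by simp
    show "norm (g x) \<le> norm x * 1" for x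
      using gle by simp
  qed
  show ?thesis
  proof (intro exI[of _ "Blinfun g"] conjI allI impI)
    show "norm (Blinfun g) \<le> 1"
      using gle by (intro norm_blinfun_bound) (auto simp: bounded_linear_Blinfun_apply bl)
    show "blinfun_apply (Blinfun g) x = t" if "(x, t) \<in> G" for x t
      using uniq[OF g[of x]] GM that by (auto simp: bounded_linear_Blinfun_apply bl)
  qed
qed

text \<open>Since N is a subspace, d bounds the distance from x0 to N from below, which is exactly
  what makes h + r x0 |-> r d dominated by the norm. With d = norm x0 the functional attains its
  norm at x0; this case produces norming points in I.\<close>

lemma hahn_banach_separation:
  fixes N :: "'a::real_normed_vector set"
  assumes N: "subspace N" and d: "d \<ge> 0" "\<And>h. h \<in> N \<Longrightarrow> d \<le> norm (x0 + h)"
  obtains g :: "'a \<Rightarrow>\<^sub>L real"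
  where "norm g \<le> 1" "\<And>h. h \<in> N \<Longrightarrow> blinfun_apply g h = 0" "blinfun_apply g x0 = d"
proof -
  define G where "G = (\<lambda>(h, r). (h + r *\<^sub>R x0, r * d)) ` (N \<times> UNIV)"
  have "subspace G"
    unfolding G_def
    by (rule linear_subspace_image)
      (auto simp: linear_iff algebra_simps intro: subspace_Times N)
  moreover have "t \<le> norm x" if xt: "(x, t) \<in> G" for x t
  proof -
    obtain h r where h: "h \<in> N" "x = h + r *\<^sub>R x0" "t = r * d"
    proof -
      from xt obtain p where "p \<in> N \<times> UNIV" "(x, t) = (\<lambda>(h, r). (h + r *\<^sub>R x0, r * d)) p"
        unfolding G_def by blast
      then show thesis
        using that[of "fst p" "snd p"] by (auto simp: case_prod_beta mem_Times_iff)
    qed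
    show ?thesis
    proof (cases "r = 0")
      case False
      have "d \<le> norm (x0 + inverse r *\<^sub>R h)"
        by (intro d(2) subspace_scale N h)
      then have "\<bar>r\<bar> * d \<le> \<bar>r\<bar> * norm (x0 + inverse r *\<^sub>R h)"
        by (intro mult_left_mono) auto
      also have "\<dots> = norm (r *\<^sub>R (x0 + inverse r *\<^sub>R h))"
        by simp
      also have "r *\<^sub>R (x0 + inverse r *\<^sub>R h) = x"
        using False h by (simp add: algebra_simps)
      finally show ?thesis
        using h(3) d(1) mult_right_mono[of r "\<bar>r\<bar>" d] by linarith
    qed (use h in auto)
  qed
  ultimately obtain g :: "'a \<Rightarrow>\<^sub>L real"
    where g: "norm g \<le> 1" "\<And>x t. (x, t) \<in> G \<Longrightarrow> blinfun_apply g x = t"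
    using hahn_banach_graph[of G] by blast
  have "(h, 0) \<in> G" if "h \<in> N" for h
    using that by (auto simp: G_def intro!: image_eqI[of _ _ "(h, 0)"])
  moreover have "(x0, d) \<in> G"
    using subspace_0[OF N] by (auto simp: G_def intro!: image_eqI[of _ _ "(0, 1)"])
  ultimately show thesis
    using g that by blast
qed

text \<open>Finite-dimensional duality: the vector of values of x lies in the image of I unless a
  linear combination of the functionals separates them. In the induction a functional g that is
  nonzero on I is disposed of by passing to its kernel in I and correcting x along some y0 with g y0
  = 1.\<close>

lemma common_value_in_subspace:
  fixes I :: "'a::real_normed_vector set" and \<Phi> :: "('a \<Rightarrow>\<^sub>L real) set"
  assumes "finite \<Phi>" "subspace I"
    and "\<And>f. f \<in> span \<Phi> \<Longrightarrow> (\<And>y. y \<in> I \<Longrightarrow> blinfun_apply f y = 0) \<Longrightarrow> blinfun_apply f x = 0"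
  shows "\<exists>y\<in>I. \<forall>f\<in>\<Phi>. blinfun_apply f y = blinfun_apply f x"
  using assms
proof (induction \<Phi> arbitrary: I x rule: finite_induct)
  case empty
  then show ?case using subspace_0 by blast
next
  case (insert g \<Phi>)
  have span: "f \<in> span (insert g \<Phi>)" if "f \<in> span \<Phi>" for f
    using that span_mono[of \<Phi> "insert g \<Phi>"] by auto
  show ?case
  proof (cases "\<forall>y\<in>I. blinfun_apply g y = 0")
    case True
    then have "blinfun_apply g x = 0"
      using insert.prems(2)[of g] by (simp add: span_base)
    moreover have "\<exists>y\<in>I. \<forall>f\<in>\<Phi>. blinfun_apply f y = blinfun_apply f x"
      using insert.prems span by (intro insert.IH) auto
    ultimately show ?thesis
      using True by auto
  next
    case False
    then obtain y1 where y1: "y1 \<in> I" "blinfun_apply g y1 \<noteq> 0" by blast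
    define y0 where "y0 = inverse (blinfun_apply g y1) *\<^sub>R y1"
    have y0: "y0 \<in> I" "blinfun_apply g y0 = 1"
      using y1 insert.prems(1) by (auto simp: y0_def blinfun.scaleR_right subspace_scale)
    define I' where "I' = I \<inter> {y. blinfun_apply g y = 0}"
    define x' where "x' = x - blinfun_apply g x *\<^sub>R y0"
    have "\<exists>y\<in>I'. \<forall>f\<in>\<Phi>. blinfun_apply f y = blinfun_apply f x'"
    proof (rule insert.IH)
      show "subspace I'"
        using insert.prems(1) by (auto simp: I'_def subspace_def blinfun.bilinear_simps)
      fix f assume f: "f \<in> span \<Phi>" "\<And>y. y \<in> I' \<Longrightarrow> blinfun_apply f y = 0"
      \<comment> \<open>Subtracting a multiple of g makes the functional vanish at y0 and so on all
        of I, where the hypothesis on the span applies.\<close>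
      define f' where "f' = f - blinfun_apply f y0 *\<^sub>R g"
      have "f' \<in> span (insert g \<Phi>)"
        unfolding f'_def using span[OF f(1)] by (intro span_diff span_scale) (simp_all add: span_base)
      moreover have "blinfun_apply f' y = 0" if "y \<in> I" for y
      proof -
        have "blinfun_apply f (y - blinfun_apply g y *\<^sub>R y0) = 0"
          using that y0 insert.prems(1)
          by (intro f) (auto simp: I'_def blinfun.bilinear_simps subspace_diff subspace_scale)
        then show ?thesis
          by (simp add: f'_def blinfun.bilinear_simps)
      qed
      ultimately have "blinfun_apply f' x = 0"
        using insert.prems(2) by blast
      then show "blinfun_apply f x' = 0"
        by (simp add: f'_def x'_def blinfun.bilinear_simps)
    qed
    then obtain y where y: "y \<in> I'" "\<forall>f\<in>\<Phi>. blinfun_apply f y = blinfun_apply f x'"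
      by blast
    have "y + blinfun_apply g x *\<^sub>R y0 \<in> I"
      using y y0 insert.prems(1) by (auto simp: I'_def subspace_add subspace_scale)
    moreover have "blinfun_apply g (y + blinfun_apply g x *\<^sub>R y0) = blinfun_apply g x"
      using y y0 by (simp add: I'_def blinfun.bilinear_simps)
    moreover have "\<forall>f\<in>\<Phi>. blinfun_apply f (y + blinfun_apply g x *\<^sub>R y0) = blinfun_apply f x"
      using y by (simp add: x'_def blinfun.bilinear_simps)
    ultimately show ?thesis
      by (intro bexI[of _ "y + blinfun_apply g x *\<^sub>R y0"]) auto
  qed
qed

text \<open>A weak* neighbourhood of x is controlled by finitely many functionals in F. If no
  functional in F separated x from I, some point of I would share all their values at x and lie in
  the complement of I.\<close>

lemma weak_star_closed_separation:
  fixes F :: "('x::real_normed_vector \<Rightarrow>\<^sub>L real) set"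
  assumes F: "subspace F" and I: "subspace I" "closedin (weak_star_topology F) I" and x: "x \<notin> I"
  obtains f where "f \<in> F" "\<And>y. y \<in> I \<Longrightarrow> blinfun_apply f y = 0" "blinfun_apply f x \<noteq> 0"
proof (rule ccontr)
  note sep = that
  assume "\<not> thesis"
  then have no: "blinfun_apply f x = 0" if "f \<in> F" "\<And>y. y \<in> I \<Longrightarrow> blinfun_apply f y = 0" for f
    using sep that by blast
  let ?B = "{blinfun_apply f -` U | f U. f \<in> F \<and> open U}"
  have "UNIV \<in> ?B"
    using subspace_0[OF F] by (auto intro!: exI[of _ 0] exI[of _ UNIV])
  then have top: "topspace (weak_star_topology F) = UNIV"
    unfolding weak_star_topology_def topology_generated_by_topspace using Union_upper[of UNIV ?B] by (simp only: top.extremum_unique)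
  then have "openin (weak_star_topology F) (- I)"
    using I(2) by (simp add: closedin_def Compl_eq_Diff_UNIV)
  then have gen: "generate_topology_on ?B (- I)"
    by (simp add: weak_star_topology_def openin_topology_generated_by_iff)
  \<comment> \<open>Exact agreement on a finite set is enough here, which spares all epsilons in the
    induction over the generated topology.\<close>
  have "\<exists>\<Phi>. finite \<Phi> \<and> \<Phi> \<subseteq> F \<and> (\<forall>y. (\<forall>f\<in>\<Phi>. blinfun_apply f y = blinfun_apply f z) \<longrightarrow> y \<in> W)"
    if "generate_topology_on ?B W" "z \<in> W" for z W
    using that
  proof (induction arbitrary: z)
    case Empty
    then show ?case by simp
  next
    case (Int a b)
    obtain \<Phi> where \<Phi>: "finite \<Phi>" "\<Phi> \<subseteq> F" "\<forall>y. (\<forall>f\<in>\<Phi>. blinfun_apply f y = blinfun_apply f z) \<longrightarrow> y \<in> a"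
      using Int.IH(1)[of z] Int.prems by (elim IntE) blast
    obtain \<Psi> where \<Psi>: "finite \<Psi>" "\<Psi> \<subseteq> F" "\<forall>y. (\<forall>f\<in>\<Psi>. blinfun_apply f y = blinfun_apply f z) \<longrightarrow> y \<in> b"
      using Int.IH(2)[of z] Int.prems by (elim IntE) blast
    show ?case
      using \<Phi> \<Psi> by (intro exI[of _ "\<Phi> \<union> \<Psi>"]) simp
  next
    case (UN K)
    then obtain k where "k \<in> K" "z \<in> k"
      by blast
    moreover from this obtain \<Phi> where "finite \<Phi>" "\<Phi> \<subseteq> F" "\<forall>y. (\<forall>f\<in>\<Phi>. blinfun_apply f y = blinfun_apply f z) \<longrightarrow> y \<in> k"
      using UN.IH[of k z] by blast
    ultimately show ?case
      by blast
  next
    case (Basis s)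
    then obtain f U where "f \<in> F" "s = blinfun_apply f -` U" by blast
    then show ?case
      using Basis by (intro exI[of _ "{f}"]) auto
  qed
  from this[OF gen, of x] x obtain \<Phi> where \<Phi>: "finite \<Phi>" "\<Phi> \<subseteq> F"
    "\<forall>y. (\<forall>f\<in>\<Phi>. blinfun_apply f y = blinfun_apply f x) \<longrightarrow> y \<in> - I"
    by blast
  have "\<exists>y\<in>I. \<forall>f\<in>\<Phi>. blinfun_apply f y = blinfun_apply f x"
    using span_minimal[OF \<Phi>(2) F] no by (intro common_value_in_subspace \<Phi>(1) I(1)) blast
  then show False
    using \<Phi>(3) by blast
qed

section \<open>Operators between quaternionic Hilbert spaces\<close>

notation hop_apply (infixr \<open>\<cdot>\<close> 80)
  and hop_compose (infixr \<open>\<odot>\<close> 82)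
  and hop_adjoint (\<open>_\<^sup>\<dagger>\<close> [1000] 999)

section \<open>Quaternionic inner products through their real part\<close>

lemma qcnj_mult: "qcnj (a * b) = qcnj b * qcnj a"
  by (simp add: qcnj_def times_quat_def quat_eq_iff)

lemma qcnj_qcnj [simp]: "qcnj (qcnj a) = a"
  by (simp add: qcnj_def quat_eq_iff)

lemma qcnj_add: "qcnj (a + b) = qcnj a + qcnj b"
  by (simp add: qcnj_def plus_quat_def)

lemma qcnj_simps [simp]: "qcnj 0 = 0" "qcnj 1 = 1" "qcnj (- a) = - qcnj a"
  by (simp_all add: qcnj_def zero_quat_def one_quat_def uminus_quat_def)

lemma qnorm2_nonneg: "0 \<le> qnorm2 c"
  by (simp add: qnorm2_def)

lemma qcnj_mult_self: "qcnj c * c = of_real (qnorm2 c)" "c * qcnj c = of_real (qnorm2 c)"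
  by (simp_all add: qcnj_def times_quat_def quat_eq_iff qnorm2_def of_real_def scaleR_quat_def one_quat_def
      power2_eq_square)

lemma qRe_simps [simp]: "qRe 0 = 0" "qRe (a + b) = qRe a + qRe b" "qRe (a - b) = qRe a - qRe b"
  "qRe (- a) = - qRe a" "qRe (of_real r) = r" "qRe (r *\<^sub>R a) = r * qRe a" "qRe (qcnj a) = qRe a"
  by (simp_all add: zero_quat_def plus_quat_def minus_quat_def uminus_quat_def of_real_def
      scaleR_quat_def one_quat_def qcnj_def)

lemma qRe_mult_commute: "qRe (a * b) = qRe (b * a)"
  by (simp add: times_quat_def)

lemma quat_eqI_qRe: "a = b" if "\<And>c. qRe (a * c) = qRe (b * c)"
  using that[of "Quat 1 0 0 0"] that[of "Quat 0 1 0 0"] that[of "Quat 0 0 1 0"] that[of "Quat 0 0 0 1"]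
  by (simp add: quat_eq_iff times_quat_def)

lemma hinner_add_left: "hinner (x + y) z = hinner x z + hinner y z"
  using hinner_commute[of "x + y" z] hinner_commute[of x z] hinner_commute[of y z]
  by (simp add: hinner_add_right qcnj_add)

lemma hinner_scaleH_left: "hinner (x *\<^sub>H c) y = qcnj c * hinner x y"
  by (metis hinner_commute hinner_scaleH_right qcnj_mult)

lemma scaleH_zero [simp]: "(0::'a::quat_hilbert) *\<^sub>H c = 0" "(x::'a) *\<^sub>H 0 = 0" "(x::'a) *\<^sub>H 1 = x"
  using scaleH_scaleR[of 0 "0::'a" c] scaleH_of_real[of x 0] scaleH_of_real[of x 1] by simp_all

lemma scaleH_minus_right: "x *\<^sub>H (- c) = - (x *\<^sub>H c)" for x :: "'a::quat_hilbert"
  using scaleH_add_right[of x c "- c"] by (simp add: eq_neg_iff_add_eq_0 add.commute)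

lemma hinner_zero [simp]: "hinner x 0 = 0" "hinner 0 x = 0"
  using hinner_scaleH_right[of x x 0] hinner_scaleH_left[of x 0 x] by simp_all

lemma inner_scaleH_left: "inner (x *\<^sub>H c) y = inner x (y *\<^sub>H qcnj c)" for x :: "'a::quat_hilbert"
  by (simp add: inner_eq_qRe_hinner hinner_scaleH_left hinner_scaleH_right qRe_mult_commute)

text \<open>The other components of the quaternionic inner product are real parts after multiplying
  by units. Hence adjoints can be treated with the real inner product alone.\<close>

lemma hinner_eqI: "hinner x y = hinner x' y'"
  if "\<And>c. inner x (y *\<^sub>H c) = inner x' (y' *\<^sub>H c)" for x y :: "'a::quat_hilbert" and x' y' :: "'b::quat_hilbert"
  using that by (intro quat_eqI_qRe) (simp add: inner_eq_qRe_hinner hinner_scaleH_right)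

lemma hinner_self: "hinner x x = of_real ((norm x)\<^sup>2)" for x :: "'a::quat_hilbert"
proof -
  have "hinner x x = qcnj (hinner x x)"
    by (rule hinner_commute)
  then show ?thesis
    by (simp add: quat_eq_iff qcnj_def of_real_def scaleR_quat_def one_quat_def power2_norm_eq_inner
       inner_eq_qRe_hinner)
qed

lemma hinner_eq_0_imp_inner: "hinner x y = 0 \<Longrightarrow> inner x y = 0"
  by (simp add: inner_eq_qRe_hinner)

lemma hinner_eq_0_commute: "hinner x y = 0 \<longleftrightarrow> hinner y x = 0"
  by (metis hinner_commute qcnj_simps(1))

lemma norm_scaleH: "norm (x *\<^sub>H c) = norm x * sqrt (qnorm2 c)" for x :: "'a::quat_hilbert"
proof -
  have "(norm (x *\<^sub>H c))\<^sup>2 = inner x (x *\<^sub>H (c * qcnj c))"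
    by (simp add: power2_norm_eq_inner inner_scaleH_left scaleH_scaleH)
  also have "\<dots> = (norm x * sqrt (qnorm2 c))\<^sup>2"
    by (simp add: qcnj_mult_self scaleH_of_real power_mult_distrib qnorm2_nonneg power2_norm_eq_inner)
  finally show ?thesis
    by (simp add: qnorm2_nonneg power2_eq_iff_nonneg)
qed

text \<open>Real Cauchy-Schwarz for x multiplied by the scalar c = \<open>hinner x y\<close>: this
  turns the full modulus into a real part.\<close>

lemma qnorm_hinner_le: "sqrt (qnorm2 (hinner x y)) \<le> norm x * norm y" for x :: "'a::quat_hilbert"
proof (cases "qnorm2 (hinner x y) = 0")
  case False
  define c where "c = hinner x y"
  have "qnorm2 c = inner (x *\<^sub>H c) y"
    by (simp add: inner_eq_qRe_hinner hinner_scaleH_left qcnj_mult_self flip: c_def)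
  also have "\<dots> \<le> norm (x *\<^sub>H c) * norm y"
    by (rule norm_cauchy_schwarz)
  finally have "sqrt (qnorm2 c) * sqrt (qnorm2 c) \<le> sqrt (qnorm2 c) * (norm x * norm y)"
    by (simp add: norm_scaleH qnorm2_nonneg mult.commute mult.left_commute)
  moreover have "0 < sqrt (qnorm2 c)"
    using False qnorm2_nonneg[of c] by (simp add: c_def)
  ultimately show ?thesis
    unfolding c_def[symmetric] using mult_le_cancel_left_pos by blast
qed simp

section \<open>Operators, adjoints and rank one operators\<close>

lemma hop_eqI: "(\<And>v. a \<cdot> v = b \<cdot> v) \<Longrightarrow> a = b"
  by transfer (rule blinfun_eqI)

lemma hop_apply_simps [simp]:
  "a \<cdot> (v + w) = a \<cdot> v + a \<cdot> w" "a \<cdot> (v - w) = a \<cdot> v - a \<cdot> w" "a \<cdot> (- v) = - (a \<cdot> v)"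
  "a \<cdot> (r *\<^sub>R v) = r *\<^sub>R (a \<cdot> v)" "a \<cdot> 0 = 0" "a \<cdot> (v *\<^sub>H c) = (a \<cdot> v) *\<^sub>H c"
  "(a + b) \<cdot> v = a \<cdot> v + b \<cdot> v" "(a - b) \<cdot> v = a \<cdot> v - b \<cdot> v" "(- a) \<cdot> v = - (a \<cdot> v)"
  "(r *\<^sub>R a) \<cdot> v = r *\<^sub>R (a \<cdot> v)" "0 \<cdot> v = 0"
  by (transfer; simp add: blinfun.bilinear_simps)+

lemma hop_compose_apply [simp]: "(a \<odot> b) \<cdot> v = a \<cdot> b \<cdot> v"
  by transfer simp

lemma norm_hop_apply: "norm (a \<cdot> v) \<le> norm a * norm v"
  by transfer (rule norm_blinfun)

lemma norm_hop_apply_le: "norm a \<le> 1 \<Longrightarrow> norm (a \<cdot> v) \<le> norm v"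
  using norm_hop_apply[of a v] mult_right_mono[of "norm a" 1 "norm v"] by simp

lemma norm_hop_bound: "0 \<le> K \<Longrightarrow> (\<And>v. norm (a \<cdot> v) \<le> K * norm v) \<Longrightarrow> norm a \<le> K"
  by transfer (rule norm_blinfun_bound)

lemma bounded_linear_hop_apply: "bounded_linear (\<lambda>v. a \<cdot> v)"
proof (rule bounded_linear_intro[of _ "norm a"])
  show "norm (a \<cdot> v) \<le> norm v * norm a" for v
    using norm_hop_apply[of a v] by (simp add: mult.commute)
qed simp_all

lemma hop_exists:
  fixes f :: "'a::quat_hilbert \<Rightarrow> 'b::quat_hilbert"
  assumes "bounded_linear f" "\<And>x c. f (x *\<^sub>H c) = f x *\<^sub>H c"
  shows "\<exists>a. \<forall>v. a \<cdot> v = f v"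
  by (rule exI[of _ "Hop (Blinfun f)"])
    (simp add: hop_apply.rep_eq Hop_inverse bounded_linear_Blinfun_apply assms)

text \<open>Real Riesz representation defines the adjoint pointwise. It commutes with scalars
  because the adjoint of multiplication by c is multiplication by \<open>qcnj c\<close>.\<close>

lemma hop_adjoint_exists:
  fixes a :: "('a::quat_hilbert, 'b::quat_hilbert) hop"
  shows "\<exists>b. \<forall>v w. inner (a \<cdot> v) w = inner v (b \<cdot> w)"
proof -
  have "\<exists>y. \<forall>v. inner (a \<cdot> v) w = inner y v" for w
    using riesz_representation[OF bounded_linear_compose[OF bounded_linear_inner_left[of w]
      bounded_linear_hop_apply[of a]]] by blast
  then obtain f where f: "inner (a \<cdot> v) w = inner (f w) v" for v w
    by metis
  have ext: "x = y" if "\<And>v. inner x v = inner y v" for x y :: 'a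
    by (metis inner_diff_left inner_eq_zero_iff right_minus_eq that)
  have "bounded_linear f"
  proof (rule bounded_linear_intro[of _ "norm a"])
    show "f (x + y) = f x + f y" for x y
      by (rule ext) (simp add: inner_add_right inner_add_left flip: f)
    show "f (r *\<^sub>R x) = r *\<^sub>R f x" for r x
      by (rule ext) (simp flip: f)
    show "norm (f x) \<le> norm x * norm a" for x
    proof (cases "f x = 0")
      case False
      have "norm (f x) * norm (f x) = inner (a \<cdot> f x) x"
        by (simp add: f flip: power2_norm_eq_inner power2_eq_square)
      also have "\<dots> \<le> norm (a \<cdot> f x) * norm x"
        by (rule norm_cauchy_schwarz)
      also have "\<dots> \<le> (norm a * norm (f x)) * norm x"
        by (intro mult_right_mono norm_hop_apply) auto
      finally show ?thesis
        using False by (simp add: mult.commute mult.left_commute)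
    qed simp
  qed
  moreover have "f (x *\<^sub>H c) = f x *\<^sub>H c" for x c
  proof (rule ext)
    fix v
    have "inner (f (x *\<^sub>H c)) v = inner x ((a \<cdot> v) *\<^sub>H qcnj c)"
      by (metis f inner_commute inner_scaleH_left)
    also have "\<dots> = inner (f x *\<^sub>H c) v"
      by (metis f hop_apply_simps(6) inner_commute inner_scaleH_left)
    finally show "inner (f (x *\<^sub>H c)) v = inner (f x *\<^sub>H c) v" .
  qed
  ultimately obtain b where "\<And>v. b \<cdot> v = f v"
    using hop_exists[of f] by blast
  then show ?thesis
    using f inner_commute[where ?'a = 'a] by (intro exI[of _ b] allI) metis
qed

lemma hop_adjoint_hinner: "hinner (a \<cdot> v) w = hinner v (a\<^sup>\<dagger> \<cdot> w)"
proof -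
  obtain b where b: "inner (a \<cdot> v) w = inner v (b \<cdot> w)" for v w
    using hop_adjoint_exists by blast
  have "\<forall>v w. hinner (a \<cdot> v) w = hinner v (b \<cdot> w)"
    by (auto intro!: hinner_eqI simp: b)
  moreover have "c = b" if "\<forall>v w. hinner (a \<cdot> v) w = hinner v (c \<cdot> w)" for c
  proof (rule hop_eqI)
    fix w
    have "inner (c \<cdot> w - b \<cdot> w) (c \<cdot> w - b \<cdot> w) = 0"
    proof -
      have "inner (a \<cdot> v) w = inner v (c \<cdot> w)" for v
        using that by (simp add: inner_eq_qRe_hinner)
      then show ?thesis
        using b[of "c \<cdot> w - b \<cdot> w" w] by (simp only: inner_diff_right)
    qed
    then show "c \<cdot> w = b \<cdot> w"
      by simp
  qed
  ultimately have "\<exists>!b. \<forall>v w. hinner (a \<cdot> v) w = hinner v (b \<cdot> w)"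
    by blast
  from theI'[OF this] show ?thesis
    unfolding hop_adjoint_def by blast
qed

lemma inner_hop_left: "inner (a \<cdot> v) w = inner v (a\<^sup>\<dagger> \<cdot> w)"
  by (simp add: inner_eq_qRe_hinner hop_adjoint_hinner)

lemma inner_hop_right: "inner v (a \<cdot> w) = inner (a\<^sup>\<dagger> \<cdot> v) w"
  by (metis inner_hop_left inner_commute)

lemma hop_adjointI: "a\<^sup>\<dagger> = b" if "\<And>v w. inner (a \<cdot> v) w = inner v (b \<cdot> w)"
proof (rule hop_eqI)
  fix w
  have "inner v (a\<^sup>\<dagger> \<cdot> w - b \<cdot> w) = 0" for v
    by (simp add: inner_diff_right that flip: inner_hop_left)
  then show "a\<^sup>\<dagger> \<cdot> w = b \<cdot> w"
    by (metis inner_eq_zero_iff right_minus_eq)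
qed

lemma hop_adjoint_adjoint [simp]: "(a\<^sup>\<dagger>)\<^sup>\<dagger> = a"
  by (rule hop_adjointI) (simp add: inner_hop_right)

lemma hop_adjoint_simps [simp]:
  "(a + b)\<^sup>\<dagger> = a\<^sup>\<dagger> + b\<^sup>\<dagger>" "(a - b)\<^sup>\<dagger> = a\<^sup>\<dagger> - b\<^sup>\<dagger>" "(- a)\<^sup>\<dagger> = - (a\<^sup>\<dagger>)" "(r *\<^sub>R a)\<^sup>\<dagger> = r *\<^sub>R a\<^sup>\<dagger>" "0\<^sup>\<dagger> = 0"
  "(a \<odot> c)\<^sup>\<dagger> = c\<^sup>\<dagger> \<odot> a\<^sup>\<dagger>"
  by (rule hop_adjointI; simp add: inner_add_left inner_add_right inner_diff_left inner_diff_right inner_hop_left)+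

lemma norm_hop_compose: "norm (a \<odot> b) \<le> norm a * norm b"
proof (rule norm_hop_bound)
  fix v
  have "norm (a \<cdot> b \<cdot> v) \<le> norm a * norm (b \<cdot> v)"
    by (rule norm_hop_apply)
  also have "\<dots> \<le> norm a * (norm b * norm v)"
    by (intro mult_left_mono norm_hop_apply) auto
  finally show "norm ((a \<odot> b) \<cdot> v) \<le> norm a * norm b * norm v"
    by (simp add: mult_ac)
qed simp

lemma norm_hop_adjoint_le: "norm (a\<^sup>\<dagger>) \<le> norm a"
proof (rule norm_hop_bound)
  fix w
  show "norm (a\<^sup>\<dagger> \<cdot> w) \<le> norm a * norm w"
  proof (cases "a\<^sup>\<dagger> \<cdot> w = 0")
    case False
    have "norm (a\<^sup>\<dagger> \<cdot> w) * norm (a\<^sup>\<dagger> \<cdot> w) = inner (a \<cdot> a\<^sup>\<dagger> \<cdot> w) w"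
      by (simp add: inner_hop_left flip: power2_norm_eq_inner power2_eq_square)
    also have "\<dots> \<le> norm (a \<cdot> a\<^sup>\<dagger> \<cdot> w) * norm w"
      by (rule norm_cauchy_schwarz)
    also have "\<dots> \<le> (norm a * norm (a\<^sup>\<dagger> \<cdot> w)) * norm w"
      by (intro mult_right_mono norm_hop_apply) auto
    finally show ?thesis
      using False by (simp add: mult.commute mult.left_commute)
  qed simp
qed simp

lemma norm_hop_adjoint [simp]: "norm (a\<^sup>\<dagger>) = norm a"
  using norm_hop_adjoint_le[of a] norm_hop_adjoint_le[of "a\<^sup>\<dagger>"] by simp

lemma hop_compose_simps [simp]:
  "(a + b) \<odot> c = a \<odot> c + b \<odot> c" "a \<odot> (c + d) = a \<odot> c + a \<odot> d"
  "(a - b) \<odot> c = a \<odot> c - b \<odot> c" "a \<odot> (c - d) = a \<odot> c - a \<odot> d"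
  "(- a) \<odot> c = - (a \<odot> c)" "a \<odot> (- c) = - (a \<odot> c)"
  "(r *\<^sub>R a) \<odot> c = r *\<^sub>R (a \<odot> c)" "a \<odot> (r *\<^sub>R c) = r *\<^sub>R (a \<odot> c)" "0 \<odot> c = 0" "a \<odot> 0 = 0"
  by (rule hop_eqI; simp)+

lemma hop_compose_assoc: "(a \<odot> b) \<odot> c = a \<odot> b \<odot> c"
  by (rule hop_eqI) simp

lemma hop_adjoint_self_0: "a\<^sup>\<dagger> \<odot> a = 0 \<Longrightarrow> a = 0"
proof (rule hop_eqI)
  fix v assume "a\<^sup>\<dagger> \<odot> a = 0"
  then have "a\<^sup>\<dagger> \<cdot> a \<cdot> v = 0"
    by (metis hop_compose_apply hop_apply_simps(11))
  then have "inner (a \<cdot> v) (a \<cdot> v) = 0"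
    by (simp only: inner_hop_left inner_zero_right)
  then show "a \<cdot> v = 0 \<cdot> v"
    by simp
qed

text \<open>The choice is unique because an operator is determined by its values; existence is
  checked in \<open>rank1_apply\<close>.\<close>

definition rank1 :: "'b::quat_hilbert \<Rightarrow> 'a::quat_hilbert \<Rightarrow> ('a, 'b) hop" where
  "rank1 \<eta> \<xi> = (SOME a. \<forall>v. a \<cdot> v = \<eta> *\<^sub>H hinner \<xi> v)"

lemma norm_scaleH_hinner_le: "norm (\<eta> *\<^sub>H hinner \<xi> v) \<le> norm \<eta> * norm \<xi> * norm v"
  for \<eta> :: "'b::quat_hilbert" and \<xi> :: "'a::quat_hilbert"
  using mult_left_mono[OF qnorm_hinner_le[of \<xi> v], of "norm \<eta>"] by (simp add: norm_scaleH mult.assoc)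

lemma rank1_apply [simp]: "rank1 \<eta> \<xi> \<cdot> v = \<eta> *\<^sub>H hinner \<xi> v"
proof -
  have "bounded_linear (\<lambda>v. \<eta> *\<^sub>H hinner \<xi> v)"
  proof (rule bounded_linear_intro[of _ "norm \<eta> * norm \<xi>"])
    show "\<eta> *\<^sub>H hinner \<xi> (r *\<^sub>R x) = r *\<^sub>R (\<eta> *\<^sub>H hinner \<xi> x)" for r x
      by (metis hinner_scaleH_right scaleH_of_real scaleH_scaleH)
  qed (use norm_scaleH_hinner_le[of \<eta> \<xi>] in \<open>simp_all add: hinner_add_right scaleH_add_right mult_ac\<close>)
  then have "\<exists>a. \<forall>v. a \<cdot> v = \<eta> *\<^sub>H hinner \<xi> v"
    by (rule hop_exists) (simp add: hinner_scaleH_right scaleH_scaleH)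
  from someI_ex[OF this] show ?thesis
    unfolding rank1_def by blast
qed

lemma norm_rank1_le: "norm (rank1 \<eta> \<xi>) \<le> norm \<eta> * norm \<xi>"
  by (rule norm_hop_bound) (simp_all add: norm_scaleH_hinner_le)

lemma rank1_adjoint [simp]: "(rank1 \<eta> \<xi>)\<^sup>\<dagger> = rank1 \<xi> \<eta>"
proof (rule hop_adjointI)
  fix v w
  have "inner (\<eta> *\<^sub>H hinner \<xi> v) w = qRe (hinner v \<xi> * hinner \<eta> w)"
    by (simp add: inner_eq_qRe_hinner hinner_scaleH_left flip: hinner_commute)
  also have "\<dots> = inner v (\<xi> *\<^sub>H hinner \<eta> w)"
    by (simp add: inner_eq_qRe_hinner hinner_scaleH_right)
  finally show "inner (rank1 \<eta> \<xi> \<cdot> v) w = inner v (rank1 \<xi> \<eta> \<cdot> w)"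
    by simp
qed

lemma compose_rank1: "a \<odot> rank1 \<eta> \<xi> = rank1 (a \<cdot> \<eta>) \<xi>"
  by (rule hop_eqI) simp

lemma rank1_compose: "rank1 \<eta> \<xi> \<odot> a = rank1 \<eta> (a\<^sup>\<dagger> \<cdot> \<xi>)"
  by (rule hop_eqI) (simp add: hop_adjoint_hinner)

lemma rank1_scaleH: "rank1 \<eta> (\<xi> *\<^sub>H c) = rank1 (\<eta> *\<^sub>H qcnj c) \<xi>"
  by (rule hop_eqI) (simp add: hinner_scaleH_left scaleH_scaleH)

lemma rank1_add: "rank1 (\<eta> + \<eta>') \<xi> = rank1 \<eta> \<xi> + rank1 \<eta>' \<xi>" "rank1 \<eta> (\<xi> + \<xi>') = rank1 \<eta> \<xi> + rank1 \<eta> \<xi>'"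
  by (rule hop_eqI; simp add: scaleH_add_left scaleH_add_right hinner_add_left)+

lemma rank1_scaleR: "rank1 (r *\<^sub>R \<eta>) \<xi> = r *\<^sub>R rank1 \<eta> \<xi>" "rank1 \<eta> (r *\<^sub>R \<xi>) = r *\<^sub>R rank1 \<eta> \<xi>"
proof -
  show 1: "rank1 (r *\<^sub>R \<eta>) \<xi> = r *\<^sub>R rank1 \<eta> \<xi>" for r \<eta> \<xi>
    by (rule hop_eqI) (simp add: scaleH_scaleR)
  show "rank1 \<eta> (r *\<^sub>R \<xi>) = r *\<^sub>R rank1 \<eta> \<xi>"
    using 1[of r \<xi> \<eta>] by (metis rank1_adjoint hop_adjoint_simps(4))
qed

lemma triple_product_apply: "triple_product a b c \<cdot> v = (1/2) *\<^sub>R (a \<cdot> b\<^sup>\<dagger> \<cdot> c \<cdot> v + c \<cdot> b\<^sup>\<dagger> \<cdot> a \<cdot> v)"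
  by (simp add: triple_product_def)

lemma triple_product_same: "triple_product a b a = a \<odot> b\<^sup>\<dagger> \<odot> a"
  by (rule hop_eqI) (simp add: triple_product_apply flip: scaleR_add_left)

section \<open>Normal functionals\<close>

text \<open>First-order perturbations of a partial isometry \<open>u\<close> that vanish on the self-adjoint part of
  the corner of \<open>u\<close> change the norm only to second order.\<close>

lemma norm_perturbed_tripotent_le:
  fixes u y :: "('a::quat_hilbert, 'b::quat_hilbert) hop"
  assumes u: "u \<odot> u\<^sup>\<dagger> \<odot> u = u" and y: "norm y \<le> 1"
    and orth: "\<And>v. inner (u \<cdot> v) (y \<cdot> u\<^sup>\<dagger> \<cdot> u \<cdot> v) = 0" and t: "0 \<le> t"
  shows "norm (u + t *\<^sub>R y) \<le> 1 + t\<^sup>2"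
proof (rule norm_hop_bound)
  fix v
  have uuu: "u \<cdot> u\<^sup>\<dagger> \<cdot> u \<cdot> z = u \<cdot> z" for z
    using arg_cong[OF u, of "\<lambda>a. a \<cdot> z"] by simp
  \<comment> \<open>v1 is the component of v in the initial space of u, and w the orthogonal
    rest.\<close>
  define v1 where "v1 = u\<^sup>\<dagger> \<cdot> u \<cdot> v"
  define w where "w = v - v1"
  have inn: "inner v v1 = (norm v1)\<^sup>2"
  proof -
    have "inner v1 v1 = inner (u \<cdot> v) (u \<cdot> v1)"
      unfolding v1_def by (simp add: inner_hop_left)
    also have "\<dots> = inner (u \<cdot> v) (u \<cdot> v)"
      by (simp add: v1_def uuu)
    also have "\<dots> = inner v v1"
      by (simp add: v1_def inner_hop_left)
    finally show ?thesis
      by (simp add: power2_norm_eq_inner)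
  qed
  have w2: "(norm w)\<^sup>2 = (norm v)\<^sup>2 - (norm v1)\<^sup>2"
    unfolding w_def using dot_norm_neg[of v v1] inn by simp
  have u2: "(norm (u \<cdot> v))\<^sup>2 = (norm v1)\<^sup>2"
    using inn by (simp add: power2_norm_eq_inner inner_hop_left v1_def)
  \<comment> \<open>By \<open>orth\<close> the first-order term pairs u v with y w only.\<close>
  have "inner (u \<cdot> v) (y \<cdot> v) = inner (u \<cdot> v) (y \<cdot> v1) + inner (u \<cdot> v) (y \<cdot> w)"
    by (simp add: w_def inner_diff_right)
  also have "\<dots> = inner (u \<cdot> v) (y \<cdot> w)"
    using orth by (simp add: v1_def)
  also have "\<dots> \<le> norm (u \<cdot> v) * norm (y \<cdot> w)"
    by (rule norm_cauchy_schwarz)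
  also have "\<dots> \<le> norm v1 * norm w"
    using u2 norm_hop_apply_le[OF y, of w] by (intro mult_mono) (auto simp: power2_eq_iff_nonneg)
  finally have cross: "inner (u \<cdot> v) (y \<cdot> v) \<le> norm v1 * norm w" .
  have "(norm ((u + t *\<^sub>R y) \<cdot> v))\<^sup>2 = (norm (u \<cdot> v))\<^sup>2 + 2 * t * inner (u \<cdot> v) (y \<cdot> v) + t\<^sup>2 * (norm (y \<cdot> v))\<^sup>2"
    using dot_norm[of "u \<cdot> v" "t *\<^sub>R (y \<cdot> v)"] by (simp add: power_mult_distrib)
  also have "\<dots> \<le> (norm v1)\<^sup>2 + 2 * t * (norm v1 * norm w) + t\<^sup>2 * (norm v)\<^sup>2"
    using norm_hop_apply_le[OF y, of v] cross t u2
    by (intro add_mono mult_left_mono power_mono) auto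
  \<comment> \<open>Young's inequality trades the mixed term for the square of norm w, which is
    exactly what v1 lacks compared with v, plus a term of order t squared.\<close>
  also have "\<dots> \<le> (norm v1)\<^sup>2 + ((norm w)\<^sup>2 + t\<^sup>2 * (norm v1)\<^sup>2) + t\<^sup>2 * (norm v)\<^sup>2"
    using sum_squares_bound[of "norm w" "t * norm v1"] by (simp add: power_mult_distrib mult_ac)
  also have "\<dots> \<le> (norm v)\<^sup>2 + t\<^sup>2 * (norm v)\<^sup>2 + t\<^sup>2 * (norm v)\<^sup>2"
    using w2 zero_le_power2[of "norm w"] by (simp add: mult_left_mono)
  also have "\<dots> \<le> ((1 + t\<^sup>2) * norm v)\<^sup>2"
  proof -
    have "((1 + t\<^sup>2) * norm v)\<^sup>2 = ((norm v)\<^sup>2 + t\<^sup>2 * (norm v)\<^sup>2 + t\<^sup>2 * (norm v)\<^sup>2) + (t\<^sup>2 * norm v)\<^sup>2"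
      by (simp add: power2_eq_square algebra_simps)
    then show ?thesis
      using zero_le_power2[of "t\<^sup>2 * norm v"] by linarith
  qed
  finally show "norm ((u + t *\<^sub>R y) \<cdot> v) \<le> (1 + t\<^sup>2) * norm v"
    by (rule power2_le_imp_le) (simp add: add_nonneg_nonneg)
qed (simp add: add_nonneg_nonneg)

lemma le_zero_if_le_scaled:
  fixes a b :: real
  assumes "\<And>t. 0 < t \<Longrightarrow> a \<le> t * b" "0 \<le> b"
  shows "a \<le> 0"
proof (rule ccontr)
  assume "\<not> a \<le> 0"
  then have "a \<le> (a / (2 * (b + 1))) * b"
    using assms(2) by (intro assms(1)) (auto intro: divide_pos_pos)
  also have "\<dots> = a * (b / (2 * (b + 1)))"
    by simp
  also have "\<dots> < a * 1"
    using \<open>\<not> a \<le> 0\<close> assms(2) by (intro mult_strict_left_mono) (auto simp: field_simps)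
  finally show False by simp
qed

text \<open>Comparing f u = norm f with f (u + t z) \<le> norm f (1 + t^2) gives f z \<le> t norm f
  for all t > 0, and likewise for - z. So a functional that is normed by u ignores every y whose
  self-adjoint part in the corner of u is zero.\<close>

lemma norming_functional_vanishes:
  fixes f :: "('a::quat_hilbert, 'b::quat_hilbert) hop \<Rightarrow>\<^sub>L real"
  assumes u: "u \<odot> u\<^sup>\<dagger> \<odot> u = u" and f: "f u = norm f"
    and orth: "\<And>v. inner (u \<cdot> v) (y \<cdot> u\<^sup>\<dagger> \<cdot> u \<cdot> v) = 0"
  shows "f y = 0"
proof -
  have le: "f z \<le> 0" if z: "norm z \<le> 1" "\<And>v. inner (u \<cdot> v) (z \<cdot> u\<^sup>\<dagger> \<cdot> u \<cdot> v) = 0" for z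
  proof (rule le_zero_if_le_scaled)
    fix t :: real assume t: "0 < t"
    have "f (u + t *\<^sub>R z) \<le> norm f * norm (u + t *\<^sub>R z)"
      using norm_blinfun[of f "u + t *\<^sub>R z"] by simp
    also have "\<dots> \<le> norm f * (1 + t\<^sup>2)"
      using t by (intro mult_left_mono norm_perturbed_tripotent_le u z) auto
    finally have "t * f z \<le> t * (t * norm f)"
      using f by (simp add: blinfun.bilinear_simps algebra_simps power2_eq_square)
    then show "f z \<le> t * norm f"
      using t by simp
  qed simp
  show ?thesis
  proof (cases "y = 0")
    case False
    have "f (sgn y) \<le> 0" "f (- sgn y) \<le> 0"
      using False orth by (auto intro!: le simp: sgn_hop_def)
    then have "f (sgn y) = 0"
      by (simp add: blinfun.bilinear_simps)
    then show ?thesis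
      using False by (simp add: sgn_hop_def blinfun.bilinear_simps)
  qed simp
qed

section \<open>Matrix coefficients as derivatives of the norm\<close>

definition matrix_coeff :: "'b::quat_hilbert \<Rightarrow> 'a::quat_hilbert \<Rightarrow> ('a, 'b) hop \<Rightarrow>\<^sub>L real" where
  "matrix_coeff \<beta> \<alpha> = Blinfun (\<lambda>x. inner \<beta> (x \<cdot> \<alpha>))"

lemma matrix_coeff_apply [simp]: "matrix_coeff \<beta> \<alpha> x = inner \<beta> (x \<cdot> \<alpha>)"
proof -
  have "bounded_linear (\<lambda>x::('a, 'b) hop. inner \<beta> (x \<cdot> \<alpha>))"
  proof (rule bounded_linear_intro[of _ "norm \<beta> * norm \<alpha>"])
    show "norm (inner \<beta> (x \<cdot> \<alpha>)) \<le> norm x * (norm \<beta> * norm \<alpha>)" for x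
    proof -
      have "norm (inner \<beta> (x \<cdot> \<alpha>)) \<le> norm \<beta> * norm (x \<cdot> \<alpha>)"
        using Cauchy_Schwarz_ineq2 by simp
      also have "\<dots> \<le> norm \<beta> * (norm x * norm \<alpha>)"
        by (intro mult_left_mono norm_hop_apply) auto
      finally show ?thesis
        by (simp add: mult_ac)
    qed
  qed (simp_all add: inner_add_right)
  then show ?thesis
    by (simp add: matrix_coeff_def bounded_linear_Blinfun_apply)
qed

lemma matrix_coeff_scaleR: "matrix_coeff (r *\<^sub>R \<beta>) (s *\<^sub>R \<alpha>) = (r * s) *\<^sub>R matrix_coeff \<beta> \<alpha>"
  by (rule blinfun_eqI) (simp add: blinfun.scaleR_left)

lemma norm_matrix_coeff_le: "norm (matrix_coeff \<beta> \<alpha>) \<le> norm \<beta> * norm \<alpha>"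
proof (rule norm_blinfun_bound)
  fix x :: "('a, 'b) hop"
  have "norm (inner \<beta> (x \<cdot> \<alpha>)) \<le> norm \<beta> * norm (x \<cdot> \<alpha>)"
    using Cauchy_Schwarz_ineq2 by simp
  also have "\<dots> \<le> norm \<beta> * (norm x * norm \<alpha>)"
    by (intro mult_left_mono norm_hop_apply) auto
  finally show "norm (matrix_coeff \<beta> \<alpha> x) \<le> norm \<beta> * norm \<alpha> * norm x"
    by (simp add: mult_ac)
qed simp

lemma rank1_tripotent: "rank1 \<beta> \<alpha> \<odot> (rank1 \<beta> \<alpha>)\<^sup>\<dagger> \<odot> rank1 \<beta> \<alpha> = rank1 \<beta> \<alpha>"
  if "norm \<beta> = 1" "norm \<alpha> = 1"
  by (rule hop_eqI) (simp add: hinner_scaleH_right hinner_self that)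

text \<open>A defect of t^2 in f (\<open>rank1 \<beta> \<alpha>\<close>) matches a perturbation of
  step t: on unit vectors y with zero matrix coefficient f is at most 2 t. The factor 5 is 2 * 2
  from that part of x and 1 from the component along the rank one operator.\<close>

lemma norming_sequence_rank1:
  fixes f :: "('a::quat_hilbert, 'b::quat_hilbert) hop \<Rightarrow>\<^sub>L real"
  assumes unit: "norm \<beta> = 1" "norm \<alpha> = 1" and f: "norm f \<le> 1" "1 - t\<^sup>2 \<le> f (rank1 \<beta> \<alpha>)"
    and t: "0 < t" "t \<le> 1"
  shows "norm (f - matrix_coeff \<beta> \<alpha>) \<le> 5 * t"
proof -
  define e where "e = rank1 \<beta> \<alpha>"
  have fe: "f e \<le> 1"
  proof -
    have "f e \<le> norm f * norm e"
      using norm_blinfun[of f e] by simp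
    also have "\<dots> \<le> 1 * 1"
      using f(1) norm_rank1_le[of \<beta> \<alpha>] unit by (intro mult_mono) (auto simp: e_def)
    finally show ?thesis by simp
  qed
  have small: "f y \<le> 2 * t" if y: "norm y \<le> 1" "inner \<beta> (y \<cdot> \<alpha>) = 0" for y
  proof -
    have "inner (e \<cdot> v) (y \<cdot> e\<^sup>\<dagger> \<cdot> e \<cdot> v) = 0" for v
    proof -
      have "inner (\<beta> *\<^sub>H c) ((y \<cdot> \<alpha>) *\<^sub>H c) = 0" for c
        using y(2) by (simp add: inner_scaleH_left qcnj_mult_self scaleH_of_real flip: scaleH_scaleH)
      then show ?thesis
        by (simp add: e_def hinner_scaleH_right hinner_self unit)
    qed
    then have "norm (e + t *\<^sub>R y) \<le> 1 + t\<^sup>2"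
      using y t unit by (intro norm_perturbed_tripotent_le) (auto simp: e_def rank1_tripotent simp del: rank1_adjoint)
    then have "norm f * norm (e + t *\<^sub>R y) \<le> 1 * (1 + t\<^sup>2)"
      using f(1) by (intro mult_mono) auto
    then have "f (e + t *\<^sub>R y) \<le> 1 + t\<^sup>2"
      using norm_blinfun[of f "e + t *\<^sub>R y"] by simp
    then have "t * f y \<le> t * (2 * t)"
      using f(2) by (simp add: blinfun.bilinear_simps e_def power2_eq_square)
    then show ?thesis
      using t by simp
  qed
  show ?thesis
  proof (rule norm_blinfun_bound)
    fix x :: "('a, 'b) hop"
    show "norm ((f - matrix_coeff \<beta> \<alpha>) x) \<le> 5 * t * norm x"
    proof (cases "x = 0")
      case False
      define r where "r = inner \<beta> (x \<cdot> \<alpha>)"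
      \<comment> \<open>x without its component along e, scaled into the unit ball; the factor 2 is
        due to \<bar>r\<bar> \<le> norm x.\<close>
      define y where "y = (1 / (2 * norm x)) *\<^sub>R (x - r *\<^sub>R e)"
      have r: "\<bar>r\<bar> \<le> norm x"
        using norm_blinfun[of "matrix_coeff \<beta> \<alpha>" x] mult_right_mono[OF norm_matrix_coeff_le[of \<beta> \<alpha>], of "norm x"] unit
        by (simp add: r_def)
      have "norm (x - r *\<^sub>R e) \<le> norm x + \<bar>r\<bar> * norm e"
        using norm_triangle_ineq4[of x "r *\<^sub>R e"] by simp
      also have "\<dots> \<le> norm x + norm x * 1"
        using r norm_rank1_le[of \<beta> \<alpha>] unit by (intro add_mono mult_mono) (auto simp: e_def)
      finally have ny: "norm y \<le> 1"
        using False by (simp add: y_def divide_simps)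
      have oy: "inner \<beta> (y \<cdot> \<alpha>) = 0"
        using unit by (simp add: y_def e_def inner_diff_right hinner_self r_def flip: power2_norm_eq_inner)
      have "\<bar>f y\<bar> \<le> 2 * t"
        using small[of y] small[of "- y"] ny oy by (auto simp: blinfun.bilinear_simps)
      then have 1: "\<bar>2 * norm x * f y\<bar> \<le> 2 * norm x * (2 * t)"
        unfolding abs_mult by (intro mult_mono) auto
      have x: "f x = 2 * norm x * f y + r * f e"
        using False by (simp add: y_def blinfun.bilinear_simps)
      have "t\<^sup>2 \<le> t"
        using t by (simp add: power2_eq_square mult_left_le)
      then have "\<bar>f e - 1\<bar> \<le> t"
        using f(2) fe by (simp add: e_def)
      then have "\<bar>r * (f e - 1)\<bar> \<le> norm x * t"
        using r unfolding abs_mult by (intro mult_mono) auto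
      moreover have "f x - r = 2 * norm x * f y + r * (f e - 1)"
        by (simp add: x algebra_simps)
      ultimately have "\<bar>f x - r\<bar> \<le> 2 * norm x * (2 * t) + norm x * t"
        using 1 by linarith
      also have "\<dots> = 5 * t * norm x"
        by simp
      finally have "\<bar>f x - r\<bar> \<le> 5 * t * norm x" .
      then show ?thesis
        by (simp add: blinfun.bilinear_simps r_def)
    qed (simp add: blinfun.bilinear_simps)
  qed (use t in simp)
qed

section \<open>An arbitrary isometric predual is the closed span of the matrix coefficients\<close>

locale operator_predual =
  fixes F :: "(('p::quat_hilbert, 'q::quat_hilbert) hop \<Rightarrow>\<^sub>L real) set"
  assumes predual: "isometric_predual F"
begin

lemma subspace_F: "subspace F" and closed_F: "closed F"
  using predual by (auto simp: isometric_predual_def)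

lemma norm_eq_Sup: "norm x = (SUP f\<in>{f \<in> F. norm f \<le> 1}. \<bar>blinfun_apply f x\<bar>)"
  using predual by (auto simp: isometric_predual_def functional_norm_on_def)

lemma evaluation_bounds:
  shows "bdd_above ((\<lambda>f. \<bar>blinfun_apply f x\<bar>) ` {f \<in> F. norm f \<le> 1})" "{f \<in> F. norm f \<le> 1} \<noteq> {}"
proof -
  show "bdd_above ((\<lambda>f. \<bar>blinfun_apply f x\<bar>) ` {f \<in> F. norm f \<le> 1})"
  proof (rule bdd_aboveI2)
    fix f assume "f \<in> {f \<in> F. norm f \<le> 1}"
    then show "\<bar>blinfun_apply f x\<bar> \<le> norm x"
      using norm_blinfun[of f x] mult_right_mono[of "norm f" 1 "norm x"] by simp
  qed
  show "{f \<in> F. norm f \<le> 1} \<noteq> {}"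
    using subspace_0[OF subspace_F] by force
qed

lemma almost_norming_functional:
  assumes "r < norm x"
  shows "\<exists>f\<in>F. norm f \<le> 1 \<and> r < blinfun_apply f x"
proof -
  obtain f where f: "f \<in> F" "norm f \<le> 1" "r < \<bar>blinfun_apply f x\<bar>"
    using assms evaluation_bounds(1)[of x] evaluation_bounds(2) unfolding norm_eq_Sup by (subst (asm) less_cSUP_iff) auto
  show ?thesis
  proof (cases "0 \<le> blinfun_apply f x")
    case False
    then show ?thesis
      using f subspace_neg[OF subspace_F f(1)] by (intro bexI[of _ "- f"]) (auto simp: blinfun.bilinear_simps)
  qed (use f in auto)
qed

text \<open>This turns the functionals produced by Hahn-Banach on the dual space back into
  operators, with control of the norm.\<close>

lemma bidual_representation:
  fixes g :: "(('p, 'q) hop \<Rightarrow>\<^sub>L real) \<Rightarrow>\<^sub>L real"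
  assumes "norm g \<le> 1"
  shows "\<exists>x. norm x \<le> 1 \<and> (\<forall>f\<in>F. blinfun_apply g f = blinfun_apply f x)"
proof -
  have "bounded_functional_on F g"
    using norm_blinfun[of g] by (auto simp: bounded_functional_on_def linear_functional_on_def blinfun.bilinear_simps)
  then obtain x where x: "\<forall>f\<in>F. blinfun_apply g f = blinfun_apply f x"
    using predual unfolding isometric_predual_def by blast
  have "norm x \<le> 1"
    unfolding norm_eq_Sup
  proof (rule cSUP_least)
    fix f assume f: "f \<in> {f \<in> F. norm f \<le> 1}"
    have "\<bar>blinfun_apply g f\<bar> \<le> norm g * norm f"
      using norm_blinfun[of g f] by simp
    also have "\<dots> \<le> 1 * 1"
      using f assms by (intro mult_mono) auto
    finally show "\<bar>blinfun_apply f x\<bar> \<le> 1"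
      using x f by simp
  qed (rule evaluation_bounds)
  then show ?thesis
    using x by blast
qed

text \<open>By the second-order estimate the norm is Frechet differentiable at a unit rank one operator,
  so almost norming functionals of the predual converge in norm to the derivative.\<close>

lemma matrix_coeff_in_F: "matrix_coeff \<beta> \<alpha> \<in> F"
proof -
  have unit: "matrix_coeff \<beta> \<alpha> \<in> F" if u: "norm \<beta> = 1" "norm \<alpha> = 1" for \<beta> :: 'q and \<alpha> :: 'p
  proof -
    have e: "1 \<le> norm (rank1 \<beta> \<alpha>)"
      using norm_hop_apply[of "rank1 \<beta> \<alpha>" \<alpha>] u by (simp add: hinner_self)
    have "\<exists>f\<in>F. dist f (matrix_coeff \<beta> \<alpha>) < \<epsilon>" if "\<epsilon> > 0" for \<epsilon>
    proof -
      \<comment> \<open>Chosen so that the bound 5 t stays below \<epsilon>.\<close>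
      define t where "t = min 1 (\<epsilon> / 6)"
      have t: "0 < t" "t \<le> 1" "t \<le> \<epsilon> / 6"
        using that by (auto simp: t_def)
      then have "1 - t\<^sup>2 < norm (rank1 \<beta> \<alpha>)"
        using e by (smt (verit) zero_less_power)
      then obtain f where f: "f \<in> F" "norm f \<le> 1" "1 - t\<^sup>2 < f (rank1 \<beta> \<alpha>)"
        using almost_norming_functional by blast
      then have "norm (f - matrix_coeff \<beta> \<alpha>) \<le> 5 * t"
        using t u by (intro norming_sequence_rank1) auto
      then show ?thesis
        using f(1) t that by (intro bexI[of _ f]) (auto simp: dist_norm)
    qed
    then show ?thesis
      using closed_F by (metis closure_approachable closure_closed)
  qed
  show ?thesis
  proof (cases "\<beta> = 0 \<or> \<alpha> = 0")
    case True
    then have "matrix_coeff \<beta> \<alpha> = 0"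
      by (auto intro: blinfun_eqI)
    then show ?thesis
      using subspace_0[OF subspace_F] by simp
  next
    case False
    then have "matrix_coeff \<beta> \<alpha> = (norm \<beta> * norm \<alpha>) *\<^sub>R matrix_coeff (sgn \<beta>) (sgn \<alpha>)"
      unfolding sgn_div_norm matrix_coeff_scaleR by (simp add: divide_simps)
    then show ?thesis
      using False by (simp add: subspace_scale[OF subspace_F] unit norm_sgn)
  qed
qed

text \<open>A functional separating f from the closed span acts on F as an operator x. All matrix
  coefficients of x vanish, so x = 0, contradicting the separation.\<close>

lemma F_eq_closure_span: "F = closure (span (range (\<lambda>(\<beta>, \<alpha>). matrix_coeff \<beta> \<alpha>)))" (is "F = closure ?T")
proof
  have "?T \<subseteq> F"
    by (rule span_minimal[OF _ subspace_F]) (auto simp: matrix_coeff_in_F)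
  then show "closure ?T \<subseteq> F"
    by (rule closure_minimal[OF _ closed_F])
  show "F \<subseteq> closure ?T"
  proof
    fix f assume f: "f \<in> F"
    show "f \<in> closure ?T"
    proof (rule ccontr)
      assume "f \<notin> closure ?T"
      then obtain d where d: "d > 0" "\<And>t. t \<in> ?T \<Longrightarrow> d \<le> dist t f"
        unfolding closure_approachable by (auto simp: not_less)
      have "d \<le> norm (f + h)" if "h \<in> ?T" for h
        using d(2)[of "- h"] span_neg[OF that] by (simp add: dist_norm norm_minus_commute)
      then obtain g where g: "norm g \<le> 1" "\<And>h. h \<in> ?T \<Longrightarrow> blinfun_apply g h = 0" "blinfun_apply g f = d"
        using hahn_banach_separation[of ?T d f] d by auto
      obtain x where x: "\<forall>f\<in>F. blinfun_apply g f = blinfun_apply f x"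
        using bidual_representation g(1) by blast
      have "inner \<beta> (x \<cdot> \<alpha>) = 0" for \<beta> \<alpha>
      proof -
        have "blinfun_apply g (matrix_coeff \<beta> \<alpha>) = 0"
          by (intro g span_base) auto
        then show ?thesis
          using x matrix_coeff_in_F[of \<beta> \<alpha>] by simp
      qed
      then have "x = 0"
        by (intro hop_eqI) (metis inner_eq_zero_iff hop_apply_simps(11))
      then show False
        using x f g(3) d(1) by simp
    qed
  qed
qed

lemma F_approx:
  assumes "f \<in> F" "\<epsilon> > 0"
  shows "\<exists>g\<in>span (range (\<lambda>(\<beta>, \<alpha>). matrix_coeff \<beta> \<alpha>)). norm (f - g) < \<epsilon>"
  using assms unfolding F_eq_closure_span closure_approachable dist_norm by (simp add: norm_minus_commute)

text \<open>Reduces the weak* continuity of a bounded operator map to matrix coefficients; it is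
  applied to x |-> b x c and to its version with the adjoint of x.\<close>

lemma precompose_in_F:
  fixes \<Phi> :: "('p, 'q) hop \<Rightarrow>\<^sub>L ('p, 'q) hop"
  assumes \<Phi>: "\<And>\<beta> \<alpha>. matrix_coeff \<beta> \<alpha> o\<^sub>L \<Phi> \<in> F" and f: "f \<in> F"
  shows "f o\<^sub>L \<Phi> \<in> F"
proof -
  let ?T = "span (range (\<lambda>(\<beta>, \<alpha>). matrix_coeff \<beta> \<alpha>)) :: (('p, 'q) hop \<Rightarrow>\<^sub>L real) set"
  have bl: "bounded_linear (\<lambda>f :: ('p, 'q) hop \<Rightarrow>\<^sub>L real. f o\<^sub>L \<Phi>)"
    by (rule bounded_bilinear.bounded_linear_left[OF bounded_bilinear_blinfun_compose])
  have "subspace {f. f o\<^sub>L \<Phi> \<in> F}"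
    using linear_subspace_vimage[OF bounded_linear.linear[OF bl] subspace_F] by (simp add: vimage_def)
  then have "?T \<subseteq> {f. f o\<^sub>L \<Phi> \<in> F}"
    by (rule span_minimal[rotated]) (use \<Phi> in auto)
  moreover have "closed {f. f o\<^sub>L \<Phi> \<in> F}"
    using continuous_closed_vimage[OF closed_F linear_continuous_at[OF bl]] by (simp add: vimage_def)
  ultimately have "closure ?T \<subseteq> {f. f o\<^sub>L \<Phi> \<in> F}"
    by (rule closure_minimal)
  then show ?thesis
    using f F_eq_closure_span by blast
qed

lemma sandwich_in_F:
  assumes "f \<in> F"
  shows "\<exists>g\<in>F. \<forall>x. blinfun_apply g x = blinfun_apply f (b \<odot> x \<odot> c)"
proof -
  have "norm (b \<odot> x \<odot> c) \<le> norm x * (norm b * norm c)" for x :: "('p, 'q) hop"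
    using norm_hop_compose[of b "x \<odot> c"] mult_left_mono[OF norm_hop_compose[of x c], of "norm b"]
    by (simp add: mult_ac)
  then have "bounded_linear (\<lambda>x :: ('p, 'q) hop. b \<odot> x \<odot> c)"
    by (intro bounded_linear_intro[of _ "norm b * norm c"]) simp_all
  then have app: "Blinfun (\<lambda>x :: ('p, 'q) hop. b \<odot> x \<odot> c) x = b \<odot> x \<odot> c" for x
    by (simp add: bounded_linear_Blinfun_apply)
  have "matrix_coeff \<beta> \<alpha> o\<^sub>L Blinfun (\<lambda>x. b \<odot> x \<odot> c) = matrix_coeff (b\<^sup>\<dagger> \<cdot> \<beta>) (c \<cdot> \<alpha>)" for \<beta> \<alpha>
    by (rule blinfun_eqI) (simp add: app inner_hop_right)
  then have "f o\<^sub>L Blinfun (\<lambda>x. b \<odot> x \<odot> c) \<in> F"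
    by (intro precompose_in_F[OF _ assms]) (simp add: matrix_coeff_in_F)
  then show ?thesis
    by (rule bexI[rotated]) (simp add: app)
qed

lemma adjoint_sandwich_in_F:
  assumes "f \<in> F"
  shows "\<exists>g\<in>F. \<forall>x. blinfun_apply g x = blinfun_apply f (b \<odot> x\<^sup>\<dagger> \<odot> c)"
proof -
  have "norm (b \<odot> x\<^sup>\<dagger> \<odot> c) \<le> norm x * (norm b * norm c)" for x :: "('p, 'q) hop"
    using norm_hop_compose[of b "x\<^sup>\<dagger> \<odot> c"] mult_left_mono[OF norm_hop_compose[of "x\<^sup>\<dagger>" c], of "norm b"]
    by (simp add: mult_ac)
  then have "bounded_linear (\<lambda>x :: ('p, 'q) hop. b \<odot> x\<^sup>\<dagger> \<odot> c)"
    by (intro bounded_linear_intro[of _ "norm b * norm c"]) simp_all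
  then have app: "Blinfun (\<lambda>x :: ('p, 'q) hop. b \<odot> x\<^sup>\<dagger> \<odot> c) x = b \<odot> x\<^sup>\<dagger> \<odot> c" for x
    by (simp add: bounded_linear_Blinfun_apply)
  have "matrix_coeff \<beta> \<alpha> o\<^sub>L Blinfun (\<lambda>x. b \<odot> x\<^sup>\<dagger> \<odot> c) = matrix_coeff (c \<cdot> \<alpha>) (b\<^sup>\<dagger> \<cdot> \<beta>)" for \<beta> \<alpha>
  proof (rule blinfun_eqI)
    fix x :: "('p, 'q) hop"
    have "inner \<beta> (b \<cdot> x\<^sup>\<dagger> \<cdot> c \<cdot> \<alpha>) = inner (x \<cdot> b\<^sup>\<dagger> \<cdot> \<beta>) (c \<cdot> \<alpha>)"
      by (simp add: inner_hop_right[of \<beta>] inner_hop_left[of x])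
    then show "(matrix_coeff \<beta> \<alpha> o\<^sub>L Blinfun (\<lambda>x. b \<odot> x\<^sup>\<dagger> \<odot> c)) x = matrix_coeff (c \<cdot> \<alpha>) (b\<^sup>\<dagger> \<cdot> \<beta>) x"
      by (simp add: app inner_commute)
  qed
  then have "f o\<^sub>L Blinfun (\<lambda>x. b \<odot> x\<^sup>\<dagger> \<odot> c) \<in> F"
    by (intro precompose_in_F[OF _ assms]) (simp add: matrix_coeff_in_F)
  then show ?thesis
    by (rule bexI[rotated]) (simp add: app)
qed

text \<open>Strong convergence gives convergence against the span of matrix coefficients, and the
  uniform bound carries it over to the norm closure.\<close>

lemma F_tendsto:
  assumes f: "f \<in> F" and bd: "\<And>n. norm (X n) \<le> K" "norm u \<le> K"
    and lim: "\<And>v. (\<lambda>n. X n \<cdot> v) \<longlonglongrightarrow> u \<cdot> v"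
  shows "(\<lambda>n. blinfun_apply f (X n)) \<longlonglongrightarrow> blinfun_apply f u"
proof (rule LIMSEQ_I)
  fix r :: real assume r: "r > 0"
  \<comment> \<open>Replacing f by g then costs at most r / 4 at X n and at u; K + 1 keeps the
    denominator positive.\<close>
  define \<epsilon> where "\<epsilon> = r / (4 * (K + 1))"
  have K: "0 \<le> K"
    using bd(2) norm_ge_zero[of u] by linarith
  have \<epsilon>: "\<epsilon> > 0"
    using r K by (simp add: \<epsilon>_def)
  obtain g where g: "g \<in> span (range (\<lambda>(\<beta>, \<alpha>). matrix_coeff \<beta> \<alpha>))" "norm (f - g) < \<epsilon>"
    using F_approx[OF f \<epsilon>] by blast
  have "(\<lambda>n. blinfun_apply g (X n)) \<longlonglongrightarrow> blinfun_apply g u"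
    using g(1)
  proof (induction rule: span_induct_alt)
    case (step c x y)
    from step(1) obtain \<beta> \<alpha> where x: "x = matrix_coeff \<beta> \<alpha>" by auto
    show ?case
      unfolding x blinfun.bilinear_simps matrix_coeff_apply
      by (intro tendsto_intros lim step.IH)
  qed (simp add: zero_blinfun.rep_eq)
  then obtain N where N: "\<And>n. n \<ge> N \<Longrightarrow> norm (g (X n) - g u) < r / 2"
    using LIMSEQ_D[of _ _ "r / 2"] r by (metis half_gt_zero)
  have close: "\<bar>f x - g x\<bar> \<le> r / 4" if "norm x \<le> K" for x
  proof -
    have "\<bar>f x - g x\<bar> \<le> norm (f - g) * norm x"
      using norm_blinfun[of "f - g" x] by (simp add: blinfun.bilinear_simps)
    also have "\<dots> \<le> \<epsilon> * (K + 1)"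
      using that g(2) \<epsilon> by (intro mult_mono) auto
    also have "\<dots> = r / 4"
      using K by (simp add: \<epsilon>_def divide_simps)
    finally show ?thesis .
  qed
  have "norm (f (X n) - f u) < r" if "n \<ge> N" for n
    using N[OF that] close[OF bd(1)[of n]] close[OF bd(2)] unfolding real_norm_def by linarith
  then show "\<exists>no. \<forall>n\<ge>no. norm (f (X n) - f u) < r"
    by blast
qed

text \<open>Weak* density of finite rank operators, dual form. An element g of the span involves
  finitely many left vectors, so a contraction d whose adjoint kills them gives g (d x) = 0. If d is
  the identity minus a finite rank operator, then f (d x) = f x, and so f x equals (f - g) (d
  x).\<close>

lemma F_zero_if_vanishes_on_rank1:
  assumes f: "f \<in> F" and zero: "\<And>\<eta> \<xi>. blinfun_apply f (rank1 \<eta> \<xi>) = 0"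
  shows "blinfun_apply f x = 0"
proof -
  have contr: "\<exists>d. norm d \<le> 1 \<and> (\<forall>s\<in>S. d\<^sup>\<dagger> \<cdot> s = 0) \<and> (\<forall>x. blinfun_apply f (d \<odot> x) = blinfun_apply f x)"
    if "finite S" for S :: "'q set"
    using that
  proof (induction S rule: finite_induct)
    case empty
    obtain d :: "('q, 'q) hop" where d: "\<And>v. d \<cdot> v = v"
      using hop_exists[of "\<lambda>v. v :: 'q"] bounded_linear_ident by auto
    have "norm d \<le> 1" "d \<odot> x = x" for x :: "('p, 'q) hop"
      by (auto intro!: norm_hop_bound hop_eqI simp: d)
    then show ?case by auto
  next
    case (insert s S)
    then obtain d where d: "norm d \<le> 1" "\<forall>s\<in>S. d\<^sup>\<dagger> \<cdot> s = 0" "\<And>x. blinfun_apply f (d \<odot> x) = blinfun_apply f x"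
      by blast
    \<comment> \<open>A Gram-Schmidt step. If the vector is already zero, \<open>sgn\<close> returns
      0 and p below is the identity.\<close>
    define \<gamma> where "\<gamma> = sgn (d\<^sup>\<dagger> \<cdot> s)"
    obtain i :: "('q, 'q) hop" where i: "\<And>v. i \<cdot> v = v"
      using hop_exists[of "\<lambda>v. v :: 'q"] bounded_linear_ident by auto
    have iadj: "i\<^sup>\<dagger> = i"
      by (rule hop_adjointI) (simp add: i)
    define p where "p = i - rank1 \<gamma> \<gamma>"
    have np: "norm p \<le> 1"
    proof (rule norm_hop_bound)
      fix v
      have "hinner \<gamma> \<gamma> = 0 \<or> hinner \<gamma> \<gamma> = 1"
        by (auto simp: hinner_self \<gamma>_def norm_sgn)
      then have "inner (\<gamma> *\<^sub>H hinner \<gamma> v) (v - \<gamma> *\<^sub>H hinner \<gamma> v) = 0"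
      proof
        assume "hinner \<gamma> \<gamma> = 0"
        then have "\<gamma> = 0"
          using hinner_eq_0_imp_inner by fastforce
        then show ?thesis by simp
      next
        assume 1: "hinner \<gamma> \<gamma> = 1"
        have "inner (\<gamma> *\<^sub>H hinner \<gamma> v) (\<gamma> *\<^sub>H hinner \<gamma> v) = inner (\<gamma> *\<^sub>H hinner \<gamma> v) v"
          unfolding inner_eq_qRe_hinner hinner_scaleH_left hinner_scaleH_right by (simp add: 1)
        then show ?thesis
          by (simp add: inner_diff_right)
      qed
      then have "(norm v)\<^sup>2 = (norm (v - \<gamma> *\<^sub>H hinner \<gamma> v))\<^sup>2 + (norm (\<gamma> *\<^sub>H hinner \<gamma> v))\<^sup>2"
        using dot_norm[of "\<gamma> *\<^sub>H hinner \<gamma> v" "v - \<gamma> *\<^sub>H hinner \<gamma> v"] by simp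
      then have "(norm (p \<cdot> v))\<^sup>2 \<le> (norm v)\<^sup>2"
        by (simp add: p_def i)
      then show "norm (p \<cdot> v) \<le> 1 * norm v"
        using power2_le_imp_le[of "norm (p \<cdot> v)" "norm v"] by simp
    qed simp
    have padj: "p\<^sup>\<dagger> = p"
      by (simp add: p_def iadj)
    have "p \<cdot> d\<^sup>\<dagger> \<cdot> s = 0"
    proof (cases "d\<^sup>\<dagger> \<cdot> s = 0")
      case False
      have "d\<^sup>\<dagger> \<cdot> s = norm (d\<^sup>\<dagger> \<cdot> s) *\<^sub>R \<gamma>"
        using False by (simp add: \<gamma>_def sgn_div_norm)
      moreover have "p \<cdot> \<gamma> = 0"
        using False by (simp add: p_def i hinner_self \<gamma>_def norm_sgn)
      ultimately show ?thesis
        by (metis hop_apply_simps(4) scaleR_zero_right)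
    qed simp
    then have "\<forall>s\<in>insert s S. (d \<odot> p)\<^sup>\<dagger> \<cdot> s = 0"
      using d(2) by (simp add: padj)
    moreover have "norm (d \<odot> p) \<le> 1"
      using norm_hop_compose[of d p] mult_mono[OF d(1) np] by simp
    moreover have "blinfun_apply f ((d \<odot> p) \<odot> x) = blinfun_apply f x" for x
    proof -
      have "i \<odot> x = x"
        by (rule hop_eqI) (simp add: i)
      then have "(d \<odot> p) \<odot> x = d \<odot> x - rank1 (d \<cdot> \<gamma>) (x\<^sup>\<dagger> \<cdot> \<gamma>)"
        by (simp add: p_def hop_compose_assoc rank1_compose compose_rank1)
      then show ?thesis
        by (simp add: blinfun.bilinear_simps zero d(3))
    qed
    ultimately show ?case by blast
  qed
  have fin: "\<exists>S. finite S \<and> (\<forall>d :: ('q, 'q) hop. (\<forall>s\<in>S. d\<^sup>\<dagger> \<cdot> s = 0) \<longrightarrow> (\<forall>x. blinfun_apply g (d \<odot> x) = 0))"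
    if "g \<in> span (range (\<lambda>(\<beta>, \<alpha>). matrix_coeff \<beta> \<alpha>))" for g :: "('p, 'q) hop \<Rightarrow>\<^sub>L real"
    using that
  proof (induction rule: span_induct_alt)
    case base
    then show ?case
      by (intro exI[of _ "{}"]) simp
  next
    case (step c g h)
    obtain p where "g = (\<lambda>(\<beta>, \<alpha>). matrix_coeff \<beta> \<alpha>) p"
      by (rule rangeE[OF step(1)])
    then obtain \<beta> \<alpha> where g: "g = matrix_coeff \<beta> \<alpha>"
      by (cases p) simp
    obtain S where S: "finite S" "\<And>(d :: ('q, 'q) hop) x. (\<forall>s\<in>S. d\<^sup>\<dagger> \<cdot> s = 0) \<Longrightarrow> blinfun_apply h (d \<odot> x) = 0"
      using step.IH by blast
    have "blinfun_apply (c *\<^sub>R g + h) (d \<odot> x) = 0" if "\<forall>s\<in>insert \<beta> S. d\<^sup>\<dagger> \<cdot> s = 0" for d :: "('q, 'q) hop" and x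
      using S(2)[of d x] that by (simp add: g blinfun.bilinear_simps inner_hop_right[of \<beta>])
    then show ?case
      using S(1) by (intro exI[of _ "insert \<beta> S"]) blast
  qed
  have "\<bar>f x\<bar> \<le> 0"
  proof (rule le_zero_if_le_scaled)
    fix t :: real assume "0 < t"
    then obtain g where g: "g \<in> span (range (\<lambda>(\<beta>, \<alpha>). matrix_coeff \<beta> \<alpha>))" "norm (f - g) < t"
      using F_approx[OF f] by blast
    obtain S where S: "finite S" "\<And>(d :: ('q, 'q) hop) x. (\<forall>s\<in>S. d\<^sup>\<dagger> \<cdot> s = 0) \<Longrightarrow> blinfun_apply g (d \<odot> x) = 0"
      using fin[OF g(1)] by blast
    obtain d where d: "norm d \<le> 1" "\<forall>s\<in>S. d\<^sup>\<dagger> \<cdot> s = 0" "\<forall>x. blinfun_apply f (d \<odot> x) = blinfun_apply f x"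
      using contr[OF S(1)] by blast
    have "\<bar>f x\<bar> = \<bar>(f - g) (d \<odot> x)\<bar>"
      using d S(2)[OF d(2)] by (simp add: blinfun.bilinear_simps)
    also have "\<dots> \<le> norm (f - g) * norm (d \<odot> x)"
      using norm_blinfun[of "f - g" "d \<odot> x"] by simp
    also have "\<dots> \<le> t * (1 * norm x)"
      using g(2) d(1) norm_hop_compose[of d x] mult_right_mono[OF d(1), of "norm x"] \<open>0 < t\<close>
      by (intro mult_mono) auto
    finally show "\<bar>f x\<bar> \<le> t * norm x" by simp
  qed simp
  then show ?thesis by simp
qed

end

section \<open>Tripotents as limits of odd powers\<close>

text \<open>All inner products of the iterates are moments c (n + m). Even and odd moments are
  squared norms, which interlace because a is a contraction; so c decreases and stays nonnegative.
  Its convergence makes the iterates Cauchy.\<close>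

lemma powers_converge:
  fixes a :: "('a::quat_hilbert, 'b::quat_hilbert) hop"
  assumes a: "norm a \<le> 1"
  shows "convergent (\<lambda>n. (hop_apply (a\<^sup>\<dagger> \<odot> a) ^^ n) v)"
proof -
  define p where "p n = (hop_apply (a\<^sup>\<dagger> \<odot> a) ^^ n) v" for n
  have p_Suc: "p (Suc n) = a\<^sup>\<dagger> \<cdot> a \<cdot> p n" for n
    by (simp add: p_def)
  define c where "c n = inner v (p n)" for n
  have shift: "inner (p n) (p m) = c (n + m)" for n m
  proof (induction n arbitrary: m)
    case 0
    then show ?case by (simp add: c_def p_def)
  next
    case (Suc n)
    have "inner (p (Suc n)) (p m) = inner (p n) (p (Suc m))"
      by (simp add: p_Suc inner_hop_left)
    then show ?case
      using Suc by simp
  qed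
  have a1: "norm (a \<cdot> w) \<le> norm w" "norm (a\<^sup>\<dagger> \<cdot> w') \<le> norm w'" for w w'
    using a by (simp_all add: norm_hop_apply_le)
  have odd: "c (n + Suc n) = (norm (a \<cdot> p n))\<^sup>2" for n
    using shift[of n "Suc n"] by (simp add: p_Suc inner_hop_right power2_norm_eq_inner)
  have even: "c (n + n) = (norm (p n))\<^sup>2" for n
    using shift[of n n] by (simp add: power2_norm_eq_inner)
  have dec: "c (Suc k) \<le> c k" for k
  proof (cases "even k")
    case True
    then obtain n where "k = n + n" by (metis evenE mult_2)
    then show ?thesis
      using odd[of n] even[of n] a1 by (simp add: power_mono)
  next
    case False
    then obtain n where n: "k = n + Suc n" by (metis oddE mult_2 add_Suc_right Suc_eq_plus1)
    then have "c (Suc k) = (norm (a\<^sup>\<dagger> \<cdot> a \<cdot> p n))\<^sup>2"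
      using even[of "Suc n"] by (simp add: p_Suc)
    then show ?thesis
      using odd[of n] n a1 by (simp add: power_mono)
  qed
  have "0 \<le> c k" for k
  proof (cases "even k")
    case True
    then obtain n where "k = n + n" by (metis evenE mult_2)
    then show ?thesis using even[of n] by simp
  next
    case False
    then obtain n where n: "k = n + Suc n" by (metis oddE mult_2 add_Suc_right Suc_eq_plus1)
    then show ?thesis using odd[of n] by simp
  qed
  then have "convergent c"
    using decseq_convergent[of c 0] dec by (metis convergentI decseq_Suc_iff)
  then have c: "Cauchy c"
    by (rule convergent_Cauchy)
  have "Cauchy p"
  proof (rule metric_CauchyI)
    fix e :: real assume e: "e > 0"
    obtain N where N: "\<And>m n. m \<ge> N \<Longrightarrow> n \<ge> N \<Longrightarrow> dist (c m) (c n) < e\<^sup>2 / 2"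
      using metric_CauchyD[OF c, of "e\<^sup>2 / 2"] e by auto
    have "dist (p m) (p n) < e" if mn: "m \<ge> N" "n \<ge> N" for m n
    proof -
      have "(norm (p m - p n))\<^sup>2 = (c (m + m) - c (n + m)) + (c (n + n) - c (n + m))"
        using shift[of m m] shift[of n n] shift[of n m] shift[of m n]
        by (simp add: power2_norm_eq_inner inner_diff_left inner_diff_right add.commute)
      also have "\<dots> < e\<^sup>2"
        using N[of "m + m" "n + m"] N[of "n + n" "n + m"] mn unfolding dist_real_def by linarith
      finally show ?thesis
        using e by (simp add: dist_norm power_less_imp_less_base)
    qed
    then show "\<exists>M. \<forall>m\<ge>M. \<forall>n\<ge>M. dist (p m) (p n) < e"
      by blast
  qed
  then show ?thesis
    unfolding p_def by (rule Cauchy_convergent)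
qed

text \<open>The triple cube {a, a, a}. It sends a singular value s to s^3, so iteration kills all s
  < 1 and keeps s = 1, and it never leaves a subtriple.\<close>

definition cube :: "('a::quat_hilbert, 'b::quat_hilbert) hop \<Rightarrow> ('a, 'b) hop" where
  "cube a = a \<odot> a\<^sup>\<dagger> \<odot> a"

lemma cube_adjoint: "(cube a)\<^sup>\<dagger> = cube (a\<^sup>\<dagger>)"
  by (simp add: cube_def hop_compose_assoc)

lemma norm_cube_le: "norm a \<le> 1 \<Longrightarrow> norm (cube a) \<le> 1"
proof (rule norm_hop_bound)
  fix v assume a: "norm a \<le> 1"
  have "norm (a \<cdot> a\<^sup>\<dagger> \<cdot> a \<cdot> v) \<le> norm (a\<^sup>\<dagger> \<cdot> a \<cdot> v)"
    using a by (rule norm_hop_apply_le)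
  also have "\<dots> \<le> norm (a \<cdot> v)"
    using a by (simp add: norm_hop_apply_le)
  also have "\<dots> \<le> norm v"
    using a by (rule norm_hop_apply_le)
  finally show "norm (cube a \<cdot> v) \<le> 1 * norm v"
    by (simp add: cube_def)
qed simp

lemma cube_funpow_adjoint: "((cube ^^ n) a)\<^sup>\<dagger> = (cube ^^ n) (a\<^sup>\<dagger>)"
  by (induction n) (simp_all add: cube_adjoint)

lemma norm_cube_funpow_le: "norm a \<le> 1 \<Longrightarrow> norm ((cube ^^ n) a) \<le> 1"
  by (induction n) (simp_all add: norm_cube_le)

text \<open>The exponent follows the recursion m |-> 3 m + 1; only its growth to infinity matters
  for the limit, hence the mere lower bound.\<close>

lemma cube_funpow_apply:
  "\<exists>m\<ge>n. \<forall>v. (cube ^^ n) a \<cdot> v = a \<cdot> (hop_apply (a\<^sup>\<dagger> \<odot> a) ^^ m) v"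
proof (induction n)
  case 0
  show ?case by (intro exI[of _ 0]) simp
next
  case (Suc n)
  then obtain m where m: "m \<ge> n" "\<And>v. (cube ^^ n) a \<cdot> v = a \<cdot> (hop_apply (a\<^sup>\<dagger> \<odot> a) ^^ m) v"
    by blast
  let ?T = "hop_apply (a\<^sup>\<dagger> \<odot> a)"
  have T: "inner ((?T ^^ k) v) w = inner v ((?T ^^ k) w)" for k v w
  proof (induction k arbitrary: v)
    case (Suc k)
    have "inner ((?T ^^ Suc k) v) w = inner ((?T ^^ k) (?T v)) w"
      by (simp only: funpow_Suc_right o_apply)
    also have "\<dots> = inner (?T v) ((?T ^^ k) w)"
      by (rule Suc.IH)
    also have "\<dots> = inner v ((?T ^^ Suc k) w)"
      by (simp add: inner_hop_left)
    finally show ?case .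
  qed simp
  have adj: "((cube ^^ n) a)\<^sup>\<dagger> \<cdot> w = (?T ^^ m) (a\<^sup>\<dagger> \<cdot> w)" for w
  proof -
    have "inner v (((cube ^^ n) a)\<^sup>\<dagger> \<cdot> w) = inner v ((?T ^^ m) (a\<^sup>\<dagger> \<cdot> w))" for v
      by (simp add: m(2) T flip: inner_hop_left) (simp add: inner_hop_left T)
    then have "inner v (((cube ^^ n) a)\<^sup>\<dagger> \<cdot> w - (?T ^^ m) (a\<^sup>\<dagger> \<cdot> w)) = 0" for v
      by (simp add: inner_diff_right)
    then show ?thesis
      by (metis inner_eq_zero_iff right_minus_eq)
  qed
  have "(cube ^^ Suc n) a \<cdot> v = a \<cdot> (?T ^^ (m + (m + Suc m))) v" for v
  proof -
    have "(cube ^^ Suc n) a \<cdot> v = a \<cdot> (?T ^^ m) ((?T ^^ m) (a\<^sup>\<dagger> \<cdot> a \<cdot> (?T ^^ m) v))"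
      by (simp add: cube_def adj m(2))
    also have "a\<^sup>\<dagger> \<cdot> a \<cdot> (?T ^^ m) v = (?T ^^ Suc m) v"
      by simp
    finally show ?thesis
      unfolding funpow_add o_apply .
  qed
  moreover have "m + (m + Suc m) \<ge> Suc n"
    using m(1) by simp
  ultimately show ?case
    by blast
qed

lemma cube_funpow_limit:
  assumes a: "norm a \<le> 1"
  shows "\<exists>u. norm u \<le> 1 \<and> (\<forall>v. (\<lambda>n. (cube ^^ n) a \<cdot> v) \<longlonglongrightarrow> u \<cdot> v)"
proof -
  obtain m where m: "\<And>n. m n \<ge> n" "\<And>n v. (cube ^^ n) a \<cdot> v = a \<cdot> (hop_apply (a\<^sup>\<dagger> \<odot> a) ^^ m n) v"
    using cube_funpow_apply[of _ a] by metis
  have m_top: "filterlim m sequentially sequentially"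
    by (rule filterlim_at_top_mono[OF filterlim_ident]) (simp add: m(1))
  have "\<exists>l. (\<lambda>n. (cube ^^ n) a \<cdot> v) \<longlonglongrightarrow> l" for v
  proof -
    obtain l where "(\<lambda>n. (hop_apply (a\<^sup>\<dagger> \<odot> a) ^^ n) v) \<longlonglongrightarrow> l"
      using powers_converge[OF a, of v] convergent_def by blast
    then have "(\<lambda>n. (hop_apply (a\<^sup>\<dagger> \<odot> a) ^^ m n) v) \<longlonglongrightarrow> l"
      using m_top by (rule filterlim_compose)
    then show ?thesis
      unfolding m(2) using bounded_linear.tendsto[OF bounded_linear_hop_apply] by blast
  qed
  then obtain f where f: "\<And>v. (\<lambda>n. (cube ^^ n) a \<cdot> v) \<longlonglongrightarrow> f v"
    by metis
  have nf: "norm (f v) \<le> norm v" for v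
    using norm_cube_funpow_le[OF a]
    by (intro LIMSEQ_le_const2[OF tendsto_norm[OF f]] exI[of _ 0]) (simp add: norm_hop_apply_le)
  have "bounded_linear f"
  proof (rule bounded_linear_intro[of _ 1])
    show "f (x + y) = f x + f y" for x y
      using LIMSEQ_unique[OF f[of "x + y"]] tendsto_add[OF f[of x] f[of y]] by simp
    show "f (r *\<^sub>R x) = r *\<^sub>R f x" for r x
      using LIMSEQ_unique[OF f[of "r *\<^sub>R x"]] tendsto_scaleR[OF tendsto_const f[of x]] by simp
  qed (use nf in simp)
  moreover have "f (x *\<^sub>H c) = f x *\<^sub>H c" for x c
    using LIMSEQ_unique[OF f[of "x *\<^sub>H c"]] bounded_linear.tendsto[OF bounded_linear_scaleH f[of x], of c] by simp
  ultimately obtain u where u: "\<forall>v. u \<cdot> v = f v"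
    using hop_exists[of f] by blast
  have "norm u \<le> 1"
    by (rule norm_hop_bound) (use u nf in auto)
  then show ?thesis
    using u f by auto
qed

text \<open>The uniform bound makes evaluation jointly continuous for strong limits, which is needed
  for limits of triple products.\<close>

lemma hop_tendsto_compose:
  assumes bd: "\<And>n. norm (X n) \<le> 1" and X: "\<And>v. (\<lambda>n. X n \<cdot> v) \<longlonglongrightarrow> u \<cdot> v" and w: "w \<longlonglongrightarrow> w0"
  shows "(\<lambda>n. X n \<cdot> w n) \<longlonglongrightarrow> u \<cdot> w0"
proof -
  have "(\<lambda>n. X n \<cdot> (w n - w0)) \<longlonglongrightarrow> 0"
  proof (rule tendsto_norm_zero_cancel)
    show "(\<lambda>n. norm (X n \<cdot> (w n - w0))) \<longlonglongrightarrow> 0"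
    proof (rule tendsto_sandwich[of "\<lambda>_. 0" _ _ "\<lambda>n. norm (w n - w0)"])
      show "(\<lambda>n. norm (w n - w0)) \<longlonglongrightarrow> 0"
        using w by (simp add: LIM_zero tendsto_norm_zero)
      show "\<forall>\<^sub>F n in sequentially. norm (X n \<cdot> (w n - w0)) \<le> norm (w n - w0)"
        by (intro always_eventually allI norm_hop_apply_le bd)
    qed auto
  qed
  then have "(\<lambda>n. X n \<cdot> (w n - w0) + X n \<cdot> w0) \<longlonglongrightarrow> 0 + u \<cdot> w0"
    by (intro tendsto_add X)
  then show ?thesis by simp
qed

text \<open>The limit u is fixed by \<open>cube\<close>, being also the limit of the shifted
  sequence. Taking adjoints is not strongly continuous, so the adjoint sequence gets its own strong
  limit, which is then identified weakly with \<open>u\<^sup>\<dagger>\<close>.\<close>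

lemma cube_funpow_limit_tripotent:
  assumes a: "norm a \<le> 1"
  shows "\<exists>u. norm u \<le> 1 \<and> (\<forall>v. (\<lambda>n. (cube ^^ n) a \<cdot> v) \<longlonglongrightarrow> u \<cdot> v) \<and> u \<odot> u\<^sup>\<dagger> \<odot> u = u"
proof -
  obtain u where u: "norm u \<le> 1" "\<And>v. (\<lambda>n. (cube ^^ n) a \<cdot> v) \<longlonglongrightarrow> u \<cdot> v"
    using cube_funpow_limit[OF a] by blast
  obtain u' where u': "norm u' \<le> 1" "\<And>v. (\<lambda>n. (cube ^^ n) (a\<^sup>\<dagger>) \<cdot> v) \<longlonglongrightarrow> u' \<cdot> v"
    using cube_funpow_limit[of "a\<^sup>\<dagger>"] a by auto
  have adj: "u\<^sup>\<dagger> = u'"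
  proof (rule hop_adjointI)
    fix v w
    have "(\<lambda>n. inner ((cube ^^ n) a \<cdot> v) w) \<longlonglongrightarrow> inner (u \<cdot> v) w"
      by (intro tendsto_intros u)
    moreover have "(\<lambda>n. inner v ((cube ^^ n) (a\<^sup>\<dagger>) \<cdot> w)) \<longlonglongrightarrow> inner v (u' \<cdot> w)"
      by (intro tendsto_intros u')
    ultimately show "inner (u \<cdot> v) w = inner v (u' \<cdot> w)"
      by (simp add: inner_hop_left cube_funpow_adjoint LIMSEQ_unique)
  qed
  have "u \<cdot> u' \<cdot> u \<cdot> v = u \<cdot> v" for v
  proof (rule LIMSEQ_unique)
    show "(\<lambda>n. (cube ^^ Suc n) a \<cdot> v) \<longlonglongrightarrow> u \<cdot> v"
      by (rule LIMSEQ_Suc[OF u(2)])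
    have "(\<lambda>n. (cube ^^ n) a \<cdot> (cube ^^ n) (a\<^sup>\<dagger>) \<cdot> (cube ^^ n) a \<cdot> v) \<longlonglongrightarrow> u \<cdot> u' \<cdot> u \<cdot> v"
      using norm_cube_funpow_le[of a] norm_cube_funpow_le[of "a\<^sup>\<dagger>"] a
      by (intro hop_tendsto_compose[OF _ u(2)] hop_tendsto_compose[OF _ u'(2)] u(2)) auto
    then show "(\<lambda>n. (cube ^^ Suc n) a \<cdot> v) \<longlonglongrightarrow> u \<cdot> u' \<cdot> u \<cdot> v"
      by (simp add: cube_def cube_funpow_adjoint)
  qed
  then have "u \<odot> u\<^sup>\<dagger> \<odot> u = u"
    by (intro hop_eqI) (simp add: adj)
  then show ?thesis
    using u by blast
qed

text \<open>On a singular value \<open>s\<close> the perturbation is \<open>s + (s - s ^ 3) / 2\<close>, which maps \<open>[0, 1]\<close> into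
  itself.\<close>

lemma norm_cube_perturbation_le:
  fixes a :: "('a::quat_hilbert, 'b::quat_hilbert) hop"
  assumes a: "norm a \<le> 1"
  shows "norm (a + (1/2) *\<^sub>R (a - cube a)) \<le> 1"
proof (rule norm_hop_bound)
  fix v
  define S where "S w = w - a\<^sup>\<dagger> \<cdot> a \<cdot> w" for w
  have pos: "0 \<le> inner w (S w)" for w
  proof -
    have "(norm (a \<cdot> w))\<^sup>2 \<le> (norm w)\<^sup>2"
      by (intro power_mono norm_hop_apply_le a) auto
    then show ?thesis
      by (simp add: S_def inner_diff_right inner_hop_right power2_norm_eq_inner)
  qed
  have sym: "inner (S w) z = inner w (S z)" for w z
    by (simp add: S_def inner_diff_right inner_diff_left inner_hop_left)
  have v: "inner (S v) v = inner v (S v)" "inner v (S (S v)) = inner (S v) (S v)"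
    by (simp_all add: sym)
  have S_lin: "S (w + r *\<^sub>R z) = S w + r *\<^sub>R S z" for w z r
    by (simp add: S_def algebra_simps)
  define z where "z = v + (1/2) *\<^sub>R S v"
  have "(a + (1/2) *\<^sub>R (a - cube a)) \<cdot> v = a \<cdot> z"
    by (simp add: z_def S_def cube_def)
  then have "(norm ((a + (1/2) *\<^sub>R (a - cube a)) \<cdot> v))\<^sup>2 = (norm (a \<cdot> z))\<^sup>2"
    by (simp only:)
  moreover have "(norm (a \<cdot> z))\<^sup>2 = inner z z - inner z (S z)"
    by (simp add: S_def inner_diff_right inner_hop_right power2_norm_eq_inner)
  moreover have "inner z z = inner v v + inner v (S v) + (1/4) * inner (S v) (S v)"
    by (simp add: z_def inner_add_left inner_add_right v add_divide_distrib)
  moreover have "inner z (S z) = inner v (S v) + inner (S v) (S v) + (1/4) * inner (S v) (S (S v))"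
    unfolding z_def S_lin by (simp add: inner_add_left inner_add_right v field_simps)
  \<comment> \<open>The terms in inner v (S v) cancel; what is left besides norm v squared is - 3/4
    inner (S v) (S v) - 1/4 inner (S v) (S (S v)).\<close>
  ultimately have "(norm ((a + (1/2) *\<^sub>R (a - cube a)) \<cdot> v))\<^sup>2 \<le> (norm v)\<^sup>2"
    using pos[of "S v"] inner_ge_zero[of "S v"] power2_norm_eq_inner[of v] by linarith
  then show "norm ((a + (1/2) *\<^sub>R (a - cube a)) \<cdot> v) \<le> 1 * norm v"
    using power2_le_imp_le[of "norm ((a + (1/2) *\<^sub>R (a - cube a)) \<cdot> v)" "norm v"] by simp
qed simp

lemma blinfun_le_norm: "f a \<le> norm f" if "norm a \<le> 1" for f :: "'a::real_normed_vector \<Rightarrow>\<^sub>L real"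
  using norm_blinfun[of f a] mult_left_mono[OF that, of "norm f"] by simp

text \<open>Both a + (a - cube a) / 2 and cube a lie in the unit ball. The first forces f (cube a)
  \<ge> f a, the second f (cube a) \<le> norm f.\<close>

lemma norming_cube:
  fixes f :: "('a::quat_hilbert, 'b::quat_hilbert) hop \<Rightarrow>\<^sub>L real"
  assumes "norm a \<le> 1" "f a = norm f"
  shows "f (cube a) = norm f"
proof -
  have "f (a + (1/2) *\<^sub>R (a - cube a)) \<le> norm f"
    by (rule blinfun_le_norm[OF norm_cube_perturbation_le[OF assms(1)]])
  moreover have "f (cube a) \<le> norm f"
    by (rule blinfun_le_norm[OF norm_cube_le[OF assms(1)]])
  ultimately show ?thesis
    using assms(2) by (simp add: blinfun.bilinear_simps)
qed

text \<open>J is left abstract because the result is used both for a subtriple and for the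
  self-adjoint part of one of its corners, which is closed under cubes and bounded strong
  limits.\<close>

lemma (in operator_predual) norming_tripotent:
  assumes f: "f \<in> F" "blinfun_apply f a = norm f" and a: "a \<in> J" "norm a \<le> 1"
    and cube: "\<And>b. b \<in> J \<Longrightarrow> cube b \<in> J"
    and lim: "\<And>X u. (\<And>n. X n \<in> J) \<Longrightarrow> (\<And>n. norm (X n) \<le> 1) \<Longrightarrow> norm u \<le> 1 \<Longrightarrow>
      (\<And>v. (\<lambda>n. X n \<cdot> v) \<longlonglongrightarrow> u \<cdot> v) \<Longrightarrow> u \<in> J"
  shows "\<exists>u\<in>J. norm u \<le> 1 \<and> u \<odot> u\<^sup>\<dagger> \<odot> u = u \<and> blinfun_apply f u = norm f"
proof -
  obtain u where u: "norm u \<le> 1" "\<And>v. (\<lambda>n. (cube ^^ n) a \<cdot> v) \<longlonglongrightarrow> u \<cdot> v" "u \<odot> u\<^sup>\<dagger> \<odot> u = u"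
    using cube_funpow_limit_tripotent[OF a(2)] by blast
  have "(cube ^^ n) a \<in> J" for n
    by (induction n) (simp_all add: a cube)
  then have "u \<in> J"
    by (rule lim[OF _ norm_cube_funpow_le[OF a(2)] u(1,2)])
  moreover have "blinfun_apply f ((cube ^^ n) a) = norm f" for n
    by (induction n) (simp_all add: f(2) norming_cube norm_cube_funpow_le a)
  then have "blinfun_apply f u = norm f"
    using LIMSEQ_unique[OF F_tendsto[OF f(1) norm_cube_funpow_le[OF a(2)] u(1,2)]] by simp
  ultimately show ?thesis
    using u by blast
qed

section \<open>Self-adjoint parts of corners\<close>

text \<open>For a tripotent e, the first summand is the Peirce-2 projection and
  \<open>e \<odot> x\<^sup>\<dagger> \<odot> e\<close> is the involution of the corner, so this is
  the projection onto the self-adjoint part of the corner.\<close>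

definition herm :: "('a::quat_hilbert, 'b::quat_hilbert) hop \<Rightarrow> ('a, 'b) hop \<Rightarrow> ('a, 'b) hop" where
  "herm e x = (1/2) *\<^sub>R (e \<odot> e\<^sup>\<dagger> \<odot> x \<odot> e\<^sup>\<dagger> \<odot> e + e \<odot> x\<^sup>\<dagger> \<odot> e)"

lemma tripotent_apply:
  assumes "e \<odot> e\<^sup>\<dagger> \<odot> e = e"
  shows "e \<cdot> e\<^sup>\<dagger> \<cdot> e \<cdot> v = e \<cdot> v" "e\<^sup>\<dagger> \<cdot> e \<cdot> e\<^sup>\<dagger> \<cdot> w = e\<^sup>\<dagger> \<cdot> w"
proof -
  show "e \<cdot> e\<^sup>\<dagger> \<cdot> e \<cdot> v = e \<cdot> v"
    using arg_cong[OF assms, of "\<lambda>a. a \<cdot> v"] by simp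
  have "e\<^sup>\<dagger> \<odot> e \<odot> e\<^sup>\<dagger> = e\<^sup>\<dagger>"
    using arg_cong[OF assms, of hop_adjoint] by (simp add: hop_compose_assoc)
  then show "e\<^sup>\<dagger> \<cdot> e \<cdot> e\<^sup>\<dagger> \<cdot> w = e\<^sup>\<dagger> \<cdot> w"
    by (metis hop_compose_apply)
qed

lemma tripotent_norm_le:
  assumes e: "e \<odot> e\<^sup>\<dagger> \<odot> e = e"
  shows "norm e \<le> 1"
proof (rule norm_hop_bound)
  fix v
  have "(norm (e \<cdot> v))\<^sup>2 = inner (e\<^sup>\<dagger> \<cdot> e \<cdot> v) v"
    by (simp add: power2_norm_eq_inner inner_hop_right)
  also have "\<dots> \<le> norm (e\<^sup>\<dagger> \<cdot> e \<cdot> v) * norm v"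
    by (rule norm_cauchy_schwarz)
  also have "norm (e\<^sup>\<dagger> \<cdot> e \<cdot> v) = norm (e \<cdot> v)"
  proof -
    have "inner (e\<^sup>\<dagger> \<cdot> e \<cdot> v) (e\<^sup>\<dagger> \<cdot> e \<cdot> v) = inner (e \<cdot> v) (e \<cdot> v)"
      by (subst inner_hop_left) (simp add: tripotent_apply[OF e])
    then show ?thesis
      by (simp add: norm_eq_sqrt_inner)
  qed
  finally have "norm (e \<cdot> v) * norm (e \<cdot> v) \<le> norm (e \<cdot> v) * norm v"
    by (simp add: power2_eq_square)
  then show "norm (e \<cdot> v) \<le> 1 * norm v"
    by (cases "norm (e \<cdot> v) = 0") (simp_all add: mult_le_cancel_left_pos)
qed simp

lemma herm_apply: "herm e x \<cdot> v = (1/2) *\<^sub>R (e \<cdot> e\<^sup>\<dagger> \<cdot> x \<cdot> e\<^sup>\<dagger> \<cdot> e \<cdot> v + e \<cdot> x\<^sup>\<dagger> \<cdot> e \<cdot> v)"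
  by (simp add: herm_def)

lemma herm_self_adjoint:
  assumes "e \<odot> e\<^sup>\<dagger> \<odot> e = e"
  shows "e \<odot> (herm e x)\<^sup>\<dagger> \<odot> e = herm e x"
  by (rule hop_eqI) (simp add: herm_def tripotent_apply[OF assms] hop_compose_assoc add.commute)

lemma herm_eq_self:
  assumes e: "e \<odot> e\<^sup>\<dagger> \<odot> e = e" and x: "e \<odot> x\<^sup>\<dagger> \<odot> e = x"
  shows "herm e x = x"
proof -
  have "x\<^sup>\<dagger> = e\<^sup>\<dagger> \<odot> x \<odot> e\<^sup>\<dagger>"
    using arg_cong[OF x, of hop_adjoint] by (simp add: hop_compose_assoc)
  then have "e \<odot> e\<^sup>\<dagger> \<odot> x \<odot> e\<^sup>\<dagger> \<odot> e = e \<odot> x\<^sup>\<dagger> \<odot> e"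
    by (simp add: hop_compose_assoc)
  then show ?thesis
    by (simp add: herm_def x flip: scaleR_2)
qed

lemma herm_herm: "e \<odot> e\<^sup>\<dagger> \<odot> e = e \<Longrightarrow> herm e (herm e x) = herm e x"
  by (simp add: herm_eq_self herm_self_adjoint)

lemma norm_herm_le:
  assumes "norm e \<le> 1"
  shows "norm (herm e x) \<le> norm x"
proof (rule norm_hop_bound)
  fix v
  have e: "norm (e \<cdot> w) \<le> norm w" "norm (e\<^sup>\<dagger> \<cdot> w') \<le> norm w'" for w w'
    using assms by (simp_all add: norm_hop_apply_le)
  have "norm (e \<cdot> e\<^sup>\<dagger> \<cdot> x \<cdot> e\<^sup>\<dagger> \<cdot> e \<cdot> v) \<le> norm (x \<cdot> e\<^sup>\<dagger> \<cdot> e \<cdot> v)"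
    using e(1) e(2) order_trans by blast
  also have "\<dots> \<le> norm x * norm (e\<^sup>\<dagger> \<cdot> e \<cdot> v)"
    by (rule norm_hop_apply)
  also have "\<dots> \<le> norm x * norm v"
    using e(1) e(2) order_trans by (intro mult_left_mono) (blast, simp)
  finally have 1: "norm (e \<cdot> e\<^sup>\<dagger> \<cdot> x \<cdot> e\<^sup>\<dagger> \<cdot> e \<cdot> v) \<le> norm x * norm v" .
  have "norm (e \<cdot> x\<^sup>\<dagger> \<cdot> e \<cdot> v) \<le> norm (x\<^sup>\<dagger> \<cdot> e \<cdot> v)"
    by (rule e)
  also have "\<dots> \<le> norm x * norm (e \<cdot> v)"
    using norm_hop_apply[of "x\<^sup>\<dagger>"] by simp
  also have "\<dots> \<le> norm x * norm v"
    by (intro mult_left_mono e) simp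
  finally have 2: "norm (e \<cdot> x\<^sup>\<dagger> \<cdot> e \<cdot> v) \<le> norm x * norm v" .
  show "norm (herm e x \<cdot> v) \<le> norm x * norm v"
    using norm_triangle_ineq[of "e \<cdot> e\<^sup>\<dagger> \<cdot> x \<cdot> e\<^sup>\<dagger> \<cdot> e \<cdot> v" "e \<cdot> x\<^sup>\<dagger> \<cdot> e \<cdot> v"] 1 2 by (simp add: herm_apply)
qed simp

lemma norm_blinfun_le_of_ball:
  fixes f :: "'a::real_normed_vector \<Rightarrow>\<^sub>L real"
  assumes "\<And>x. norm x \<le> 1 \<Longrightarrow> f x \<le> c"
  shows "norm f \<le> c"
proof (rule norm_blinfun_bound)
  show "0 \<le> c"
    using assms[of 0] by (simp add: blinfun.zero_right)
  fix x
  show "norm (f x) \<le> c * norm x"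
  proof (cases "x = 0")
    case False
    have "\<bar>f (sgn x)\<bar> \<le> c"
      using assms[of "sgn x"] assms[of "- sgn x"] False by (simp add: norm_sgn blinfun.minus_right abs_le_iff)
    then show ?thesis
      using False by (simp add: sgn_div_norm blinfun.scaleR_right abs_mult divide_simps)
  qed (simp add: blinfun.zero_right)
qed

lemma norm_le_of_idempotent:
  assumes "p\<^sup>\<dagger> = p" "\<And>v. p \<cdot> p \<cdot> v = p \<cdot> v"
  shows "norm (p \<cdot> w) \<le> norm w"
proof -
  have "norm (p \<cdot> w) * norm (p \<cdot> w) = inner (p \<cdot> w) w"
    using assms by (simp add: inner_hop_left flip: power2_norm_eq_inner power2_eq_square)
      (simp add: power2_norm_eq_inner inner_hop_left assms)
  also have "\<dots> \<le> norm (p \<cdot> w) * norm w"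
    by (rule norm_cauchy_schwarz)
  finally show ?thesis
    by (cases "norm (p \<cdot> w) = 0") (simp_all add: mult_le_cancel_left_pos)
qed

section \<open>Positive normal functionals of a corner\<close>

context operator_predual
begin

text \<open>For a tripotent e, the cone of positive normal functionals of the corner with unit e:
  positivity is encoded as attaining the norm at the unit.\<close>

definition positive_at :: "('p, 'q) hop \<Rightarrow> (('p, 'q) hop \<Rightarrow>\<^sub>L real) set" where
  "positive_at e = {f \<in> F. blinfun_apply f e = norm f}"

lemma positive_at_zero: "0 \<in> positive_at e"
  using subspace_0[OF subspace_F] by (simp add: positive_at_def)

lemma positive_at_add:
  assumes "norm e \<le> 1" "f \<in> positive_at e" "g \<in> positive_at e"
  shows "f + g \<in> positive_at e"
proof -
  have "norm (f + g) \<le> norm f + norm g"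
    by (rule norm_triangle_ineq)
  moreover have "blinfun_apply (f + g) e \<le> norm (f + g)"
    by (rule blinfun_le_norm[OF assms(1)])
  ultimately show ?thesis
    using assms subspace_add[OF subspace_F] by (auto simp: positive_at_def blinfun.add_left)
qed

lemma positive_at_scaleR: "0 \<le> c \<Longrightarrow> f \<in> positive_at e \<Longrightarrow> c *\<^sub>R f \<in> positive_at e"
  using subspace_scale[OF subspace_F] by (simp add: positive_at_def blinfun.scaleR_left)

lemma herm_in_F: "f \<in> F \<Longrightarrow> \<exists>g\<in>F. \<forall>x. blinfun_apply g x = blinfun_apply f (herm e x)"
proof -
  assume f: "f \<in> F"
  obtain g1 where g1: "g1 \<in> F" "\<And>x. blinfun_apply g1 x = blinfun_apply f ((e \<odot> e\<^sup>\<dagger>) \<odot> x \<odot> (e\<^sup>\<dagger> \<odot> e))"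
    using sandwich_in_F[OF f] by blast
  obtain g2 where g2: "g2 \<in> F" "\<And>x. blinfun_apply g2 x = blinfun_apply f (e \<odot> x\<^sup>\<dagger> \<odot> e)"
    using adjoint_sandwich_in_F[OF f] by blast
  show ?thesis
  proof (intro bexI allI)
    show "(1/2) *\<^sub>R (g1 + g2) \<in> F"
      by (intro subspace_scale subspace_add subspace_F g1 g2)
    show "blinfun_apply ((1/2) *\<^sub>R (g1 + g2)) x = blinfun_apply f (herm e x)" for x
      by (simp add: herm_def blinfun.bilinear_simps g1 g2 hop_compose_assoc)
  qed
qed

text \<open>Polarization: after passing to self-adjoint parts, a matrix coefficient becomes a difference
  of vector states.\<close>

lemma span_herm_decomposition:
  assumes e: "e \<odot> e\<^sup>\<dagger> \<odot> e = e"
    and t: "t \<in> span (range (\<lambda>(\<beta>, \<alpha>). matrix_coeff \<beta> \<alpha>))"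
  shows "\<exists>f\<in>positive_at e. \<exists>g\<in>positive_at e. \<forall>x. blinfun_apply t (herm e x) = blinfun_apply f x - blinfun_apply g x"
  using t
proof (induction rule: span_induct_alt)
  case base
  show ?case
    using positive_at_zero by (intro bexI[of _ 0]) simp_all
next
  case (step c s t)
  obtain p where "s = (\<lambda>(\<beta>, \<alpha>). matrix_coeff \<beta> \<alpha>) p"
    by (rule rangeE[OF step(1)])
  then obtain \<beta> \<alpha> where s: "s = matrix_coeff \<beta> \<alpha>"
    by (cases p) simp
  have e1: "norm e \<le> 1"
    by (rule tripotent_norm_le[OF e])
  define \<omega> where "\<omega> \<xi> = matrix_coeff (e \<cdot> \<xi>) \<xi>" for \<xi>
  have pos: "\<omega> \<xi> \<in> positive_at e" if \<xi>: "e\<^sup>\<dagger> \<cdot> e \<cdot> \<xi> = \<xi>" for \<xi>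
  proof -
    have eq: "inner (e \<cdot> \<xi>) (e \<cdot> \<xi>) = (norm \<xi>)\<^sup>2"
      by (simp add: inner_hop_left \<xi> power2_norm_eq_inner)
    then have "norm (\<omega> \<xi>) \<le> (norm \<xi>)\<^sup>2"
      using norm_matrix_coeff_le[of "e \<cdot> \<xi>" \<xi>] by (simp add: \<omega>_def norm_eq_sqrt_inner power2_eq_square)
    moreover have "blinfun_apply (\<omega> \<xi>) e \<le> norm (\<omega> \<xi>)"
      by (rule blinfun_le_norm[OF e1])
    ultimately show ?thesis
      using eq matrix_coeff_in_F by (simp add: positive_at_def \<omega>_def)
  qed
  define \<alpha>' where "\<alpha>' = e\<^sup>\<dagger> \<cdot> e \<cdot> \<alpha>"
  define \<beta>' where "\<beta>' = e\<^sup>\<dagger> \<cdot> \<beta>"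
  have inv: "e\<^sup>\<dagger> \<cdot> e \<cdot> \<alpha>' = \<alpha>'" "e\<^sup>\<dagger> \<cdot> e \<cdot> \<beta>' = \<beta>'" "e \<cdot> \<alpha> = e \<cdot> \<alpha>'"
    by (simp_all add: \<alpha>'_def \<beta>'_def tripotent_apply[OF e])
  \<comment> \<open>Passing from + to - changes the vector state by twice the sum of its two cross
    terms, while \<open>herm\<close> averages these terms; hence 1/4.\<close>
  define f0 where "f0 = (1/4) *\<^sub>R \<omega> (\<alpha>' + \<beta>')"
  define g0 where "g0 = (1/4) *\<^sub>R \<omega> (\<alpha>' - \<beta>')"
  have fg0: "f0 \<in> positive_at e" "g0 \<in> positive_at e"
    unfolding f0_def g0_def by (intro positive_at_scaleR pos; simp add: inv)+
  have s0: "blinfun_apply s (herm e x) = blinfun_apply f0 x - blinfun_apply g0 x" for x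
  proof -
    have "inner \<beta> (e \<cdot> e\<^sup>\<dagger> \<cdot> x \<cdot> e\<^sup>\<dagger> \<cdot> e \<cdot> \<alpha>) = inner (e \<cdot> \<beta>') (x \<cdot> \<alpha>')"
      by (simp add: inner_hop_right[of \<beta>] inner_hop_right[of "e\<^sup>\<dagger> \<cdot> \<beta>"] \<alpha>'_def \<beta>'_def)
    moreover have "inner \<beta> (e \<cdot> x\<^sup>\<dagger> \<cdot> e \<cdot> \<alpha>) = inner (e \<cdot> \<alpha>') (x \<cdot> \<beta>')"
      by (simp add: inner_hop_right[of \<beta>] inner_hop_right[of "e\<^sup>\<dagger> \<cdot> \<beta>"] inv(3) \<beta>'_def inner_commute)
    ultimately show ?thesis
      by (simp add: s f0_def g0_def \<omega>_def blinfun.scaleR_left herm_apply inner_add_left inner_add_right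
          inner_diff_left inner_diff_right field_simps)
  qed
  obtain f g where fg: "f \<in> positive_at e" "g \<in> positive_at e"
    "\<And>x. blinfun_apply t (herm e x) = blinfun_apply f x - blinfun_apply g x"
    using step.IH by blast
  show ?case
  proof (cases "0 \<le> c")
    case True
    have "c *\<^sub>R f0 + f \<in> positive_at e" "c *\<^sub>R g0 + g \<in> positive_at e"
      by (intro positive_at_add positive_at_scaleR True e1 fg fg0)+
    moreover have "blinfun_apply (c *\<^sub>R s + t) (herm e x)
        = blinfun_apply (c *\<^sub>R f0 + f) x - blinfun_apply (c *\<^sub>R g0 + g) x" for x
      by (simp add: blinfun.bilinear_simps s0 fg(3) algebra_simps)
    ultimately show ?thesis
      by blast
  next
    case False
    then have "(- c) *\<^sub>R g0 + f \<in> positive_at e" "(- c) *\<^sub>R f0 + g \<in> positive_at e"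
      by (intro positive_at_add positive_at_scaleR e1 fg fg0; simp)+
    moreover have "blinfun_apply (c *\<^sub>R s + t) (herm e x)
        = blinfun_apply ((- c) *\<^sub>R g0 + f) x - blinfun_apply ((- c) *\<^sub>R f0 + g) x" for x
      by (simp add: blinfun.bilinear_simps s0 fg(3) algebra_simps)
    ultimately show ?thesis
      by blast
  qed
qed

text \<open>The Jordan decomposition of a self-adjoint functional \<open>k\<close> that attains its norm at a
  self-adjoint tripotent \<open>u\<close>: \<open>pp\<close> and \<open>pm\<close> are the spectral projections of \<open>u e\<^sup>\<dagger>\<close> for the
  eigenvalues \<open>1\<close> and \<open>- 1\<close>, and \<open>rp\<close>, \<open>rm\<close> those of \<open>e\<^sup>\<dagger> u\<close>.\<close>

lemma jordan_decomposition:
  assumes e: "e \<odot> e\<^sup>\<dagger> \<odot> e = e" and u: "u \<odot> u\<^sup>\<dagger> \<odot> u = u" and ue: "e \<odot> u\<^sup>\<dagger> \<odot> e = u"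
    and k: "k \<in> F" "blinfun_apply k u = norm k" "\<And>x. blinfun_apply k (herm e x) = blinfun_apply k x"
  shows "\<exists>f\<in>positive_at e. \<exists>g\<in>positive_at e. \<forall>x. blinfun_apply k x = blinfun_apply f x - blinfun_apply g x"
proof -
  have e1: "norm e \<le> 1" and u1: "norm u \<le> 1"
    using tripotent_norm_le e u by auto
  note e' = tripotent_apply[OF e] and u' = tripotent_apply[OF u]
  have ue': "u\<^sup>\<dagger> = e\<^sup>\<dagger> \<odot> u \<odot> e\<^sup>\<dagger>"
    using arg_cong[OF ue, of hop_adjoint] by (simp add: hop_compose_assoc)
  have a1: "u \<cdot> v = e \<cdot> u\<^sup>\<dagger> \<cdot> e \<cdot> v" for v
    using arg_cong[OF ue, of "\<lambda>a. a \<cdot> v"] by simp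
  have a2: "u\<^sup>\<dagger> \<cdot> w = e\<^sup>\<dagger> \<cdot> u \<cdot> e\<^sup>\<dagger> \<cdot> w" for w
    using arg_cong[OF ue', of "\<lambda>a. a \<cdot> w"] by simp
  have b1: "e \<cdot> e\<^sup>\<dagger> \<cdot> u \<cdot> v = u \<cdot> v" "u \<cdot> e\<^sup>\<dagger> \<cdot> e \<cdot> v = u \<cdot> v" for v
    by (simp_all add: a1 e')
  have b2: "e\<^sup>\<dagger> \<cdot> e \<cdot> u\<^sup>\<dagger> \<cdot> w = u\<^sup>\<dagger> \<cdot> w" "u\<^sup>\<dagger> \<cdot> e \<cdot> e\<^sup>\<dagger> \<cdot> w = u\<^sup>\<dagger> \<cdot> w" for w
    by (simp_all add: a2 e')
  have c1: "e\<^sup>\<dagger> \<cdot> u \<cdot> v = u\<^sup>\<dagger> \<cdot> e \<cdot> v" for v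
    unfolding a1 b2 ..
  have c2: "e \<cdot> u\<^sup>\<dagger> \<cdot> w = u \<cdot> e\<^sup>\<dagger> \<cdot> w" for w
    unfolding a2 b1 ..
  \<comment> \<open>These rules normalize words in e, u and their adjoints, which turns the
    projection identities below into linear algebra.\<close>
  note rules = b1 b2 c1 c2 u' e'
  define pp where "pp = (1/2) *\<^sub>R (u \<odot> u\<^sup>\<dagger> + u \<odot> e\<^sup>\<dagger>)"
  define pm where "pm = (1/2) *\<^sub>R (u \<odot> u\<^sup>\<dagger> - u \<odot> e\<^sup>\<dagger>)"
  define rp where "rp = (1/2) *\<^sub>R (u\<^sup>\<dagger> \<odot> u + u\<^sup>\<dagger> \<odot> e)"
  define rm where "rm = (1/2) *\<^sub>R (u\<^sup>\<dagger> \<odot> u - u\<^sup>\<dagger> \<odot> e)"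
  note defs = pp_def pm_def rp_def rm_def
  have half: "(1/2) *\<^sub>R x + (1/2) *\<^sub>R x = x" for x :: "'z::real_vector"
    by (simp flip: scaleR_add_left)
  have quarter: "(1/4) *\<^sub>R x + (1/4) *\<^sub>R y + ((1/4) *\<^sub>R y + (1/4) *\<^sub>R x) = (1/2) *\<^sub>R x + (1/2) *\<^sub>R y"
    "(1/4) *\<^sub>R x - (1/4) *\<^sub>R y - ((1/4) *\<^sub>R y - (1/4) *\<^sub>R x) = (1/2) *\<^sub>R x - (1/2) *\<^sub>R y"
    for x y :: "'z::real_vector"
    using half[of "(1/2) *\<^sub>R x"] half[of "(1/2) *\<^sub>R y"] by (simp_all add: algebra_simps)
  have adj: "pp\<^sup>\<dagger> = pp" "pm\<^sup>\<dagger> = pm" "rp\<^sup>\<dagger> = rp" "rm\<^sup>\<dagger> = rm"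
    by (rule hop_eqI; simp add: defs rules)+
  have idem: "pp \<cdot> pp \<cdot> w = pp \<cdot> w" "pm \<cdot> pm \<cdot> w = pm \<cdot> w" "rp \<cdot> rp \<cdot> v = rp \<cdot> v" "rm \<cdot> rm \<cdot> v = rm \<cdot> v" for v w
    by (simp_all add: defs rules scaleR_add_right scaleR_diff_right quarter)
  have orth: "pp \<cdot> pm \<cdot> w = 0" "pm \<cdot> pp \<cdot> w = 0" "rp \<cdot> rm \<cdot> v = 0" "rm \<cdot> rp \<cdot> v = 0" for v w
    by (simp_all add: defs rules scaleR_diff_right)
  have ppe: "pp \<cdot> e \<cdot> v = e \<cdot> rp \<cdot> v" "pm \<cdot> e \<cdot> v = e \<cdot> rm \<cdot> v" for v
    by (simp_all add: defs rules)
  have u_eq: "u \<cdot> v = e \<cdot> rp \<cdot> v - e \<cdot> rm \<cdot> v" for v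
    by (simp add: defs rules half flip: scaleR_add_left scaleR_diff_right)
  have uu_eq: "u\<^sup>\<dagger> \<cdot> u \<cdot> v = rp \<cdot> v + rm \<cdot> v" for v
    by (simp add: defs half flip: scaleR_add_right)
  have eu_eq: "e\<^sup>\<dagger> \<cdot> u \<cdot> v = rp \<cdot> v - rm \<cdot> v" for v
    by (simp add: defs rules half flip: scaleR_diff_right)
  \<comment> \<open>The two blocks have orthogonal initial and orthogonal final spaces, so x and y
    can vary independently in the unit ball.\<close>
  have norm_le: "norm (pp \<odot> x \<odot> rp - pm \<odot> y \<odot> rm) \<le> 1" if xy: "norm x \<le> 1" "norm y \<le> 1" for x y :: "('p, 'q) hop"
  proof (rule norm_hop_bound)
    fix v
    have "inner (pp \<cdot> x \<cdot> rp \<cdot> v) (pm \<cdot> y \<cdot> rm \<cdot> v) = 0"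
      by (simp add: inner_hop_left[of pp] adj orth)
    then have "(norm ((pp \<odot> x \<odot> rp - pm \<odot> y \<odot> rm) \<cdot> v))\<^sup>2
        = (norm (pp \<cdot> x \<cdot> rp \<cdot> v))\<^sup>2 + (norm (pm \<cdot> y \<cdot> rm \<cdot> v))\<^sup>2"
      using dot_norm_neg[of "pp \<cdot> x \<cdot> rp \<cdot> v" "pm \<cdot> y \<cdot> rm \<cdot> v"] by simp
    also have "\<dots> \<le> (norm (rp \<cdot> v))\<^sup>2 + (norm (rm \<cdot> v))\<^sup>2"
      using norm_le_of_idempotent[OF adj(1) idem(1), of "x \<cdot> rp \<cdot> v"] norm_hop_apply_le[OF xy(1), of "rp \<cdot> v"]
        norm_le_of_idempotent[OF adj(2) idem(2), of "y \<cdot> rm \<cdot> v"] norm_hop_apply_le[OF xy(2), of "rm \<cdot> v"]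
      by (intro add_mono power_mono) auto
    also have "\<dots> = inner v (rp \<cdot> v + rm \<cdot> v)"
      by (simp add: power2_norm_eq_inner inner_hop_left adj idem inner_add_right)
    also have "\<dots> = (norm (u \<cdot> v))\<^sup>2"
      by (simp add: power2_norm_eq_inner inner_hop_left flip: uu_eq)
    also have "\<dots> \<le> (norm v)\<^sup>2"
      using norm_hop_apply_le[OF u1, of v] by (simp add: power_mono)
    finally show "norm ((pp \<odot> x \<odot> rp - pm \<odot> y \<odot> rm) \<cdot> v) \<le> 1 * norm v"
      using power2_le_imp_le[of "norm ((pp \<odot> x \<odot> rp - pm \<odot> y \<odot> rm) \<cdot> v)" "norm v"] by simp
  qed simp
  have u_pe: "u = pp \<odot> e \<odot> rp - pm \<odot> e \<odot> rm"
    by (rule hop_eqI) (simp add: ppe idem u_eq)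
  \<comment> \<open>The value at u is the maximum over all such pairs, attained at (e, e). Fixing
    one entry at e shows that each of f and g attains its norm at e.\<close>
  have bound: "blinfun_apply k (pp \<odot> x \<odot> rp) - blinfun_apply k (pm \<odot> y \<odot> rm)
      \<le> blinfun_apply k (pp \<odot> e \<odot> rp) - blinfun_apply k (pm \<odot> e \<odot> rm)"
    if "norm x \<le> 1" "norm y \<le> 1" for x y
    using blinfun_le_norm[OF norm_le[OF that], of k] k(2) arg_cong[OF u_pe, of "blinfun_apply k"]
    by (simp add: blinfun.diff_right)
  obtain f where f: "f \<in> F" "\<And>x. blinfun_apply f x = blinfun_apply k (pp \<odot> x \<odot> rp)"
    using sandwich_in_F[OF k(1)] by blast
  obtain g' where g': "g' \<in> F" "\<And>x. blinfun_apply g' x = blinfun_apply k (pm \<odot> x \<odot> rm)"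
    using sandwich_in_F[OF k(1)] by blast
  define g where "g = - g'"
  have "norm f \<le> blinfun_apply f e"
    using bound[OF _ e1] by (intro norm_blinfun_le_of_ball) (simp add: f)
  then have "f \<in> positive_at e"
    using f(1) blinfun_le_norm[OF e1, of f] by (simp add: positive_at_def)
  moreover have "norm g \<le> blinfun_apply g e"
    using bound[OF e1] by (intro norm_blinfun_le_of_ball) (simp add: g_def g' blinfun.minus_left)
  then have "g \<in> positive_at e"
    using g'(1) blinfun_le_norm[OF e1, of g] subspace_neg[OF subspace_F] by (simp add: positive_at_def g_def)
  moreover have "blinfun_apply k x = blinfun_apply f x - blinfun_apply g x" for x
  proof -
    \<comment> \<open>x without its two diagonal blocks. Against u the diagonal terms of
      \<open>herm e y\<close> vanish, and the mixed terms cancel with those of the adjoint.\<close>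
    define y where "y = x - pp \<odot> x \<odot> rp - pm \<odot> x \<odot> rm"
    have "inner (u \<cdot> v) (herm e y \<cdot> u\<^sup>\<dagger> \<cdot> u \<cdot> v) = 0" for v
    proof -
      have p: "inner (e \<cdot> rp \<cdot> v) (y \<cdot> rp \<cdot> v) = 0"
        by (simp add: y_def inner_diff_right idem orth inner_hop_right[of _ pp] adj ppe)
      have m: "inner (e \<cdot> rm \<cdot> v) (y \<cdot> rm \<cdot> v) = 0"
        by (simp add: y_def inner_diff_right idem orth inner_hop_right[of _ pm] adj ppe)
      have "inner (u \<cdot> v) (e \<cdot> e\<^sup>\<dagger> \<cdot> y \<cdot> e\<^sup>\<dagger> \<cdot> e \<cdot> u\<^sup>\<dagger> \<cdot> u \<cdot> v) = inner (u \<cdot> v) (y \<cdot> u\<^sup>\<dagger> \<cdot> u \<cdot> v)"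
        by (simp add: inner_hop_right[of _ e] inner_hop_right[of _ "e\<^sup>\<dagger>"] b1 b2)
      also have "\<dots> = inner (e \<cdot> rp \<cdot> v - e \<cdot> rm \<cdot> v) (y \<cdot> (rp \<cdot> v + rm \<cdot> v))"
        unfolding uu_eq unfolding u_eq ..
      finally have 1: "inner (u \<cdot> v) (e \<cdot> e\<^sup>\<dagger> \<cdot> y \<cdot> e\<^sup>\<dagger> \<cdot> e \<cdot> u\<^sup>\<dagger> \<cdot> u \<cdot> v)
        = inner (e \<cdot> rp \<cdot> v - e \<cdot> rm \<cdot> v) (y \<cdot> (rp \<cdot> v + rm \<cdot> v))" .
      have "inner (u \<cdot> v) (e \<cdot> y\<^sup>\<dagger> \<cdot> e \<cdot> u\<^sup>\<dagger> \<cdot> u \<cdot> v) = inner (y \<cdot> e\<^sup>\<dagger> \<cdot> u \<cdot> v) (e \<cdot> u\<^sup>\<dagger> \<cdot> u \<cdot> v)"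
        by (simp add: inner_hop_right[of _ e] inner_hop_right[of _ "y\<^sup>\<dagger>"])
      also have "\<dots> = inner (y \<cdot> (rp \<cdot> v - rm \<cdot> v)) (e \<cdot> (rp \<cdot> v + rm \<cdot> v))"
        unfolding uu_eq eu_eq ..
      finally have 2: "inner (u \<cdot> v) (e \<cdot> y\<^sup>\<dagger> \<cdot> e \<cdot> u\<^sup>\<dagger> \<cdot> u \<cdot> v)
        = inner (y \<cdot> (rp \<cdot> v - rm \<cdot> v)) (e \<cdot> (rp \<cdot> v + rm \<cdot> v))" .
      have "inner (u \<cdot> v) (e \<cdot> e\<^sup>\<dagger> \<cdot> y \<cdot> e\<^sup>\<dagger> \<cdot> e \<cdot> u\<^sup>\<dagger> \<cdot> u \<cdot> v) + inner (u \<cdot> v) (e \<cdot> y\<^sup>\<dagger> \<cdot> e \<cdot> u\<^sup>\<dagger> \<cdot> u \<cdot> v) = 0"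
        unfolding 1 2 using p m
        by (simp add: inner_add_left inner_add_right inner_diff_left inner_diff_right
            inner_commute[of "y \<cdot> _" "e \<cdot> _"])
      then show ?thesis
        by (simp only: herm_apply inner_scaleR_right inner_add_right)
    qed
    then have "blinfun_apply k (herm e y) = 0"
      by (rule norming_functional_vanishes[OF u k(2)])
    then show ?thesis
      by (simp add: k(3) y_def f g_def g' blinfun.bilinear_simps)
  qed
  ultimately show ?thesis
    by blast
qed

end

section \<open>Smooth subtriples\<close>

locale smooth_subtriple = operator_predual F for F :: "(('p::quat_hilbert, 'q::quat_hilbert) hop \<Rightarrow>\<^sub>L real) set" +
  fixes I :: "('p, 'q) hop set"
  assumes subtriple_I: "subtriple I"
    and closed_I: "closedin (weak_star_topology F) I"
    and smooth_I: "weak_star_HB_smooth F I"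
begin

lemma subspace_I: "subspace I"
  using subtriple_I by (simp add: subtriple_def)

lemma triple_in_I: "a \<in> I \<Longrightarrow> b \<in> I \<Longrightarrow> c \<in> I \<Longrightarrow> triple_product a b c \<in> I"
  using subtriple_I by (simp add: subtriple_def)

lemma sandwich_in_I: "a \<in> I \<Longrightarrow> b \<in> I \<Longrightarrow> a \<odot> b\<^sup>\<dagger> \<odot> a \<in> I"
  using triple_in_I[of a b a] by (simp add: triple_product_same)

text \<open>The bipolar criterion: membership in I is tested against the functionals in F that
  annihilate I.\<close>

lemma in_I_by_annihilator:
  assumes "\<And>h. h \<in> F \<Longrightarrow> (\<And>y. y \<in> I \<Longrightarrow> blinfun_apply h y = 0) \<Longrightarrow> blinfun_apply h x = 0"
  shows "x \<in> I"
proof (rule ccontr)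
  assume "x \<notin> I"
  then obtain h where "h \<in> F" "\<And>y. y \<in> I \<Longrightarrow> blinfun_apply h y = 0" "blinfun_apply h x \<noteq> 0"
    using weak_star_closed_separation[OF subspace_F subspace_I closed_I] by metis
  then show False
    using assms by blast
qed

lemma I_limit:
  assumes "\<And>n. X n \<in> I" "\<And>n. norm (X n) \<le> K" "norm u \<le> K" "\<And>v. (\<lambda>n. X n \<cdot> v) \<longlonglongrightarrow> u \<cdot> v"
  shows "u \<in> I"
proof (rule in_I_by_annihilator)
  fix h assume h: "h \<in> F" "\<And>y. y \<in> I \<Longrightarrow> blinfun_apply h y = 0"
  have "(\<lambda>n. blinfun_apply h (X n)) \<longlonglongrightarrow> blinfun_apply h u"
    by (rule F_tendsto[OF h(1) assms(2-4)])
  then show "blinfun_apply h u = 0"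
    using h(2) assms(1) by (simp add: LIMSEQ_const_iff)
qed

lemma functional_norm_bounds:
  fixes f :: "('p, 'q) hop \<Rightarrow>\<^sub>L real"
  shows "a \<in> I \<Longrightarrow> norm a \<le> 1 \<Longrightarrow> \<bar>blinfun_apply f a\<bar> \<le> functional_norm_on I f"
    and "(\<And>a. a \<in> I \<Longrightarrow> norm a \<le> 1 \<Longrightarrow> \<bar>blinfun_apply f a\<bar> \<le> c) \<Longrightarrow> functional_norm_on I f \<le> c"
proof -
  have bdd: "bdd_above ((\<lambda>x. \<bar>blinfun_apply f x\<bar>) ` {x \<in> I. norm x \<le> 1})"
  proof (rule bdd_aboveI2)
    fix x assume "x \<in> {x \<in> I. norm x \<le> 1}"
    then show "\<bar>blinfun_apply f x\<bar> \<le> norm f"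
      using norm_blinfun[of f x] mult_left_mono[of "norm x" 1 "norm f"] by simp
  qed
  show "\<bar>blinfun_apply f a\<bar> \<le> functional_norm_on I f" if "a \<in> I" "norm a \<le> 1"
    unfolding functional_norm_on_def by (rule cSUP_upper[OF _ bdd]) (use that in simp)
  have "{x \<in> I. norm x \<le> 1} \<noteq> {}"
    using subspace_0[OF subspace_I] by force
  then show "functional_norm_on I f \<le> c" if "\<And>a. a \<in> I \<Longrightarrow> norm a \<le> 1 \<Longrightarrow> \<bar>blinfun_apply f a\<bar> \<le> c"
    unfolding functional_norm_on_def by (rule cSUP_least) (use that in simp)
qed

lemma smooth_extension:
  assumes f: "f \<in> F"
  shows "\<exists>!f'. f' \<in> F \<and> (\<forall>z\<in>I. blinfun_apply f' z = blinfun_apply f z) \<and> norm f' = functional_norm_on I f"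
proof -
  have "openin (weak_star_topology F) {x. blinfun_apply f x \<in> U}" if "open U" for U
    using f that unfolding weak_star_topology_def openin_topology_generated_by_iff
    by (intro generate_topology_on.Basis) (auto simp: vimage_def)
  then have "continuous_map (weak_star_topology F) euclideanreal f"
    unfolding continuous_map_def topspace_euclidean open_openin[symmetric]
    using openin_subset[of "weak_star_topology F"]
    by (smt (verit, ccfv_SIG) Collect_cong UNIV_I mem_Collect_eq open_UNIV openin_subset subset_iff Pi_iff)
  then have "continuous_map (subtopology (weak_star_topology F) I) euclideanreal f"
    by (rule continuous_map_from_subtopology)
  moreover have "linear_functional_on I f"
    by (simp add: linear_functional_on_def blinfun.bilinear_simps)
  ultimately show ?thesis
    using smooth_I unfolding weak_star_HB_smooth_def by blast
qed

text \<open>The norm of a minimal extension is attained on \<open>I\<close>: separate it from the annihilator of \<open>I\<close>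
  and represent the separating functional by a point, which then lies in \<open>I\<close>.\<close>

lemma norm_attaining_extension:
  assumes f: "f \<in> F"
  shows "\<exists>f'\<in>F. \<exists>a\<in>I. (\<forall>z\<in>I. blinfun_apply f' z = blinfun_apply f z) \<and> norm a \<le> 1 \<and> blinfun_apply f' a = norm f'"
proof -
  obtain f' where f': "f' \<in> F" "\<And>z. z \<in> I \<Longrightarrow> blinfun_apply f' z = blinfun_apply f z"
    "norm f' = functional_norm_on I f"
    using smooth_extension[OF f] by metis
  define N where "N = {h \<in> F. \<forall>y\<in>I. blinfun_apply h y = 0}"
  have "subspace N"
    using subspace_F by (auto simp: N_def subspace_def blinfun.bilinear_simps)
  moreover have "norm f' \<le> norm (f' + h)" if h: "h \<in> N" for h
    unfolding f'(3)
  proof (rule functional_norm_bounds(2))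
    fix a assume a: "a \<in> I" "norm a \<le> 1"
    have "blinfun_apply f a = blinfun_apply (f' + h) a"
      using a h f'(2) by (simp add: N_def blinfun.add_left)
    then show "\<bar>blinfun_apply f a\<bar> \<le> norm (f' + h)"
      using norm_blinfun[of "f' + h" a] mult_left_mono[OF a(2), of "norm (f' + h)"] by simp
  qed
  ultimately obtain g where g: "norm g \<le> 1" "\<And>h. h \<in> N \<Longrightarrow> blinfun_apply g h = 0" "blinfun_apply g f' = norm f'"
    using hahn_banach_separation[of N "norm f'" f'] by auto
  obtain a where a: "norm a \<le> 1" "\<forall>f\<in>F. blinfun_apply g f = blinfun_apply f a"
    using bidual_representation[OF g(1)] by blast
  have "a \<in> I"
  proof (rule in_I_by_annihilator)
    fix h assume "h \<in> F" "\<And>y. y \<in> I \<Longrightarrow> blinfun_apply h y = 0"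
    then show "blinfun_apply h a = 0"
      using a(2) g(2)[of h] by (simp add: N_def)
  qed
  then show ?thesis
    using a g(3) f' by (intro bexI[of _ f'] bexI[of _ a]) auto
qed

text \<open>A functional that attains its norm in the unit ball of I is a norm-preserving extension
  of its own restriction, and smoothness admits only one.\<close>

lemma unique_norming_functional:
  assumes fg: "f \<in> F" "g \<in> F" "\<And>z. z \<in> I \<Longrightarrow> blinfun_apply f z = blinfun_apply g z"
    and a: "a \<in> I" "norm a \<le> 1" "blinfun_apply f a = norm f" "blinfun_apply g a = norm g"
  shows "f = g"
proof -
  have *: "norm h = functional_norm_on I f" if "h \<in> {f, g}" for h
  proof (rule antisym)
    show "norm h \<le> functional_norm_on I f"
      using functional_norm_bounds(1)[OF a(1,2), of f] a fg(3)[OF a(1)] that by auto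
    show "functional_norm_on I f \<le> norm h"
    proof (rule functional_norm_bounds(2))
      fix b assume b: "b \<in> I" "norm b \<le> 1"
      then have "blinfun_apply f b = blinfun_apply h b"
        using that fg(3) by auto
      then show "\<bar>blinfun_apply f b\<bar> \<le> norm h"
        using norm_blinfun[of h b] mult_left_mono[OF b(2), of "norm h"] by simp
    qed
  qed
  have "f \<in> F \<and> (\<forall>z\<in>I. blinfun_apply f z = blinfun_apply f z) \<and> norm f = functional_norm_on I f"
    using fg *[of f] by simp
  moreover have "g \<in> F \<and> (\<forall>z\<in>I. blinfun_apply g z = blinfun_apply f z) \<and> norm g = functional_norm_on I f"
    using fg *[of g] by simp
  ultimately show ?thesis
    using smooth_extension[OF fg(1)] by blast
qed

lemma herm_in_I_if:
  assumes "e \<in> I" "x \<in> I"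
  shows "herm e x \<in> I"
proof -
  have *: "e \<odot> x\<^sup>\<dagger> \<odot> e \<in> I" if "x \<in> I" for x
    by (rule sandwich_in_I[OF assms(1) that])
  have "e \<odot> e\<^sup>\<dagger> \<odot> x \<odot> e\<^sup>\<dagger> \<odot> e = e \<odot> (e \<odot> x\<^sup>\<dagger> \<odot> e)\<^sup>\<dagger> \<odot> e"
    by (simp add: hop_compose_assoc)
  also have "\<dots> \<in> I"
    by (intro * assms)
  finally show ?thesis
    unfolding herm_def by (intro subspace_scale subspace_add subspace_I * assms(2))
qed

text \<open>Composing the minimal extension with \<open>herm e\<close> changes neither its values on
  I, since \<open>herm e\<close> maps I into I and fixes k, nor its norm. The norming point then
  moves to \<open>herm e a\<close>, and iterated cubes stay in the self-adjoint part of the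
  corner.\<close>

lemma norming_extension_tripotent:
  assumes e: "e \<in> I" "e \<odot> e\<^sup>\<dagger> \<odot> e = e"
    and k: "k \<in> F" "\<And>x. blinfun_apply k (herm e x) = blinfun_apply k x"
  shows "\<exists>k'\<in>F. \<exists>u\<in>I. (\<forall>z\<in>I. blinfun_apply k' z = blinfun_apply k z) \<and> (\<forall>x. blinfun_apply k' (herm e x) = blinfun_apply k' x) \<and>
    u \<odot> u\<^sup>\<dagger> \<odot> u = u \<and> e \<odot> u\<^sup>\<dagger> \<odot> e = u \<and> blinfun_apply k' u = norm k'"
proof -
  have e1: "norm e \<le> 1"
    by (rule tripotent_norm_le[OF e(2)])
  obtain f a where f: "f \<in> F" "\<And>z. z \<in> I \<Longrightarrow> blinfun_apply f z = blinfun_apply k z"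
    and a: "a \<in> I" "norm a \<le> 1" "blinfun_apply f a = norm f"
    using norm_attaining_extension[OF k(1)] by metis
  obtain k' where k': "k' \<in> F" "\<And>x. blinfun_apply k' x = blinfun_apply f (herm e x)"
    using herm_in_F[OF f(1)] by metis
  have agree: "blinfun_apply k' z = blinfun_apply k z" if "z \<in> I" for z
    using that f(2)[OF herm_in_I_if[OF e(1) that]] by (simp add: k' k)
  have norm_k': "norm k' \<le> norm f"
  proof (rule norm_blinfun_le_of_ball)
    fix x :: "('p, 'q) hop" assume "norm x \<le> 1"
    then have "norm (herm e x) \<le> 1"
      using norm_herm_le[OF e1, of x] by simp
    then show "blinfun_apply k' x \<le> norm f"
      unfolding k' by (rule blinfun_le_norm)
  qed
  have "blinfun_apply k' a = norm f"
    using agree[OF a(1)] f(2)[OF a(1)] a(3) by simp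
  then have "blinfun_apply k' a = norm k'"
    using norm_k' blinfun_le_norm[OF a(2), of k'] by linarith
  then have attains: "blinfun_apply k' (herm e a) = norm k'"
    by (simp add: k' herm_herm[OF e(2)])
  have herm_a: "herm e a \<in> {x \<in> I. e \<odot> x\<^sup>\<dagger> \<odot> e = x}"
    using herm_in_I_if[OF e(1) a(1)] herm_self_adjoint[OF e(2)] by simp
  have norm_a: "norm (herm e a) \<le> 1"
    using norm_herm_le[OF e1, of a] a(2) by simp
  have cube: "cube b \<in> {x \<in> I. e \<odot> x\<^sup>\<dagger> \<odot> e = x}" if "b \<in> {x \<in> I. e \<odot> x\<^sup>\<dagger> \<odot> e = x}" for b
  proof -
    have b: "e \<cdot> b\<^sup>\<dagger> \<cdot> e \<cdot> v = b \<cdot> v" for v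
      using that by (metis (mono_tags, lifting) hop_compose_apply mem_Collect_eq)
    have "e \<odot> (cube b)\<^sup>\<dagger> \<odot> e = cube b"
    proof (rule hop_eqI)
      fix v
      have "(e \<odot> (cube b)\<^sup>\<dagger> \<odot> e) \<cdot> v = e \<cdot> b\<^sup>\<dagger> \<cdot> b \<cdot> b\<^sup>\<dagger> \<cdot> e \<cdot> v"
        by (simp add: cube_def)
      \<comment> \<open>Only the middle factor b is rewritten as
        \<open>e \<odot> b\<^sup>\<dagger> \<odot> e\<close>; afterwards both outer groups collapse
        to b.\<close>
      also have "\<dots> = e \<cdot> b\<^sup>\<dagger> \<cdot> (e \<cdot> b\<^sup>\<dagger> \<cdot> e \<cdot> (b\<^sup>\<dagger> \<cdot> e \<cdot> v))"
        unfolding b[of "b\<^sup>\<dagger> \<cdot> e \<cdot> v", symmetric] ..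
      also have "\<dots> = cube b \<cdot> v"
        unfolding b by (simp add: cube_def)
      finally show "(e \<odot> (cube b)\<^sup>\<dagger> \<odot> e) \<cdot> v = cube b \<cdot> v" .
    qed
    then show ?thesis
      using that sandwich_in_I[of b b] by (simp add: cube_def)
  qed
  have lim: "w \<in> {x \<in> I. e \<odot> x\<^sup>\<dagger> \<odot> e = x}"
    if X: "\<And>n. X n \<in> {x \<in> I. e \<odot> x\<^sup>\<dagger> \<odot> e = x}" "\<And>n. norm (X n) \<le> 1" "norm w \<le> 1"
      "\<And>v. (\<lambda>n. X n \<cdot> v) \<longlonglongrightarrow> w \<cdot> v" for X w
  proof -
    have "w \<in> I"
      using X by (intro I_limit[of X 1 w]) auto
    moreover have "e \<odot> w\<^sup>\<dagger> \<odot> e = w"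
    proof (rule hop_eqI)
      fix v
      \<comment> \<open>The adjoint is moved to the other side of the inner product, because only
        the X n themselves converge strongly.\<close>
      have Xn: "inner z (X n \<cdot> v) = inner (X n \<cdot> e\<^sup>\<dagger> \<cdot> z) (e \<cdot> v)" for n z
      proof -
        have "X n \<cdot> v = e \<cdot> (X n)\<^sup>\<dagger> \<cdot> e \<cdot> v"
          using X(1)[of n] by (metis (mono_tags, lifting) hop_compose_apply mem_Collect_eq)
        then show ?thesis
          by (simp add: inner_hop_right[of _ e] inner_hop_right[of _ "(X n)\<^sup>\<dagger>"])
      qed
      have "inner z (w \<cdot> v) = inner z (e \<cdot> w\<^sup>\<dagger> \<cdot> e \<cdot> v)" for z
      proof -
        have "(\<lambda>n. inner z (X n \<cdot> v)) \<longlonglongrightarrow> inner z (w \<cdot> v)"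
          by (intro tendsto_intros X)
        moreover have "(\<lambda>n. inner (X n \<cdot> e\<^sup>\<dagger> \<cdot> z) (e \<cdot> v)) \<longlonglongrightarrow> inner (w \<cdot> e\<^sup>\<dagger> \<cdot> z) (e \<cdot> v)"
          by (intro tendsto_intros X)
        ultimately have "inner z (w \<cdot> v) = inner (w \<cdot> e\<^sup>\<dagger> \<cdot> z) (e \<cdot> v)"
          unfolding Xn by (rule LIMSEQ_unique)
        then show ?thesis
          by (simp add: inner_hop_right[of z e] inner_hop_right[of _ "w\<^sup>\<dagger>"])
      qed
      then have "inner (e \<cdot> w\<^sup>\<dagger> \<cdot> e \<cdot> v - w \<cdot> v) (e \<cdot> w\<^sup>\<dagger> \<cdot> e \<cdot> v - w \<cdot> v) = 0"
        by (metis inner_diff_right right_minus_eq)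
      then show "(e \<odot> w\<^sup>\<dagger> \<odot> e) \<cdot> v = w \<cdot> v"
        by simp
    qed
    ultimately show ?thesis by simp
  qed
  obtain u where u: "u \<in> {x \<in> I. e \<odot> x\<^sup>\<dagger> \<odot> e = x}" "u \<odot> u\<^sup>\<dagger> \<odot> u = u" "blinfun_apply k' u = norm k'"
  proof -
    have "\<exists>u\<in>{x \<in> I. e \<odot> x\<^sup>\<dagger> \<odot> e = x}. norm u \<le> 1 \<and> u \<odot> u\<^sup>\<dagger> \<odot> u = u \<and> blinfun_apply k' u = norm k'"
      by (rule norming_tripotent[OF k'(1) attains herm_a norm_a]) (fact cube, fact lim)
    then show ?thesis
      using that by blast
  qed
  have "\<forall>x. blinfun_apply k' (herm e x) = blinfun_apply k' x"
    by (simp add: k'(2) herm_herm[OF e(2)])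
  then show ?thesis
    using k'(1) agree u by blast
qed

text \<open>Normal states of the corner of \<open>e\<close> that agree on \<open>I\<close> are equal by smoothness, and the
  differences of such states are dense among the self-adjoint normal functionals; hence no nonzero
  self-adjoint normal functional annihilates \<open>I\<close>.\<close>

lemma herm_in_I:
  assumes e: "e \<in> I" "e \<odot> e\<^sup>\<dagger> \<odot> e = e"
  shows "herm e x \<in> I"
proof (rule in_I_by_annihilator)
  fix h assume h: "h \<in> F" "\<And>y. y \<in> I \<Longrightarrow> blinfun_apply h y = 0"
  have e1: "norm e \<le> 1"
    by (rule tripotent_norm_le[OF e(2)])
  have "\<bar>blinfun_apply h (herm e x)\<bar> \<le> 0"
  proof (rule le_zero_if_le_scaled)
    fix \<epsilon> :: real assume "0 < \<epsilon>"
    then obtain t where t: "t \<in> span (range (\<lambda>(\<beta>, \<alpha>). matrix_coeff \<beta> \<alpha>))" "norm (h - t) < \<epsilon>"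
      using F_approx[OF h(1)] by blast
    obtain f g where fg: "f \<in> positive_at e" "g \<in> positive_at e"
      "\<And>x. blinfun_apply t (herm e x) = blinfun_apply f x - blinfun_apply g x"
      using span_herm_decomposition[OF e(2) t(1)] by blast
    define k where "k = f - g"
    have kt: "blinfun_apply k x = blinfun_apply t (herm e x)" for x
      by (simp add: k_def blinfun.diff_left fg)
    have kF: "k \<in> F"
      using fg subspace_F by (simp add: k_def positive_at_def subspace_diff)
    obtain k' u where k': "k' \<in> F" "\<And>z. z \<in> I \<Longrightarrow> blinfun_apply k' z = blinfun_apply k z"
        "\<And>x. blinfun_apply k' (herm e x) = blinfun_apply k' x"
      and u: "u \<in> I" "u \<odot> u\<^sup>\<dagger> \<odot> u = u" "e \<odot> u\<^sup>\<dagger> \<odot> e = u" "blinfun_apply k' u = norm k'"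
      using norming_extension_tripotent[OF e kF] kt herm_herm[OF e(2)] by metis
    obtain f' g' where fg': "f' \<in> positive_at e" "g' \<in> positive_at e"
      "\<And>x. blinfun_apply k' x = blinfun_apply f' x - blinfun_apply g' x"
      using jordan_decomposition[OF e(2) u(2,3) k'(1) u(4) k'(3)] by blast
    \<comment> \<open>Crossing over the terms turns an equality of differences on I into one of
      positive functionals, to which uniqueness applies.\<close>
    have "f + g' \<in> positive_at e" "f' + g \<in> positive_at e"
      by (intro positive_at_add e1 fg fg')+
    moreover have "blinfun_apply (f + g') z = blinfun_apply (f' + g) z" if "z \<in> I" for z
      using k'(2)[OF that] fg'(3)[of z] by (simp add: k_def blinfun.bilinear_simps)
    ultimately have eq: "f + g' = f' + g"
      using e(1) e1 by (intro unique_norming_functional) (auto simp: positive_at_def)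
    have "k' = k"
    proof (rule blinfun_eqI)
      fix z
      have "blinfun_apply f z + blinfun_apply g' z = blinfun_apply f' z + blinfun_apply g z"
        using arg_cong[OF eq, of "\<lambda>f. blinfun_apply f z"] by (simp add: blinfun.add_left)
      then show "blinfun_apply k' z = blinfun_apply k z"
        by (simp add: fg'(3) k_def blinfun.diff_left)
    qed
    \<comment> \<open>k attains its norm at u in I, where h vanishes; so norm k is bounded by the
      distance from t to h.\<close>
    then have "norm k = blinfun_apply (t - h) u"
      using u(4) kt[of u] herm_eq_self[OF e(2) u(3)] h(2)[OF u(1)] by (simp add: blinfun.diff_left)
    also have "\<dots> \<le> norm (t - h)"
      by (rule blinfun_le_norm[OF tripotent_norm_le[OF u(2)]])
    finally have nk: "norm k \<le> \<epsilon>"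
      using t(2) by (simp add: norm_minus_commute)
    have "blinfun_apply h (herm e x) = blinfun_apply (h - t) (herm e x) + blinfun_apply k x"
      by (simp add: kt blinfun.diff_left)
    moreover have "\<bar>blinfun_apply (h - t) (herm e x)\<bar> \<le> \<epsilon> * norm x"
    proof -
      have "\<bar>blinfun_apply (h - t) (herm e x)\<bar> \<le> norm (h - t) * norm (herm e x)"
        using norm_blinfun[of "h - t"] by simp
      also have "\<dots> \<le> \<epsilon> * norm x"
        using t(2) \<open>0 < \<epsilon>\<close> norm_herm_le[OF e1] by (intro mult_mono) auto
      finally show ?thesis .
    qed
    moreover have "\<bar>blinfun_apply k x\<bar> \<le> \<epsilon> * norm x"
      using norm_blinfun[of k x] mult_right_mono[OF nk, of "norm x"] by simp
    ultimately show "\<bar>blinfun_apply h (herm e x)\<bar> \<le> \<epsilon> * (2 * norm x)"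
      by (simp add: abs_le_iff)
  qed simp
  then show "blinfun_apply h (herm e x) = 0"
    by simp
qed

end

section \<open>Rank one operators in a smooth subtriple\<close>

lemma scaleH_eq_0_iff: "x *\<^sub>H c = 0 \<longleftrightarrow> x = 0 \<or> c = 0" for x :: "'a::quat_hilbert"
proof -
  have "norm (x *\<^sub>H c) = 0 \<longleftrightarrow> norm x = 0 \<or> qnorm2 c = 0"
    by (simp add: norm_scaleH)
  then show ?thesis
    by (simp add: qnorm2_eq_0_iff)
qed

lemma triple_product_rank1:
  "triple_product (rank1 \<alpha> \<beta>) (rank1 \<gamma> \<delta>) (rank1 \<epsilon> \<zeta>) = (1/2) *\<^sub>R
    (rank1 (\<alpha> *\<^sub>H (hinner \<beta> \<delta> * hinner \<gamma> \<epsilon>)) \<zeta> + rank1 (\<epsilon> *\<^sub>H (hinner \<zeta> \<delta> * hinner \<gamma> \<alpha>)) \<beta>)"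
  by (rule hop_eqI) (simp add: triple_product_apply hinner_scaleH_right scaleH_scaleH)

lemma triple_product_adjoint: "triple_product (a\<^sup>\<dagger>) (b\<^sup>\<dagger>) (c\<^sup>\<dagger>) = (triple_product a b c)\<^sup>\<dagger>"
  by (rule hop_eqI) (simp add: triple_product_def hop_compose_assoc add.commute)

lemma rank1_zero: "rank1 0 \<xi> = 0" "rank1 \<eta> 0 = 0"
  by (rule hop_eqI; simp)+

lemma hinner_diff_right: "hinner x (y - z) = hinner x y - hinner x z"
  using hinner_add_right[of x "y - z" z] by (simp add: eq_diff_eq)

lemma hinner_sgn: "hinner x y = 0 \<Longrightarrow> hinner (sgn x) (sgn y) = 0"
  by (simp add: sgn_div_norm hinner_scaleH_left hinner_scaleH_right flip: scaleH_of_real)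

text \<open>The output of the 2 by 2 block argument, stated for an arbitrary set so that it passes
  to the set of adjoints, where columns become rows. Only the row of \<eta> is required; exchanging
  the two operators gives the other row.\<close>

definition cross_closed :: "('a::quat_hilbert, 'b::quat_hilbert) hop set \<Rightarrow> bool" where
  "cross_closed K \<longleftrightarrow> (\<forall>\<eta> \<xi> \<eta>' \<xi>' c. rank1 \<eta> \<xi> \<in> K \<longrightarrow> rank1 \<eta>' \<xi>' \<in> K \<longrightarrow> \<eta> \<noteq> 0 \<longrightarrow> \<xi> \<noteq> 0 \<longrightarrow> \<eta>' \<noteq> 0 \<longrightarrow> \<xi>' \<noteq> 0 \<longrightarrow>
     hinner \<eta> \<eta>' = 0 \<longrightarrow> hinner \<xi> \<xi>' = 0 \<longrightarrow> rank1 (\<eta> *\<^sub>H c) \<xi> \<in> K \<and> rank1 (\<eta> *\<^sub>H c) \<xi>' \<in> K)"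

lemma cross_closedD:
  assumes "cross_closed K" "rank1 \<eta> \<xi> \<in> K" "rank1 \<eta>' \<xi>' \<in> K" "\<eta> \<noteq> 0" "\<xi> \<noteq> 0" "\<eta>' \<noteq> 0" "\<xi>' \<noteq> 0"
    "hinner \<eta> \<eta>' = 0" "hinner \<xi> \<xi>' = 0"
  shows "rank1 (\<eta> *\<^sub>H c) \<xi> \<in> K" "rank1 (\<eta> *\<^sub>H c) \<xi>' \<in> K" "rank1 (\<eta>' *\<^sub>H c) \<xi> \<in> K" "rank1 (\<eta>' *\<^sub>H c) \<xi>' \<in> K"
  using assms(1)[unfolded cross_closed_def, rule_format, OF assms(2,3)]
    assms(1)[unfolded cross_closed_def, rule_format, OF assms(3,2)] assms(4-)
  by (auto simp: hinner_eq_0_commute[of \<eta>'] hinner_eq_0_commute[of \<xi>'])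

lemma subtriple_adjoint: "subtriple (hop_adjoint ` K)" if "subtriple K"
proof -
  have "subspace (hop_adjoint ` K)"
    using that by (intro linear_subspace_image) (simp_all add: linear_iff subtriple_def)
  then show ?thesis
    using that by (auto simp: subtriple_def triple_product_adjoint)
qed

lemma rank1_in_adjoint_iff: "rank1 \<xi> \<eta> \<in> hop_adjoint ` K \<longleftrightarrow> rank1 \<eta> \<xi> \<in> K"
  by (metis hop_adjoint_adjoint image_iff rank1_adjoint)

lemma cross_closed_adjoint: "cross_closed (hop_adjoint ` K)" if "cross_closed K"
  unfolding cross_closed_def
proof (intro allI impI conjI)
  fix \<xi> \<eta> \<xi>' \<eta>' c
  assume *: "rank1 \<xi> \<eta> \<in> hop_adjoint ` K" "rank1 \<xi>' \<eta>' \<in> hop_adjoint ` K" "\<xi> \<noteq> 0" "\<eta> \<noteq> 0" "\<xi>' \<noteq> 0" "\<eta>' \<noteq> 0"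
    "hinner \<xi> \<xi>' = 0" "hinner \<eta> \<eta>' = 0"
  show "rank1 (\<xi> *\<^sub>H c) \<eta> \<in> hop_adjoint ` K" "rank1 (\<xi> *\<^sub>H c) \<eta>' \<in> hop_adjoint ` K"
    using cross_closedD[OF that, of \<eta> \<xi> \<eta>' \<xi>' "qcnj c"] * unfolding rank1_in_adjoint_iff rank1_scaleH by auto
qed

text \<open>If \<xi> is not orthogonal to \<xi>2, one triple product replaces it by \<xi>1; if it is
  not orthogonal to \<xi>1, a detour through \<xi>2 works. If it is orthogonal to both, removing the
  components of \<eta> along \<eta>1 and \<eta>2 leaves an operator orthogonal to the first one, and
  cross-closedness applies.\<close>

lemma rank1_range_in_column_space:
  assumes K: "subtriple K" "cross_closed K"
    and unit: "norm \<eta>1 = 1" "norm \<eta>2 = 1" "norm \<xi>1 = 1" "norm \<xi>2 = 1"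
    and orth: "hinner \<eta>1 \<eta>2 = 0" "hinner \<xi>1 \<xi>2 = 0"
    and in_K: "rank1 \<eta>1 \<xi>1 \<in> K" "rank1 \<eta>2 \<xi>2 \<in> K"
    and r: "rank1 \<eta> \<xi> \<in> K" "\<eta> \<noteq> 0" "\<xi> \<noteq> 0"
  shows "rank1 (\<eta> *\<^sub>H d) \<xi>1 \<in> K"
proof -
  have sub: "subspace K" and triple: "\<And>a b c. a \<in> K \<Longrightarrow> b \<in> K \<Longrightarrow> c \<in> K \<Longrightarrow> triple_product a b c \<in> K"
    using K(1) by (auto simp: subtriple_def)
  have double: "x \<in> K" if "(1/2) *\<^sub>R x \<in> K" for x
    using subspace_scale[OF sub that, of 2] by simp
  have nz: "\<eta>1 \<noteq> 0" "\<eta>2 \<noteq> 0" "\<xi>1 \<noteq> 0" "\<xi>2 \<noteq> 0"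
    using unit by auto
  note cross = cross_closedD[OF K(2) in_K nz(1,3,2,4) orth]
  have self: "hinner \<eta>1 \<eta>1 = 1" "hinner \<eta>2 \<eta>2 = 1" "hinner \<xi>1 \<xi>1 = 1" "hinner \<xi>2 \<xi>2 = 1"
    using unit by (simp_all add: hinner_self)
  have orth': "hinner \<eta>2 \<eta>1 = 0" "hinner \<xi>2 \<xi>1 = 0"
    using orth by (simp_all add: hinner_eq_0_commute)
  have move: "rank1 (\<eta> *\<^sub>H d) \<xi>' \<in> K"
    if \<xi>: "rank1 \<eta> \<xi> \<in> K" "hinner \<xi> \<xi>'' \<noteq> 0" and \<xi>': "(\<xi>', \<xi>'') = (\<xi>1, \<xi>2) \<or> (\<xi>', \<xi>'') = (\<xi>2, \<xi>1)" for \<xi> \<xi>' \<xi>'' d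
  proof -
    have "rank1 (\<eta>1 *\<^sub>H c) \<xi>'' \<in> K" "rank1 (\<eta>1 *\<^sub>H c) \<xi>' \<in> K" for c
      using \<xi>' cross by auto
    \<comment> \<open>The inverse cancels the scalar that the triple product creates; its second
      term vanishes because \<xi>' and \<xi>'' are orthogonal.\<close>
    from this(1)[of 1] this(2) have "triple_product (rank1 \<eta> \<xi>) (rank1 \<eta>1 \<xi>'') (rank1 (\<eta>1 *\<^sub>H (inverse (hinner \<xi> \<xi>'') * d)) \<xi>') \<in> K"
      by (intro triple \<xi>(1)) simp_all
    moreover have "hinner \<xi>' \<xi>'' = 0"
      using \<xi>' orth orth' by auto
    ultimately have "(1/2) *\<^sub>R rank1 (\<eta> *\<^sub>H (hinner \<xi> \<xi>'' * (inverse (hinner \<xi> \<xi>'') * d))) \<xi>' \<in> K"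
      by (simp add: triple_product_rank1 hinner_scaleH_right self rank1_zero)
    moreover have "hinner \<xi> \<xi>'' * (inverse (hinner \<xi> \<xi>'') * d) = d"
      using \<xi>(2) by (simp flip: mult.assoc)
    ultimately show ?thesis
      by (simp add: double)
  qed
  consider "hinner \<xi> \<xi>2 \<noteq> 0" | "hinner \<xi> \<xi>1 \<noteq> 0" | "hinner \<xi> \<xi>1 = 0" "hinner \<xi> \<xi>2 = 0"
    by blast
  then show ?thesis
  proof cases
    case 1
    then show ?thesis
      using move r(1) by blast
  next
    case 2
    then have "rank1 (\<eta> *\<^sub>H 1) \<xi>2 \<in> K"
      using move r(1) by blast
    then show ?thesis
      using move[of \<xi>2 \<xi>2 \<xi>1 d] self by simp
  next
    case 3
    \<comment> \<open>Orthogonality of \<xi> to \<xi>1 kills the second term, so this triple product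
      projects the left vector onto the line of \<eta>'.\<close>
    have proj: "rank1 (\<eta>' *\<^sub>H hinner \<eta>' \<eta>) \<xi> \<in> K" if "rank1 \<eta>' \<xi>1 \<in> K" for \<eta>'
    proof -
      have "triple_product (rank1 \<eta>' \<xi>1) (rank1 \<eta>' \<xi>1) (rank1 \<eta> \<xi>) \<in> K"
        by (intro triple that r(1))
      then show ?thesis
        by (simp add: triple_product_rank1 self 3 rank1_zero double)
    qed
    define \<eta>' where "\<eta>' = \<eta> - \<eta>1 *\<^sub>H hinner \<eta>1 \<eta> - \<eta>2 *\<^sub>H hinner \<eta>2 \<eta>"
    have "\<eta> = \<eta>' + \<eta>1 *\<^sub>H hinner \<eta>1 \<eta> + \<eta>2 *\<^sub>H hinner \<eta>2 \<eta>"
      by (simp add: \<eta>'_def)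
    then have eq: "rank1 (\<eta> *\<^sub>H d) \<xi>' = rank1 (\<eta>' *\<^sub>H d) \<xi>' + rank1 (\<eta>1 *\<^sub>H (hinner \<eta>1 \<eta> * d)) \<xi>'
        + rank1 (\<eta>2 *\<^sub>H (hinner \<eta>2 \<eta> * d)) \<xi>'" for d and \<xi>' :: 'a
      by (metis rank1_add(1) scaleH_add_left scaleH_scaleH)
    have "rank1 (\<eta>' *\<^sub>H d) \<xi>1 \<in> K"
    proof (cases "\<eta>' = 0")
      case False
      have "rank1 (\<eta>1 *\<^sub>H hinner \<eta>1 \<eta>) \<xi> \<in> K" "rank1 (\<eta>2 *\<^sub>H hinner \<eta>2 \<eta>) \<xi> \<in> K"
        using cross(3)[of 1] by (intro proj in_K; simp)+
      then have "rank1 \<eta> \<xi> - rank1 (\<eta>1 *\<^sub>H hinner \<eta>1 \<eta>) \<xi> - rank1 (\<eta>2 *\<^sub>H hinner \<eta>2 \<eta>) \<xi> \<in> K"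
        by (intro subspace_diff sub r(1))
      then have "rank1 \<eta>' \<xi> \<in> K"
        using eq[of 1 \<xi>] by (simp add: algebra_simps)
      moreover have "hinner \<eta>1 \<eta>' = 0"
        using orth self unfolding \<eta>'_def by (simp add: hinner_diff_right hinner_scaleH_right)
      ultimately show ?thesis
        using cross_closedD(3)[OF K(2) in_K(1) _ nz(1,3) False r(3)] 3(1) hinner_eq_0_commute by blast
    qed (simp add: rank1_zero subspace_0[OF sub])
    then show ?thesis
      unfolding eq by (intro subspace_add sub cross)
  qed
qed

section \<open>From rank one operators in I to the inner ideal property\<close>

context smooth_subtriple
begin

lemma rank1_corner_in_I:
  assumes "e \<in> I" "e \<odot> e\<^sup>\<dagger> \<odot> e = e" "e\<^sup>\<dagger> \<cdot> e \<cdot> \<xi> = \<xi>"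
  shows "rank1 (e \<cdot> \<xi>) \<xi> \<in> I"
proof -
  have "e \<odot> (rank1 (e \<cdot> \<xi>) \<xi>)\<^sup>\<dagger> \<odot> e = rank1 (e \<cdot> \<xi>) \<xi>"
    by (simp add: rank1_compose compose_rank1 assms(3))
  then show ?thesis
    using herm_in_I[OF assms(1,2), of "rank1 (e \<cdot> \<xi>) \<xi>"] herm_eq_self[OF assms(2)] by simp
qed

text \<open>The vector \<xi>1 + \<xi>2 c lies in the initial space of both the sum and the
  difference of the two operators. The resulting rank one operators share their first row and have
  opposite second rows, so half their sum isolates the first row.\<close>

lemma off_diagonal_in_I:
  assumes unit: "norm \<eta>1 = 1" "norm \<eta>2 = 1" "norm \<xi>1 = 1" "norm \<xi>2 = 1"
    and orth: "hinner \<eta>1 \<eta>2 = 0" "hinner \<xi>1 \<xi>2 = 0"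
    and in_I: "rank1 \<eta>1 \<xi>1 \<in> I" "rank1 \<eta>2 \<xi>2 \<in> I"
  shows "rank1 (\<eta>1 *\<^sub>H c) \<xi>2 \<in> I" "rank1 (\<eta>2 *\<^sub>H c) \<xi>1 \<in> I"
proof -
  have self: "hinner \<eta>1 \<eta>1 = 1" "hinner \<eta>2 \<eta>2 = 1" "hinner \<xi>1 \<xi>1 = 1" "hinner \<xi>2 \<xi>2 = 1"
    using unit by (simp_all add: hinner_self)
  have orth': "hinner \<eta>2 \<eta>1 = 0" "hinner \<xi>2 \<xi>1 = 0"
    using orth by (simp_all add: hinner_eq_0_commute)
  note simps = self orth orth' hinner_add_right hinner_diff_right hinner_scaleH_right
  define r11 where "r11 = rank1 \<eta>1 \<xi>1"
  define r12 where "r12 c = rank1 (\<eta>1 *\<^sub>H c) \<xi>2" for c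
  define r21 where "r21 c = rank1 (\<eta>2 *\<^sub>H c) \<xi>1" for c
  \<comment> \<open>The scalar in the lower diagonal entry is c times its conjugate, hence real; so
    this entry is in I by linearity.\<close>
  define r22 where "r22 c = qnorm2 c *\<^sub>R rank1 \<eta>2 \<xi>2" for c
  have r22_eq: "rank1 (\<eta>2 *\<^sub>H c) (\<xi>2 *\<^sub>H c) = r22 c" for c
    by (simp add: r22_def rank1_scaleH qcnj_mult_self scaleH_of_real rank1_scaleR flip: scaleH_scaleH)
  have diag: "r11 \<in> I" "r22 c \<in> I" for c
    using in_I subspace_scale[OF subspace_I] by (simp_all add: r11_def r22_def)
  have plus: "r11 + r12 (qcnj c) + (r21 c + r22 c) \<in> I" for c
  proof -
    define e where "e = rank1 \<eta>1 \<xi>1 + rank1 \<eta>2 \<xi>2"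
    have "e \<odot> e\<^sup>\<dagger> \<odot> e = e"
      by (rule hop_eqI) (simp add: e_def simps)
    moreover have "e\<^sup>\<dagger> \<cdot> e \<cdot> (\<xi>1 + \<xi>2 *\<^sub>H c) = \<xi>1 + \<xi>2 *\<^sub>H c"
      by (simp add: e_def simps)
    moreover have "e \<in> I"
      unfolding e_def by (intro subspace_add subspace_I in_I)
    ultimately have "rank1 (e \<cdot> (\<xi>1 + \<xi>2 *\<^sub>H c)) (\<xi>1 + \<xi>2 *\<^sub>H c) \<in> I"
      by (intro rank1_corner_in_I)
    also have "e \<cdot> (\<xi>1 + \<xi>2 *\<^sub>H c) = \<eta>1 + \<eta>2 *\<^sub>H c"
      by (simp add: e_def simps)
    finally have "rank1 \<eta>1 \<xi>1 + rank1 (\<eta>2 *\<^sub>H c) \<xi>1 + (rank1 \<eta>1 (\<xi>2 *\<^sub>H c) + rank1 (\<eta>2 *\<^sub>H c) (\<xi>2 *\<^sub>H c)) \<in> I"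
      by (simp only: rank1_add)
    then show ?thesis
      unfolding r22_eq by (simp add: r11_def r12_def r21_def rank1_scaleH algebra_simps)
  qed
  have minus: "r11 + r12 (qcnj c) - (r21 c + r22 c) \<in> I" for c
  proof -
    define e where "e = rank1 \<eta>1 \<xi>1 - rank1 \<eta>2 \<xi>2"
    have "e \<odot> e\<^sup>\<dagger> \<odot> e = e"
      by (rule hop_eqI) (simp add: e_def simps)
    moreover have "e\<^sup>\<dagger> \<cdot> e \<cdot> (\<xi>1 + \<xi>2 *\<^sub>H c) = \<xi>1 + \<xi>2 *\<^sub>H c"
      by (simp add: e_def simps)
    moreover have "e \<in> I"
      unfolding e_def by (intro subspace_diff subspace_I in_I)
    ultimately have "rank1 (e \<cdot> (\<xi>1 + \<xi>2 *\<^sub>H c)) (\<xi>1 + \<xi>2 *\<^sub>H c) \<in> I"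
      by (intro rank1_corner_in_I)
    also have "e \<cdot> (\<xi>1 + \<xi>2 *\<^sub>H c) = \<eta>1 + (- 1) *\<^sub>R (\<eta>2 *\<^sub>H c)"
      by (simp add: e_def simps scaleH_minus)
    finally have "rank1 \<eta>1 \<xi>1 + (- 1) *\<^sub>R rank1 (\<eta>2 *\<^sub>H c) \<xi>1 + (rank1 \<eta>1 (\<xi>2 *\<^sub>H c) + (- 1) *\<^sub>R rank1 (\<eta>2 *\<^sub>H c) (\<xi>2 *\<^sub>H c)) \<in> I"
      by (simp only: rank1_add rank1_scaleR)
    then show ?thesis
      unfolding r22_eq by (simp add: r11_def r12_def r21_def rank1_scaleH algebra_simps)
  qed
  have "(1/2) *\<^sub>R ((r11 + r12 (qcnj c) + (r21 c + r22 c)) + (r11 + r12 (qcnj c) - (r21 c + r22 c))) - r11 \<in> I" for c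
    by (intro subspace_diff subspace_scale subspace_add subspace_I plus minus diag)
  then have 12: "r12 (qcnj c) \<in> I" for c
    by (simp flip: scaleR_2)
  then show "rank1 (\<eta>1 *\<^sub>H c) \<xi>2 \<in> I"
    using 12[of "qcnj c"] by (simp add: r12_def)
  have "(r11 + r12 (qcnj c) + (r21 c + r22 c)) - r11 - r12 (qcnj c) - r22 c \<in> I"
    by (intro subspace_diff subspace_I plus 12 diag)
  then show "rank1 (\<eta>2 *\<^sub>H c) \<xi>1 \<in> I"
    by (simp add: r21_def)
qed

lemma cross_closed_I: "cross_closed I"
  unfolding cross_closed_def
proof (intro allI impI)
  fix \<eta>1 \<xi>1 \<eta>2 \<xi>2 c
  assume in_I: "rank1 \<eta>1 \<xi>1 \<in> I" "rank1 \<eta>2 \<xi>2 \<in> I" and nz: "\<eta>1 \<noteq> 0" "\<xi>1 \<noteq> 0" "\<eta>2 \<noteq> 0" "\<xi>2 \<noteq> 0"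
    and orth: "hinner \<eta>1 \<eta>2 = 0" "hinner \<xi>1 \<xi>2 = 0"
  have sgn_in: "rank1 (sgn \<eta>) (sgn \<xi>) \<in> I" if "rank1 \<eta> \<xi> \<in> I" for \<eta> \<xi>
    using that by (simp add: sgn_div_norm rank1_scaleR subspace_scale[OF subspace_I])
  have unsgn: "rank1 (\<eta> *\<^sub>H c) \<xi> \<in> I" if "\<And>c. rank1 (sgn \<eta> *\<^sub>H c) (sgn \<xi>) \<in> I" "\<eta> \<noteq> 0" "\<xi> \<noteq> 0" for \<eta> \<xi> c
  proof -
    have "rank1 (\<eta> *\<^sub>H c) \<xi> = (norm \<eta> * norm \<xi>) *\<^sub>R rank1 (sgn \<eta> *\<^sub>H c) (sgn \<xi>)"
      using that(2,3) by (simp add: sgn_div_norm scaleH_scaleR rank1_scaleR divide_simps)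
    then show ?thesis
      using that(1) subspace_scale[OF subspace_I] by simp
  qed
  have norm: "norm (sgn \<eta>1) = 1" "norm (sgn \<eta>2) = 1" "norm (sgn \<xi>1) = 1" "norm (sgn \<xi>2) = 1"
    using nz by (simp_all add: norm_sgn)
  note off = off_diagonal_in_I[OF norm hinner_sgn[OF orth(1)] hinner_sgn[OF orth(2)] sgn_in[OF in_I(1)] sgn_in[OF in_I(2)]]
  have "hinner (sgn \<xi>2) (sgn \<xi>1) = 0"
    using hinner_sgn[OF orth(2)] hinner_eq_0_commute by blast
  \<comment> \<open>Applied to the antidiagonal pair, whose off-diagonal entries are the diagonal
    ones.\<close>
  then have "rank1 (sgn \<eta>1 *\<^sub>H c) (sgn \<xi>1) \<in> I" for c
    using off_diagonal_in_I(1)[OF norm(1,2,4,3) hinner_sgn[OF orth(1)]] off[of 1] by simp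
  then show "rank1 (\<eta>1 *\<^sub>H c) \<xi>1 \<in> I \<and> rank1 (\<eta>1 *\<^sub>H c) \<xi>2 \<in> I"
    using unsgn[OF _ nz(1,2)] unsgn[OF off(1) nz(1,4)] by blast
qed

text \<open>The minimal extension of the matrix coefficient restricted to I is normed by a tripotent
  u of I, so the coefficient of u itself is nonzero. Cutting u down to the initial-space part of
  \<xi> keeps its value at \<xi> in view.\<close>

lemma detecting_rank1:
  assumes "a \<in> I" "inner \<eta> (a \<cdot> \<xi>) \<noteq> 0"
  shows "\<exists>\<rho> \<zeta>. rank1 \<rho> \<zeta> \<in> I \<and> inner \<eta> \<rho> \<noteq> 0 \<and> inner \<zeta> \<xi> \<noteq> 0"
proof -
  obtain f b where f: "f \<in> F" "\<And>z. z \<in> I \<Longrightarrow> blinfun_apply f z = blinfun_apply (matrix_coeff \<eta> \<xi>) z"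
    and b: "b \<in> I" "norm b \<le> 1" "blinfun_apply f b = norm f"
    using norm_attaining_extension[OF matrix_coeff_in_F[of \<eta> \<xi>]] by metis
  have "\<exists>u\<in>I. norm u \<le> 1 \<and> u \<odot> u\<^sup>\<dagger> \<odot> u = u \<and> blinfun_apply f u = norm f"
  proof (rule norming_tripotent[OF f(1) b(3,1,2)])
    show "cube x \<in> I" if "x \<in> I" for x
      unfolding cube_def using that by (rule sandwich_in_I[OF that])
  qed (rule I_limit)
  then obtain u where u: "u \<in> I" "u \<odot> u\<^sup>\<dagger> \<odot> u = u" "blinfun_apply f u = norm f"
    by blast
  have "blinfun_apply f a \<noteq> 0"
    using f(2)[OF assms(1)] assms(2) by simp
  then have "norm f \<noteq> 0"
    by (auto simp: blinfun.zero_left)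
  then have nz: "inner \<eta> (u \<cdot> \<xi>) \<noteq> 0"
    using u f(2)[OF u(1)] by simp
  define \<zeta> where "\<zeta> = u\<^sup>\<dagger> \<cdot> u \<cdot> \<xi>"
  have "rank1 (u \<cdot> \<zeta>) \<zeta> \<in> I"
    by (rule rank1_corner_in_I[OF u(1,2)]) (simp add: \<zeta>_def tripotent_apply[OF u(2)])
  moreover have "u \<cdot> \<zeta> = u \<cdot> \<xi>"
    by (simp add: \<zeta>_def tripotent_apply[OF u(2)])
  moreover have "inner \<zeta> \<xi> = inner (u \<cdot> \<xi>) (u \<cdot> \<xi>)"
    by (simp add: \<zeta>_def inner_hop_right)
  then have "inner \<zeta> \<xi> \<noteq> 0"
    using nz by auto
  ultimately show ?thesis
    using nz by metis
qed

text \<open>Orthogonality is tested only within I. Testing with x makes the square of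
  \<open>x \<odot> y\<^sup>\<dagger>\<close> zero; testing with a rank one element shows that this
  operator maps the left vector into its own line. Hence it kills such vectors, and by
  \<open>detecting_rank1\<close> the whole range of I.\<close>

lemma orthogonal_imp_disjoint_supports:
  assumes xy: "x \<in> I" "y \<in> I" "triple_orthogonal I x y"
  shows "x \<odot> y\<^sup>\<dagger> = 0" "y\<^sup>\<dagger> \<odot> x = 0"
proof -
  have triple: "triple_product x y z = 0" if "z \<in> I" for z
    using xy(3) that by (simp add: triple_orthogonal_def)
  have xyx: "x \<cdot> y\<^sup>\<dagger> \<cdot> x \<cdot> v = 0" for v
    using triple[OF xy(1)] by (metis triple_product_same hop_compose_apply hop_apply_simps(11))
  have kill: "x \<cdot> y\<^sup>\<dagger> \<cdot> \<rho> = 0" if r: "rank1 \<rho> \<zeta> \<in> I" "\<zeta> \<noteq> 0" for \<rho> \<zeta>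
  proof -
    have "triple_product x y (rank1 \<rho> \<zeta>) \<cdot> \<zeta> = 0"
      using triple[OF r(1)] by simp
    then have "(norm \<zeta>)\<^sup>2 *\<^sub>R (x \<cdot> y\<^sup>\<dagger> \<cdot> \<rho>) + \<rho> *\<^sub>H hinner \<zeta> (y\<^sup>\<dagger> \<cdot> x \<cdot> \<zeta>) = 0"
      by (simp add: triple_product_apply hinner_self scaleH_of_real del: of_real_power)
    then have "(norm \<zeta>)\<^sup>2 *\<^sub>R (x \<cdot> y\<^sup>\<dagger> \<cdot> \<rho>) = \<rho> *\<^sub>H (- hinner \<zeta> (y\<^sup>\<dagger> \<cdot> x \<cdot> \<zeta>))"
      by (simp add: scaleH_minus_right eq_neg_iff_add_eq_0)
    then obtain c where c: "(norm \<zeta>)\<^sup>2 *\<^sub>R (x \<cdot> y\<^sup>\<dagger> \<cdot> \<rho>) = \<rho> *\<^sub>H c"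
      by blast
    \<comment> \<open>On the line of \<rho> the operator acts, up to a positive factor, as
      multiplication by c, so its square being zero forces the product of \<rho> and c to be
      0.\<close>
    have "(\<rho> *\<^sub>H c) *\<^sub>H c = (norm \<zeta>)\<^sup>2 *\<^sub>R (x \<cdot> y\<^sup>\<dagger> \<cdot> (\<rho> *\<^sub>H c))"
      by (metis c scaleH_scaleR hop_apply_simps(6))
    also have "\<dots> = 0"
      by (simp add: xyx flip: c)
    finally have "\<rho> *\<^sub>H c = 0"
      by (auto simp: scaleH_eq_0_iff)
    then show ?thesis
      using c r(2) by simp
  qed
  have xya: "x \<cdot> y\<^sup>\<dagger> \<cdot> a \<cdot> \<xi> = 0" if a: "a \<in> I" for a \<xi>
  proof (rule ccontr)
    assume nz: "x \<cdot> y\<^sup>\<dagger> \<cdot> a \<cdot> \<xi> \<noteq> 0"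
    define \<eta> where "\<eta> = y \<cdot> x\<^sup>\<dagger> \<cdot> x \<cdot> y\<^sup>\<dagger> \<cdot> a \<cdot> \<xi>"
    have \<eta>: "inner \<eta> w = inner (x \<cdot> y\<^sup>\<dagger> \<cdot> a \<cdot> \<xi>) (x \<cdot> y\<^sup>\<dagger> \<cdot> w)" for w
      by (simp add: \<eta>_def inner_hop_right)
    have "inner \<eta> (a \<cdot> \<xi>) \<noteq> 0"
      using nz by (simp add: \<eta>)
    then obtain \<rho> \<zeta> where "rank1 \<rho> \<zeta> \<in> I" "inner \<eta> \<rho> \<noteq> 0" "inner \<zeta> \<xi> \<noteq> 0"
      using detecting_rank1[OF a] by blast
    moreover from this(3) have "\<zeta> \<noteq> 0"
      by auto
    ultimately show False
      using kill[of \<rho> \<zeta>] by (simp add: \<eta>)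
  qed
  have "x \<odot> y\<^sup>\<dagger> \<odot> y = 0"
    by (rule hop_eqI) (simp add: xya[OF xy(2)])
  then have "((x \<odot> y\<^sup>\<dagger>)\<^sup>\<dagger>)\<^sup>\<dagger> \<odot> (x \<odot> y\<^sup>\<dagger>)\<^sup>\<dagger> = 0"
    by (simp flip: hop_compose_assoc)
  then have "(x \<odot> y\<^sup>\<dagger>)\<^sup>\<dagger> = 0"
    by (rule hop_adjoint_self_0)
  then show "x \<odot> y\<^sup>\<dagger> = 0"
    by (metis hop_adjoint_adjoint hop_adjoint_simps(5))
  have "triple_product x y y \<cdot> v = (1/2) *\<^sub>R (y \<cdot> y\<^sup>\<dagger> \<cdot> x \<cdot> v)" for v
    by (simp add: triple_product_apply xya[OF xy(2)])
  then have "y \<odot> y\<^sup>\<dagger> \<odot> x = 0"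
    using triple[OF xy(2)] by (intro hop_eqI) simp
  then have "(y\<^sup>\<dagger> \<odot> x)\<^sup>\<dagger> \<odot> (y\<^sup>\<dagger> \<odot> x) = 0"
    by (simp add: hop_compose_assoc)
  then show "y\<^sup>\<dagger> \<odot> x = 0"
    by (rule hop_adjoint_self_0)
qed

text \<open>A rank one r in I that is detected against x is sandwiched twice between x. This
  confines its left and right vectors to the ranges of x and of its adjoint; choosing \<xi> in the
  range of the adjoint keeps both nonzero.\<close>

lemma rank1_supported_in:
  assumes x: "x \<in> I" "x \<noteq> 0"
  shows "\<exists>w z. rank1 (x \<cdot> w) (x\<^sup>\<dagger> \<cdot> z) \<in> I \<and> x \<cdot> w \<noteq> 0 \<and> x\<^sup>\<dagger> \<cdot> z \<noteq> 0"
proof -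
  have adj0: "w = 0" if "inner w w = 0" for w :: "'z::real_inner"
    using that by simp
  have xx: "x \<cdot> x\<^sup>\<dagger> \<cdot> w \<noteq> 0" if "x\<^sup>\<dagger> \<cdot> w \<noteq> 0" for w
    using that adj0[of "x\<^sup>\<dagger> \<cdot> w"] by (auto simp: inner_hop_left)
  have xx': "x\<^sup>\<dagger> \<cdot> x \<cdot> v \<noteq> 0" if "x \<cdot> v \<noteq> 0" for v
    using that adj0[of "x \<cdot> v"] by (auto simp: inner_hop_left)
  have "x\<^sup>\<dagger> \<noteq> 0"
    using x(2) by (metis hop_adjoint_adjoint hop_adjoint_simps(5))
  then obtain w0 where w0: "x\<^sup>\<dagger> \<cdot> w0 \<noteq> 0"
    by (metis hop_eqI hop_apply_simps(11))
  define \<xi> where "\<xi> = x\<^sup>\<dagger> \<cdot> w0"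
  have "inner (x \<cdot> \<xi>) (x \<cdot> \<xi>) \<noteq> 0"
    using xx[OF w0] by (simp add: \<xi>_def)
  then obtain \<rho> \<zeta> where r: "rank1 \<rho> \<zeta> \<in> I" "inner (x \<cdot> \<xi>) \<rho> \<noteq> 0" "inner \<zeta> \<xi> \<noteq> 0"
    using detecting_rank1[OF x(1)] by blast
  have "x \<odot> (x \<odot> (rank1 \<rho> \<zeta>)\<^sup>\<dagger> \<odot> x)\<^sup>\<dagger> \<odot> x \<in> I"
    by (intro sandwich_in_I x r)
  then have "rank1 (x \<cdot> x\<^sup>\<dagger> \<cdot> \<rho>) (x\<^sup>\<dagger> \<cdot> x \<cdot> \<zeta>) \<in> I"
    by (simp add: hop_compose_assoc rank1_compose compose_rank1)
  moreover have "x\<^sup>\<dagger> \<cdot> \<rho> \<noteq> 0"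
    using r(2) by (auto simp: inner_hop_left)
  then have "x \<cdot> x\<^sup>\<dagger> \<cdot> \<rho> \<noteq> 0"
    by (rule xx)
  moreover have "x \<cdot> \<zeta> \<noteq> 0"
    using r(3) by (auto simp: \<xi>_def inner_hop_right)
  then have "x\<^sup>\<dagger> \<cdot> x \<cdot> \<zeta> \<noteq> 0"
    by (rule xx')
  ultimately show ?thesis
    by blast
qed

lemma norm_closed_I: "closed I"
proof -
  have "I = (\<Inter>h\<in>{h \<in> F. \<forall>y\<in>I. blinfun_apply h y = 0}. {x. blinfun_apply h x = 0})"
  proof (intro equalityI subsetI)
    fix x assume "x \<in> (\<Inter>h\<in>{h \<in> F. \<forall>y\<in>I. blinfun_apply h y = 0}. {x. blinfun_apply h x = 0})"
    then show "x \<in> I"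
      by (intro in_I_by_annihilator) blast
  qed blast
  also have "closed \<dots>"
    by (intro closed_INT ballI closed_Collect_eq continuous_intros)
  finally show ?thesis .
qed

text \<open>For h annihilating I, the functional x |-> h (a \<open>x\<^sup>\<dagger>\<close> c) is
  in F and vanishes on rank one operators, hence everywhere; so rank one middle factors decide the
  general case.\<close>

lemma sandwich_of_any_in_I:
  fixes a b c :: "('p, 'q) hop"
  assumes rank1: "\<And>\<eta> \<xi>. rank1 (a \<cdot> \<xi>) (c\<^sup>\<dagger> \<cdot> \<eta>) \<in> I"
  shows "a \<odot> b\<^sup>\<dagger> \<odot> c \<in> I"
proof (rule in_I_by_annihilator)
  fix h assume h: "h \<in> F" "\<And>y. y \<in> I \<Longrightarrow> blinfun_apply h y = 0"
  obtain g where g: "g \<in> F" "\<And>x. blinfun_apply g x = blinfun_apply h (a \<odot> x\<^sup>\<dagger> \<odot> c)"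
    using adjoint_sandwich_in_F[OF h(1)] by blast
  have "blinfun_apply g (rank1 \<eta> \<xi>) = 0" for \<eta> \<xi>
    using h(2)[OF rank1] by (simp add: g(2) rank1_compose compose_rank1)
  then have "blinfun_apply g b = 0"
    by (rule F_zero_if_vanishes_on_rank1[OF g(1)])
  then show "blinfun_apply h (a \<odot> b\<^sup>\<dagger> \<odot> c) = 0"
    by (simp add: g(2))
qed

lemma inner_ideal_if_orthogonal_pair:
  assumes x: "x \<in> I" "x \<noteq> 0" and y: "y \<in> I" "y \<noteq> 0" and xy: "triple_orthogonal I x y"
  shows "inner_ideal I"
proof -
  note disjoint = orthogonal_imp_disjoint_supports[OF x(1) y(1) xy]
  obtain w z where wz: "rank1 (x \<cdot> w) (x\<^sup>\<dagger> \<cdot> z) \<in> I" "x \<cdot> w \<noteq> 0" "x\<^sup>\<dagger> \<cdot> z \<noteq> 0"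
    using rank1_supported_in[OF x] by blast
  obtain w' z' where wz': "rank1 (y \<cdot> w') (y\<^sup>\<dagger> \<cdot> z') \<in> I" "y \<cdot> w' \<noteq> 0" "y\<^sup>\<dagger> \<cdot> z' \<noteq> 0"
    using rank1_supported_in[OF y] by blast
  define \<eta>1 \<xi>1 \<eta>2 \<xi>2 where vecs: "\<eta>1 = sgn (x \<cdot> w)" "\<xi>1 = sgn (x\<^sup>\<dagger> \<cdot> z)" "\<eta>2 = sgn (y \<cdot> w')" "\<xi>2 = sgn (y\<^sup>\<dagger> \<cdot> z')"
  have unit: "norm \<eta>1 = 1" "norm \<eta>2 = 1" "norm \<xi>1 = 1" "norm \<xi>2 = 1"
    using wz wz' by (simp_all add: vecs norm_sgn)
  have "y\<^sup>\<dagger> \<cdot> x \<cdot> w = 0" "x \<cdot> y\<^sup>\<dagger> \<cdot> z' = 0"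
    using disjoint by (metis hop_compose_apply hop_apply_simps(11))+
  then have "hinner (y \<cdot> w') (x \<cdot> w) = 0" "hinner (x\<^sup>\<dagger> \<cdot> z) (y\<^sup>\<dagger> \<cdot> z') = 0"
    by (simp_all add: hop_adjoint_hinner)
  then have orth: "hinner \<eta>1 \<eta>2 = 0" "hinner \<xi>1 \<xi>2 = 0"
    unfolding vecs using hinner_eq_0_commute by (blast intro: hinner_sgn)+
  have in_I: "rank1 \<eta>1 \<xi>1 \<in> I" "rank1 \<eta>2 \<xi>2 \<in> I"
    unfolding vecs sgn_div_norm rank1_scaleR by (intro subspace_scale subspace_I wz wz')+
  have col: "rank1 (\<eta> *\<^sub>H d) \<xi>1 \<in> I" if "rank1 \<eta> \<xi> \<in> I" "\<eta> \<noteq> 0" "\<xi> \<noteq> 0" for \<eta> \<xi> d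
    by (rule rank1_range_in_column_space[OF subtriple_I cross_closed_I unit orth in_I that])
  have row: "rank1 \<eta>1 (\<xi> *\<^sub>H d) \<in> I" if "rank1 \<eta> \<xi> \<in> I" "\<eta> \<noteq> 0" "\<xi> \<noteq> 0" for \<eta> \<xi> d
    using rank1_range_in_column_space[OF subtriple_adjoint[OF subtriple_I] cross_closed_adjoint[OF cross_closed_I]
      unit(3,4,1,2) orth(2,1), of \<xi> \<eta> d] in_I that unfolding rank1_in_adjoint_iff by blast
  \<comment> \<open>V and W serve as final and initial space of I. Quantifying over d makes them
    stable under quaternions, although only real orthogonal projections onto them are used.\<close>
  define V where "V = {\<eta>. \<forall>d. rank1 (\<eta> *\<^sub>H d) \<xi>1 \<in> I}"
  define W where "W = {\<xi>. \<forall>d. rank1 \<eta>1 (\<xi> *\<^sub>H d) \<in> I}"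
  have bl1: "bounded_linear (\<lambda>\<eta>. rank1 (\<eta> *\<^sub>H d) \<xi>1)" for d
    using norm_rank1_le[of _ \<xi>1] unit
    by (intro bounded_linear_intro[of _ "sqrt (qnorm2 d)"])
      (auto simp: scaleH_add_left rank1_add scaleH_scaleR rank1_scaleR simp flip: norm_scaleH)
  have bl2: "bounded_linear (\<lambda>\<xi>. rank1 \<eta>1 (\<xi> *\<^sub>H d))" for d
    using norm_rank1_le[of \<eta>1] unit
    by (intro bounded_linear_intro[of _ "sqrt (qnorm2 d)"])
      (auto simp: scaleH_add_left rank1_add scaleH_scaleR rank1_scaleR simp flip: norm_scaleH)
  have V: "subspace V" "closed V"
  proof -
    have eq: "V = (\<Inter>d. (\<lambda>\<eta>. rank1 (\<eta> *\<^sub>H d) \<xi>1) -` I)"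
      by (auto simp: V_def)
    show "subspace V"
      unfolding eq by (intro subspace_Inter) (auto intro: linear_subspace_vimage bounded_linear.linear bl1 subspace_I)
    show "closed V"
      unfolding eq by (intro closed_INT ballI continuous_closed_vimage norm_closed_I linear_continuous_at bl1)
  qed
  have W: "subspace W" "closed W"
  proof -
    have eq: "W = (\<Inter>d. (\<lambda>\<xi>. rank1 \<eta>1 (\<xi> *\<^sub>H d)) -` I)"
      by (auto simp: W_def)
    show "subspace W"
      unfolding eq by (intro subspace_Inter) (auto intro: linear_subspace_vimage bounded_linear.linear bl2 subspace_I)
    show "closed W"
      unfolding eq by (intro closed_INT ballI continuous_closed_vimage norm_closed_I linear_continuous_at bl2)
  qed
  \<comment> \<open>A component of a \<xi> orthogonal to V would be detected by a rank one element
    of I, whose left vector is in V by \<open>col\<close>.\<close>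
  have range_V: "a \<cdot> \<xi> \<in> V" if a: "a \<in> I" for a \<xi>
  proof (rule ccontr)
    assume "a \<cdot> \<xi> \<notin> V"
    obtain v where v: "v \<in> V" "\<And>z. z \<in> V \<Longrightarrow> inner (a \<cdot> \<xi> - v) z = 0"
      using closed_subspace_projection[OF V] by metis
    define \<eta> where "\<eta> = a \<cdot> \<xi> - v"
    have "\<eta> \<noteq> 0"
      using v(1) \<open>a \<cdot> \<xi> \<notin> V\<close> by (auto simp: \<eta>_def)
    moreover have "inner \<eta> (a \<cdot> \<xi>) = inner \<eta> \<eta> + inner \<eta> v"
      by (simp add: \<eta>_def flip: inner_add_right)
    ultimately have "inner \<eta> (a \<cdot> \<xi>) \<noteq> 0"
      using v by (simp add: \<eta>_def)
    then obtain \<rho> \<zeta> where r: "rank1 \<rho> \<zeta> \<in> I" "inner \<eta> \<rho> \<noteq> 0" "inner \<zeta> \<xi> \<noteq> 0"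
      using detecting_rank1[OF a] by blast
    then have "\<rho> \<noteq> 0" "\<zeta> \<noteq> 0"
      by auto
    then have "\<rho> \<in> V"
      using col[OF r(1)] by (simp add: V_def)
    then show False
      using v(2) r(2) by (simp add: \<eta>_def)
  qed
  have range_W: "c\<^sup>\<dagger> \<cdot> \<eta> \<in> W" if c: "c \<in> I" for c \<eta>
  proof (rule ccontr)
    assume "c\<^sup>\<dagger> \<cdot> \<eta> \<notin> W"
    obtain v where v: "v \<in> W" "\<And>z. z \<in> W \<Longrightarrow> inner (c\<^sup>\<dagger> \<cdot> \<eta> - v) z = 0"
      using closed_subspace_projection[OF W] by metis
    define \<xi> where "\<xi> = c\<^sup>\<dagger> \<cdot> \<eta> - v"
    have "\<xi> \<noteq> 0"
      using v(1) \<open>c\<^sup>\<dagger> \<cdot> \<eta> \<notin> W\<close> by (auto simp: \<xi>_def)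
    moreover have "inner \<xi> (c\<^sup>\<dagger> \<cdot> \<eta>) = inner \<xi> \<xi> + inner \<xi> v"
      by (simp add: \<xi>_def flip: inner_add_right)
    ultimately have "inner \<xi> (c\<^sup>\<dagger> \<cdot> \<eta>) \<noteq> 0"
      using v by (simp add: \<xi>_def)
    then have "inner \<eta> (c \<cdot> \<xi>) \<noteq> 0"
      by (metis inner_commute inner_hop_left)
    then obtain \<rho> \<zeta> where r: "rank1 \<rho> \<zeta> \<in> I" "inner \<eta> \<rho> \<noteq> 0" "inner \<zeta> \<xi> \<noteq> 0"
      using detecting_rank1[OF c] by blast
    then have "\<rho> \<noteq> 0" "\<zeta> \<noteq> 0"
      by auto
    then have "\<zeta> \<in> W"
      using row[OF r(1)] by (simp add: W_def)
    then show False
      using v(2)[of \<zeta>] r(3) by (simp add: \<xi>_def inner_commute)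
  qed
  \<comment> \<open>One triple product through the corner \<eta>1, \<xi>1 yields half the wanted
    operator plus half an error term, which lies in I by \<open>col\<close>.\<close>
  have VW: "rank1 \<eta> \<xi> \<in> I" if "\<eta> \<in> V" "\<xi> \<in> W" for \<eta> \<xi>
  proof -
    have "rank1 (\<eta> *\<^sub>H 1) \<xi>1 \<in> I" "rank1 \<eta>1 (\<xi> *\<^sub>H 1) \<in> I"
      using that by (auto simp: V_def W_def simp del: scaleH_zero)
    then have "triple_product (rank1 \<eta> \<xi>1) (rank1 \<eta>1 \<xi>1) (rank1 \<eta>1 \<xi>) \<in> I"
      using in_I by (intro triple_in_I) auto
    moreover have "\<eta>1 \<noteq> 0" "\<xi>1 \<noteq> 0"
      using unit by auto
    then have "rank1 (\<eta>1 *\<^sub>H (hinner \<xi> \<xi>1 * hinner \<eta>1 \<eta>)) \<xi>1 \<in> I"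
      by (rule col[OF in_I(1)])
    ultimately have "2 *\<^sub>R triple_product (rank1 \<eta> \<xi>1) (rank1 \<eta>1 \<xi>1) (rank1 \<eta>1 \<xi>)
        - rank1 (\<eta>1 *\<^sub>H (hinner \<xi> \<xi>1 * hinner \<eta>1 \<eta>)) \<xi>1 \<in> I"
      by (intro subspace_diff subspace_scale subspace_I)
    then show ?thesis
      by (simp add: triple_product_rank1 hinner_self unit)
  qed
  have "a \<odot> b\<^sup>\<dagger> \<odot> c \<in> I" if "a \<in> I" "c \<in> I" for a b c
    using that by (intro sandwich_of_any_in_I VW range_V range_W)
  then have "triple_product a b c \<in> I" if "a \<in> I" "c \<in> I" for a b c
    unfolding triple_product_def using that by (intro subspace_scale subspace_add subspace_I)
  then show ?thesis
    using subtriple_I norm_closed_I by (simp add: inner_ideal_def)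
qed

end

text \<open>Without such a pair, orthogonal subsets have at most one element. S0 is a largest one,
  empty if I = 0, so its cardinality witnesses that the chosen \<open>triple_rank\<close> really is
  a rank, and bounds it below two.\<close>

lemma orthogonal_pair_of_rank:
  fixes I :: "('p::quat_hilbert, 'q::quat_hilbert) hop set"
  assumes "ctwo \<le>o triple_rank I"
  shows "\<exists>x\<in>I. \<exists>y\<in>I. x \<noteq> 0 \<and> y \<noteq> 0 \<and> triple_orthogonal I x y"
proof (rule ccontr)
  assume no: "\<not> ?thesis"
  define S0 where "S0 = (if I \<subseteq> {0} then {} else {SOME x. x \<in> I \<and> x \<noteq> 0})"
  have some: "(SOME x. x \<in> I \<and> x \<noteq> 0) \<in> I - {0}" if "\<not> I \<subseteq> {0}"
    using someI_ex[of "\<lambda>x. x \<in> I \<and> x \<noteq> 0"] that by auto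
  have S0: "orthogonal_subset I S0"
    using some by (auto simp: orthogonal_subset_def S0_def)
  have "|S| \<le>o |S0|" if S: "orthogonal_subset I S" for S
  proof (cases "S = {}")
    case False
    then obtain x where x: "x \<in> S"
      by auto
    have "y = x" if "y \<in> S" for y
    proof (rule ccontr)
      assume "y \<noteq> x"
      then have "x \<in> I" "y \<in> I" "x \<noteq> 0" "y \<noteq> 0" "triple_orthogonal I x y"
        using S x that unfolding orthogonal_subset_def by auto
      then show False
        using no by blast
    qed
    then have "S = {x}"
      using x by blast
    moreover have "S0 \<noteq> {}"
      using S x by (auto simp: S0_def orthogonal_subset_def)
    ultimately show ?thesis
      by (simp add: card_of_singl_ordLeq)
  qed (simp add: card_of_empty)
  then have "is_triple_rank I |S0|"
    using S0 by (auto simp: is_triple_rank_def card_of_Card_order)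
  then have "is_triple_rank I (triple_rank I)"
    unfolding triple_rank_def by (rule someI)
  then have "triple_rank I \<le>o |S0|"
    using \<open>is_triple_rank I |S0|\<close> unfolding is_triple_rank_def by blast
  then have "|UNIV :: bool set| \<le>o |S0|"
    using assms ordLeq_transitive unfolding ctwo_def by blast
  then obtain f :: "bool \<Rightarrow> ('p, 'q) hop" where "inj f" "range f \<subseteq> S0"
    unfolding card_of_ordLeq[symmetric] by blast
  then have "f True \<in> S0" "f False \<in> S0"
    by blast+
  then have "f True = f False"
    by (simp add: S0_def split: if_splits)
  then show False
    using \<open>inj f\<close> by (auto dest: injD)
qed

theorem proposition4p1:
  fixes I :: "('p::quat_hilbert, 'q::quat_hilbert) hop set"
    and C_predual :: "(('p, 'q) hop \<Rightarrow>\<^sub>L real) set"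
  assumes "ctwo \<le>o hdim TYPE('p)"
    and "hdim TYPE('p) \<le>o hdim TYPE('q)"
    and "isometric_predual C_predual"
    and "subtriple I"
    and "closedin (weak_star_topology C_predual) I"
    and "weak_star_HB_smooth C_predual I"
    and "ctwo \<le>o triple_rank I"
  shows "inner_ideal I"
proof -
  interpret smooth_subtriple C_predual I
    using assms(3-6) by unfold_locales
  show ?thesis
    using orthogonal_pair_of_rank[OF assms(7)] inner_ideal_if_orthogonal_pair by blast
qed

end
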